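(* Consider a diffusion $dX_t=b(t,X_t)dt+\sigma(t,X_t)dW_t$ on $\mathbb R^n$, $t\in[0,1]$, with a continuous nonnegative killing rate $V(t,x)$ that is not identically zero, and with $a(t,x)=\sigma(t,x)\sigma(t,x)'$ positive definite for all $(t,x)$. Let $\rho_0,\rho_1$ be absolutely continuous with respect to Lebesgue measure, with densities (also denoted $\rho_0,\rho_1$) satisfying $\rho_0,\rho_1\ge 0$, $\int\rho_0=1$ and $\int\rho_1\le 1$. Assume that the transition kernel (fundamental solution) $q$ of the killed diffusion is continuous and strictly positive on compact subsets. Then there exists a $4$-tuple $(\hat\varphi(t,x),\hat\psi(t),\varphi(t,x),\psi(t))$ of nonnegative functions, $t\in[0,1]$, $x\in\mathbb R^n$, satisfying the generalized Schrödinger system $$\partial_t\hat\varphi=-\nabla\cdot(b\hat\varphi)-V\hat\varphi+\tfrac12\sum_{i,j=1}^n\frac{\partial^2(a_{ij}\hat\varphi)}{\partial x_i\partial x_j},\qquad \frac{d\hat\psi}{dt}=\int_{\mathbb R^n}V(t,x)\hat\varphi(t,x)\,dx,$$ $$\partial_t\varphi=-b\cdot\nabla\varphi+V\varphi-\tfrac12\sum_{i,j=1}^n a_{ij}\frac{\partial^2\varphi}{\partial x_i\partial x_j}-V\psi,\qquad \frac{d\psi}{dt}=0,$$ $$\rho_0=\varphi(0,\cdot)\hat\varphi(0,\cdot),\quad \rho_1=\varphi(1,\cdot)\hat\varphi(1,\cdot),\quad \hat\psi(0)=0,\quad \psi(1)\hat\psi(1)=1-\int_{\mathbb R^n}\rho_1(x)\,dx,$$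 and this $4$-tuple is unique up to a constant positive scaling.
   Context: The kernel $q(s,x,t,y)$, $0\le s<t\le1$, is the fundamental solution of the Fokker-Planck equation with killing $\partial_t\hat\varphi=-\nabla\cdot(b\hat\varphi)-V\hat\varphi+\frac12\sum_{i,j}\partial^2_{x_ix_j}(a_{ij}\hat\varphi)$, i.e. $q(s,x,t,\cdot)$ is the (sub-probability) density of particles started at $x$ at time $s$ and still alive at time $t$. "Continuous and strictly positive on compact subsets" is a standing assumption, ensured by sufficient smoothness of the coefficients $b,V,a$. The differential equations are understood through $q$: with $\psi$ constant, $$\hat\varphi(t,x)=\int_{\mathbb R^n}q(0,x_0,t,x)\hat\varphi(0,x_0)\,dx_0\quad(0<t\le 1),\qquad \hat\psi(t)=\int_0^t\!\int_{\mathbb R^n}V(s,x)\hat\varphi(s,x)\,dx\,ds,$$ $$\varphi(t,x)=\int_{\mathbb R^n}q(t,x,1,y)\varphi(1,y)\,dy+\psi\int_t^1\!\int_{\mathbb R^n}q(t,x,s,y)V(s,y)\,dy\,ds\quad(0\le t<1).$$ "Unique up to a constant positive scaling" means that any two solutions are related by $(\hat\varphi,\hat\psi,\varphi,\psi)\mapsto(\kappa\hat\varphi,\kappa\hat\psi,\kappa^{-1}\varphi,\kappa^{-1}\psi)$ for some constant $\kappa>0$ (functions of $x$ being identified when equal almost everywhere).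
   Formalization: The nonnegative functions may take the value +∞ (with 0·∞=0), since finite-valued solutions need not exist (e.g. Brownian motion, ρ₁ uniform on [-1,1], ρ₀ with polynomial tails); ψ and, almost everywhere, the product of φ̂ and φ are required to be finite. *)

theory Defs
  imports "HOL-Analysis.Analysis"
begin

definition partial_derivative :: "'n::finite \<Rightarrow> (real ^ 'n \<Rightarrow> real) \<Rightarrow> real ^ 'n \<Rightarrow> real"
  where "partial_derivative i f x = frechet_derivative f (at x) (axis i 1)"

definition twice_differentiable :: "(real ^ 'n::finite \<Rightarrow> real) \<Rightarrow> bool"
  where "twice_differentiable f \<longleftrightarrow>
    (\<forall>x. f differentiable (at x)) \<and>
    (\<forall>i x. partial_derivative i f differentiable (at x))"

definition positive_definite :: "real ^ 'n ^ 'n::finite \<Rightarrow> bool"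
  where "positive_definite A \<longleftrightarrow> transpose A = A \<and> (\<forall>v. v \<noteq> 0 \<longrightarrow> 0 < v \<bullet> (A *v v))"

definition diffusion_matrix ::
    "(real \<Rightarrow> real ^ 'n::finite \<Rightarrow> real ^ 'm::finite ^ 'n) \<Rightarrow> real \<Rightarrow> real ^ 'n \<Rightarrow> real ^ 'n ^ 'n"
  where "diffusion_matrix \<sigma> t x = \<sigma> t x ** transpose (\<sigma> t x)"

definition fokker_planck_operator ::
    "(real \<Rightarrow> real ^ 'n::finite \<Rightarrow> real ^ 'n) \<Rightarrow> (real \<Rightarrow> real ^ 'n \<Rightarrow> real) \<Rightarrow>
     (real \<Rightarrow> real ^ 'n \<Rightarrow> real ^ 'n ^ 'n) \<Rightarrow> real \<Rightarrow> (real ^ 'n \<Rightarrow> real) \<Rightarrow> real ^ 'n \<Rightarrow> real"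
  where "fokker_planck_operator b V a t p x =
    - (\<Sum>i\<in>UNIV. partial_derivative i (\<lambda>z. b t z $ i * p z) x)
    - V t x * p x
    + 1/2 * (\<Sum>i\<in>UNIV. \<Sum>j\<in>UNIV.
        partial_derivative i (partial_derivative j (\<lambda>z. a t z $ i $ j * p z)) x)"

text \<open>A kernel \<open>q s x t y\<close> is only meaningful for \<open>0 \<le> s < t \<le> 1\<close>. Since
  \<^const>\<open>partial_derivative\<close> is total, the classical equation comes with explicit
  differentiability requirements. The last clause says that the initial datum at time \<open>s\<close> is
  the unit mass at \<open>x\<close>.\<close>

definition fundamental_solution ::
    "(real \<Rightarrow> real ^ 'n::finite \<Rightarrow> real ^ 'n) \<Rightarrow> (real \<Rightarrow> real ^ 'n \<Rightarrow> real) \<Rightarrow>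
     (real \<Rightarrow> real ^ 'n \<Rightarrow> real ^ 'n ^ 'n) \<Rightarrow>
     (real \<Rightarrow> real ^ 'n \<Rightarrow> real \<Rightarrow> real ^ 'n \<Rightarrow> real) \<Rightarrow> bool"
  where "fundamental_solution b V a q \<longleftrightarrow>
    (\<forall>s x t. 0 \<le> s \<and> s < t \<and> t \<le> 1 \<longrightarrow>
      (\<forall>i y. (\<lambda>z. b t z $ i * q s x t z) differentiable (at y)) \<and>
      (\<forall>i j. twice_differentiable (\<lambda>z. a t z $ i $ j * q s x t z)) \<and>
      (\<forall>y. ((\<lambda>r. q s x r y) has_real_derivative
              fokker_planck_operator b V a t (q s x t) y) (at t within {s<..1}))) \<and>
    (\<forall>s x f. 0 \<le> s \<and> s < 1 \<and> continuous_on UNIV f \<and> bounded (range f) \<longrightarrow>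
      ((\<lambda>t. \<integral>y. q s x t y * f y \<partial>lborel) \<longlongrightarrow> f x) (at_right s))"

text \<open>The probabilistic content of \<open>q s x t\<close> being the density at time \<open>t\<close> of the surviving
  particles started at \<open>x\<close> at time \<open>s\<close>: it is nonnegative; a particle is at time \<open>t\<close> either
  alive or has been killed, at rate \<open>V\<close>, at some time \<open>r\<close> between \<open>s\<close> and \<open>t\<close> (so \<open>q s x t\<close> is a
  sub-probability density, mass being lost only through killing); and the Chapman-Kolmogorov
  equation holds.\<close>

definition killed_transition_density ::
    "(real \<Rightarrow> real ^ 'n::finite \<Rightarrow> real) \<Rightarrow>
     (real \<Rightarrow> real ^ 'n \<Rightarrow> real \<Rightarrow> real ^ 'n \<Rightarrow> real) \<Rightarrow> bool"
  where "killed_transition_density V q \<longleftrightarrow>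
    (\<forall>s x t y. 0 \<le> s \<and> s < t \<and> t \<le> 1 \<longrightarrow> 0 \<le> q s x t y) \<and>
    (\<forall>s x t. 0 \<le> s \<and> s < t \<and> t \<le> 1 \<longrightarrow>
      (\<integral>\<^sup>+y. ennreal (q s x t y) \<partial>lborel) +
      (\<integral>\<^sup>+r\<in>{s..t}. (\<integral>\<^sup>+y. ennreal (q s x r y) * ennreal (V r y) \<partial>lborel) \<partial>lborel) = 1) \<and>
    (\<forall>s x r t. 0 \<le> s \<and> s < r \<and> r < t \<and> t \<le> 1 \<longrightarrow>
      (AE y in lborel.
        (\<integral>\<^sup>+z. ennreal (q s x r z) * ennreal (q r z t y) \<partial>lborel) = ennreal (q s x t y)))"

text \<open>The generalized Schroedinger system, with its differential equations read through \<open>q\<close>.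
  The unknowns \<open>(\<phi>h, \<psi>h, \<phi>, \<psi>)\<close> take values in \<open>[0, \<infinity>]\<close>, with \<open>0 * \<infinity> = 0\<close>: infinite values
  cannot be excluded. For instance, if \<open>b = 0\<close>, \<open>\<sigma> = 1\<close>, \<open>V\<close> has compact support, \<open>\<rho>1\<close> has mass
  \<open>1\<close> and support \<open>[-1, 1]\<close> and \<open>\<rho>0\<close> has polynomial tails, then \<open>\<phi>h 1 x = \<infinity>\<close> for \<open>\<bar>x\<bar> > 1\<close>;
  and if instead \<open>V\<close> is a positive constant, then \<open>\<psi>h t = \<infinity>\<close> for \<open>t > 0\<close>, while \<open>\<psi> = 0\<close>.
  What is always finite is the constant \<open>\<psi>\<close> and, almost everywhere, the density
  \<open>\<phi>h t x * \<phi> t x\<close>; this is required.\<close>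

definition schroedinger_system ::
    "(real \<Rightarrow> real ^ 'n::finite \<Rightarrow> real) \<Rightarrow>
     (real \<Rightarrow> real ^ 'n \<Rightarrow> real \<Rightarrow> real ^ 'n \<Rightarrow> real) \<Rightarrow>
     (real ^ 'n \<Rightarrow> real) \<Rightarrow> (real ^ 'n \<Rightarrow> real) \<Rightarrow>
     (real \<Rightarrow> real ^ 'n \<Rightarrow> ennreal) \<Rightarrow> (real \<Rightarrow> ennreal) \<Rightarrow>
     (real \<Rightarrow> real ^ 'n \<Rightarrow> ennreal) \<Rightarrow> (real \<Rightarrow> ennreal) \<Rightarrow> bool"
  where "schroedinger_system V q \<rho>0 \<rho>1 \<phi>h \<psi>h \<phi> \<psi> \<longleftrightarrow>
    (\<forall>t\<in>{0..1}. \<phi>h t \<in> borel_measurable borel \<and> \<phi> t \<in> borel_measurable borel) \<and>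
    (\<forall>t\<in>{0..1}. \<psi> t < \<infinity> \<and> (AE x in lborel. \<phi>h t x * \<phi> t x < \<infinity>)) \<and>
    (\<forall>t\<in>{0<..1}. \<forall>x.
      \<phi>h t x = (\<integral>\<^sup>+x0. ennreal (q 0 x0 t x) * \<phi>h 0 x0 \<partial>lborel)) \<and>
    (\<forall>t\<in>{0..1}.
      \<psi>h t = (\<integral>\<^sup>+s\<in>{0..t}. (\<integral>\<^sup>+x. ennreal (V s x) * \<phi>h s x \<partial>lborel) \<partial>lborel)) \<and>
    (\<forall>t\<in>{0..<1}. \<forall>x.
      \<phi> t x = (\<integral>\<^sup>+y. ennreal (q t x 1 y) * \<phi> 1 y \<partial>lborel) +
        \<psi> t * (\<integral>\<^sup>+s\<in>{t..1}. (\<integral>\<^sup>+y. ennreal (q t x s y) * ennreal (V s y) \<partial>lborel) \<partial>lborel)) \<and>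
    (\<forall>t\<in>{0..1}. \<psi> t = \<psi> 0) \<and>
    (AE x in lborel. ennreal (\<rho>0 x) = \<phi> 0 x * \<phi>h 0 x) \<and>
    (AE x in lborel. ennreal (\<rho>1 x) = \<phi> 1 x * \<phi>h 1 x) \<and>
    \<psi>h 0 = 0 \<and>
    \<psi> 1 * \<psi>h 1 = ennreal (1 - (\<integral>x. \<rho>1 x \<partial>lborel))"

end

theory Submission
  imports Defs "HOL-Probability.Probability_Measure"
begin

text \<open>Let \<open>f = \<phi>h 0\<close> and \<open>g = \<phi> 1\<close>. A killed particle is sent to a cemetery, so that \<open>q 0 x 1 y\<close>
  together with the killing probability becomes a positive transition kernel \<open>p\<close> into the extended
  space. The system then says that the measure \<open>f x * p x y * g y\<close> has the prescribed marginals: it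
  is a Schroedinger system for \<open>p\<close>, with \<open>\<psi>\<close> the value of \<open>g\<close> at the cemetery. It is solved first
  for kernels bounded above and below, by a monotone iteration in the spirit of Fortet. In general
  \<open>p\<close> is modified outside an exhaustion by sets on which it is bounded; the integrals
  \<open>\<integral> p x y * g y\<close> over these sets converge along a subsequence, and tightness of the marginals turns
  this into \<open>L\<^sup>1\<close> convergence of \<open>f\<close> and \<open>g\<close>. Uniqueness follows by comparing two couplings with the
  same marginals.\<close>

section \<open>Schroedinger systems for bounded kernels\<close>

text \<open>The prescribed marginals serve as the reference measures \<open>M\<close> and
  \<open>N\<close>; this absorbs the data, so that both right-hand sides become \<open>1\<close> and
  the two variables play symmetric roles. Two obstacles shape the existence proof: a positive
  continuous kernel on an unbounded space has no global bounds, and the equations are products of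
  two unknown sequences, for which weak convergence is not enough. One factor is therefore recovered
  from the other: on a bounded set \<open>F n\<close> differs from the reciprocal of a truncated
  integral of \<open>G n\<close> by an error controlled by the mass that leaves the truncation. The
  error is uniform in \<open>n\<close> because the masses are read off from the fixed marginals. A
  subsequence is extracted only for functions of the first variable, where the kernel is continuous;
  strong convergence of \<open>F n\<close> then settles the integrals that determine
  \<open>G n\<close>. For the diffusion, the local bounds require the killing probability to be
  positive and continuous in the starting point, which has to be derived. Uniqueness compares
  couplings through bounded weights, so that no logarithm or entropy has to be integrable.\<close>

definition schroedinger_pair ::
    "'a measure \<Rightarrow> 'b measure \<Rightarrow> ('a \<Rightarrow> 'b \<Rightarrow> real) \<Rightarrow> ('a \<Rightarrow> real) \<Rightarrow> ('b \<Rightarrow> real) \<Rightarrow> bool"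
  where "schroedinger_pair M N p F G \<longleftrightarrow>
    F \<in> borel_measurable M \<and> G \<in> borel_measurable N \<and> (\<forall>x. 0 \<le> F x) \<and> (\<forall>y. 0 \<le> G y) \<and>
    (AE x in M. ennreal (F x) * (\<integral>\<^sup>+y. ennreal (p x y * G y) \<partial>N) = 1) \<and>
    (AE y in N. ennreal (G y) * (\<integral>\<^sup>+x. ennreal (p x y * F x) \<partial>M) = 1)"

lemma (in prob_space) integral_bounds:
  fixes f :: "'a \<Rightarrow> real"
  assumes "f \<in> borel_measurable M" "\<And>x. l \<le> f x" "\<And>x. f x \<le> u"
  shows "integrable M f" "l \<le> integral\<^sup>L M f" "integral\<^sup>L M f \<le> u"
proof -
  have "\<bar>f x\<bar> \<le> \<bar>l\<bar> + \<bar>u\<bar>" for x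
    using assms(2,3)[of x] by linarith
  then show int: "integrable M f"
    by (intro integrable_const_bound[of _ "\<bar>l\<bar> + \<bar>u\<bar>"] assms(1)) auto
  show "l \<le> integral\<^sup>L M f" "integral\<^sup>L M f \<le> u"
    using integral_ge_const[OF int, of l] integral_le_const[OF int, of u] assms by auto
qed

lemma (in finite_measure) bounded_convergence:
  fixes f :: "nat \<Rightarrow> 'a \<Rightarrow> real"
  assumes "\<And>n. f n \<in> borel_measurable M" "\<And>n x. \<bar>f n x\<bar> \<le> K" "\<And>x. (\<lambda>n. f n x) \<longlonglongrightarrow> g x"
  shows "(\<lambda>n. integral\<^sup>L M (f n)) \<longlonglongrightarrow> integral\<^sup>L M g"
proof (rule integral_dominated_convergence[where w = "\<lambda>_. K"])
  show "g \<in> borel_measurable M"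
    by (rule borel_measurable_LIMSEQ_real[OF assms(3,1)])
qed (use assms in auto)

text \<open>With \<open>H = 1 / F\<close> the system reads \<open>\<Omega> H = H\<close> for a monotone operator \<open>\<Omega>\<close>, and
  \<open>\<integral> \<Omega> H / H = 1\<close> for every \<open>H\<close>; hence \<open>\<Omega> H \<le> H\<close> or \<open>\<Omega> H \<ge> H\<close> already implies equality a.e. Clamp
  \<open>\<Omega>\<close> between \<open>c / C\<close> and \<open>1\<close> and iterate downwards from \<open>1\<close> to a fixed point \<open>H\<close> of the clamped
  operator. As \<open>p\<close> varies by at most the factor \<open>C / c\<close>, only one of the two bounds can be active.\<close>

lemma bounded_kernel_schroedinger_pair:
  fixes M :: "'a measure" and N :: "'b measure" and p :: "'a \<Rightarrow> 'b \<Rightarrow> real"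
  assumes "prob_space M" "prob_space N" and [simp]: "space M = UNIV" "space N = UNIV"
    and p_meas: "(\<lambda>(x, y). p x y) \<in> borel_measurable (M \<Otimes>\<^sub>M N)"
    and c: "0 < c" and p_ge: "\<And>x y. c \<le> p x y" and p_le: "\<And>x y. p x y \<le> C"
  obtains F G K where "F \<in> borel_measurable M" "G \<in> borel_measurable N"
    "\<And>x. 0 < F x \<and> F x \<le> K" "\<And>y. 0 < G y \<and> G y \<le> K"
    "\<And>x. F x * (\<integral>y. p x y * G y \<partial>N) = 1" "\<And>y. G y * (\<integral>x. p x y * F x \<partial>M) = 1"
proof -
  interpret M: prob_space M by fact
  interpret N: prob_space N by fact
  interpret MN: pair_prob_space M N ..
  note [measurable] = p_meas
  have C: "0 < C" and cC: "c \<le> C"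
    using c p_ge p_le by (meson order_trans less_le_trans)+
  define \<epsilon> where "\<epsilon> = c / C"
  have \<epsilon>: "0 < \<epsilon>" "\<epsilon> \<le> 1"
    using c C cC by (auto simp: \<epsilon>_def)
  have px: "p x y \<ge> 0" for x y
    using c p_ge[of x y] by linarith
  have [measurable]: "p x \<in> borel_measurable N" "(\<lambda>x. p x y) \<in> borel_measurable M" for x y
    using measurable_Pair2[OF p_meas, of x] measurable_Pair1[OF p_meas, of y] by simp_all

  define S where "S H y = (\<integral>x. p x y / H x \<partial>M)" for H y
  define \<Omega> where "\<Omega> H x = (\<integral>y. p x y / S H y \<partial>N)" for H x
  define W where "W = {H \<in> borel_measurable M. \<forall>x. \<epsilon> \<le> H x \<and> H x \<le> (1::real)}"
  define T where "T H x = max \<epsilon> (min 1 (\<Omega> H x))" for H x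
  have W_meas[measurable_dest]: "H \<in> W \<Longrightarrow> H \<in> borel_measurable M" for H
    by (simp add: W_def)
  have W_D: "\<epsilon> \<le> H x" "H x \<le> 1" "0 < H x" if "H \<in> W" for H x
    using that \<epsilon> by (auto simp: W_def intro: less_le_trans)
  have pW: "c \<le> p x y / H x" "p x y / H x \<le> C / \<epsilon>" if "H \<in> W" for H x y
  proof -
    have "c \<le> p x y / 1" using p_ge by simp
    also have "\<dots> \<le> p x y / H x" using W_D[OF that] px by (intro divide_left_mono) auto
    finally show "c \<le> p x y / H x" .
    show "p x y / H x \<le> C / \<epsilon>" using W_D[OF that] \<epsilon> C p_le by (intro frac_le) auto
  qed
  have S_int: "integrable M (\<lambda>x. p x y / H x)"
    and S_ge: "c \<le> S H y" and S_le: "S H y \<le> C / \<epsilon>" if [measurable]: "H \<in> W" for H y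
    unfolding S_def using pW[OF that] by (auto intro!: M.integral_bounds)
  have S_pos: "0 < S H y" if "H \<in> W" for H y
    using S_ge[OF that, of y] c by linarith
  have S_meas[measurable]: "S H \<in> borel_measurable N" if "H \<in> W" for H
    using W_meas[OF that] unfolding S_def by measurable
  define l u where "l = c / (C / \<epsilon>)" and "u = C / c"
  have l: "0 < l" using c C \<epsilon> by (auto simp: l_def)
  have pS: "l \<le> p x y / S H y" "p x y / S H y \<le> u" if "H \<in> W" for H x y
    unfolding l_def u_def
    by (rule frac_le; use S_ge[OF that] S_le[OF that] S_pos[OF that] c C p_ge p_le px in \<open>simp add: less_imp_le\<close>)+
  have \<Omega>_int: "integrable N (\<lambda>y. p x y / S H y)"
    and \<Omega>_ge: "l \<le> \<Omega> H x" and \<Omega>_le: "\<Omega> H x \<le> u" if [measurable]: "H \<in> W" for H x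
    unfolding \<Omega>_def using pS[OF that] S_meas[OF that] by (auto intro!: N.integral_bounds)
  have \<Omega>_meas[measurable]: "\<Omega> H \<in> borel_measurable M" if "H \<in> W" for H
    using S_meas[OF that] unfolding \<Omega>_def by measurable
  have T_W: "T H \<in> W" if [measurable]: "H \<in> W" for H
    unfolding T_def W_def using \<epsilon> by auto
  have S_mono: "S H' y \<le> S H y" if "H \<in> W" "H' \<in> W" "\<And>x. H x \<le> H' x" for H H' y
    unfolding S_def using that S_int px W_D
    by (intro integral_mono) (auto intro!: divide_left_mono)
  have \<Omega>_mono: "\<Omega> H x \<le> \<Omega> H' x" if "H \<in> W" "H' \<in> W" "\<And>x. H x \<le> H' x" for H H' x
    unfolding \<Omega>_def using that \<Omega>_int px S_pos S_mono[OF that]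
    by (intro integral_mono) (auto intro!: divide_left_mono)
  have T_mono: "T H x \<le> T H' x" if "H \<in> W" "H' \<in> W" "\<And>x. H x \<le> H' x" for H H' x
    unfolding T_def using \<Omega>_mono[OF that, of x] by auto

  define h where "h n = (T ^^ n) (\<lambda>_. 1)" for n
  have h_Suc: "h (Suc n) = T (h n)" for n
    by (simp add: h_def)
  have hW[measurable]: "h n \<in> W" for n
  proof (induction n)
    case 0 then show ?case using \<epsilon> by (auto simp: h_def W_def)
  qed (simp add: h_Suc T_W)
  have h_dec: "h (Suc n) x \<le> h n x" for n x
  proof (induction n arbitrary: x)
    case 0 then show ?case using W_D(2)[OF hW[of "Suc 0"]] by (simp add: h_def)
  next
    case (Suc n) then show ?case by (subst (1 2) h_Suc) (intro T_mono hW)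
  qed
  define H where "H x = lim (\<lambda>n. h n x)" for x
  have h_lim: "(\<lambda>n. h n x) \<longlonglongrightarrow> H x" for x
  proof -
    have "decseq (\<lambda>n. h n x)" using h_dec by (auto intro: decseq_SucI)
    then obtain L where "(\<lambda>n. h n x) \<longlonglongrightarrow> L"
      using decseq_convergent[of "\<lambda>n. h n x" \<epsilon>] W_D(1)[OF hW] by metis
    then show ?thesis unfolding H_def by (simp add: limI)
  qed
  have HW[measurable]: "H \<in> W"
    unfolding W_def
  proof (intro CollectI conjI allI)
    show "H \<in> borel_measurable M"
      by (rule borel_measurable_LIMSEQ_real[OF h_lim]) measurable
    show "\<epsilon> \<le> H x" "H x \<le> 1" for x
      using W_D[OF hW] by (auto intro!: LIMSEQ_le_const[OF h_lim] LIMSEQ_le_const2[OF h_lim])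
  qed
  have S_lim: "(\<lambda>n. S (h n) y) \<longlonglongrightarrow> S H y" for y
    unfolding S_def
  proof (rule M.bounded_convergence[where K = "C / \<epsilon>"])
    show "(\<lambda>n. p x y / h n x) \<longlonglongrightarrow> p x y / H x" for x
      using W_D(3)[OF HW, of x] by (intro tendsto_intros h_lim) auto
    show "\<bar>p x y / h n x\<bar> \<le> C / \<epsilon>" for n x
      using pW[OF hW, of x y n] c by auto
  qed measurable
  have \<Omega>_lim: "(\<lambda>n. \<Omega> (h n) x) \<longlonglongrightarrow> \<Omega> H x" for x
    unfolding \<Omega>_def
  proof (rule N.bounded_convergence[where K = u])
    show "(\<lambda>n. p x y / S (h n) y) \<longlonglongrightarrow> p x y / S H y" for y
      using S_pos[OF HW, of y] by (intro tendsto_intros S_lim) auto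
    show "\<bar>p x y / S (h n) y\<bar> \<le> u" for n y
      using pS[OF hW, of x y n] l by auto
  qed measurable
  have H_fix: "H x = max \<epsilon> (min 1 (\<Omega> H x))" for x
  proof (rule LIMSEQ_unique)
    show "(\<lambda>n. h (Suc n) x) \<longlonglongrightarrow> H x"
      by (rule LIMSEQ_Suc[OF h_lim])
    show "(\<lambda>n. h (Suc n) x) \<longlonglongrightarrow> max \<epsilon> (min 1 (\<Omega> H x))"
      unfolding h_Suc T_def by (intro tendsto_intros \<Omega>_lim)
  qed

  have total: "(\<integral>x. \<Omega> H x / H x \<partial>M) = 1"
  proof -
    have "(\<integral>x. \<Omega> H x / H x \<partial>M) = (\<integral>x. \<integral>y. p x y / S H y / H x \<partial>N \<partial>M)"
      by (simp only: \<Omega>_def integral_divide_zero)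
    also have "\<dots> = (\<integral>y. \<integral>x. p x y / S H y / H x \<partial>M \<partial>N)"
    proof (rule MN.Fubini_integral[symmetric])
      have "\<bar>p x y / S H y / H x\<bar> \<le> u / \<epsilon>" for x y
        unfolding abs_divide[of "p x y / S H y"]
        by (rule frac_le; use pS[OF HW, of x y] W_D[OF HW, of x] l \<epsilon> in linarith)
      moreover note [measurable] = W_meas[OF HW] S_meas[OF HW]
      ultimately show "integrable (M \<Otimes>\<^sub>M N) (\<lambda>(x, y). p x y / S H y / H x)"
        by (intro MN.integrable_const_bound[of _ "u / \<epsilon>"]) auto
    qed
    also have "\<dots> = (\<integral>y. \<integral>x. p x y / H x / S H y \<partial>M \<partial>N)"
      by (simp add: mult.commute)
    also have "\<dots> = (\<integral>y. S H y / S H y \<partial>N)"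
      by (simp only: S_def integral_divide_zero)
    also have "\<dots> = (\<integral>y. 1 \<partial>N)"
      using S_pos[OF HW] by (simp add: less_imp_neq[symmetric])
    finally show ?thesis by (simp add: N.prob_space[simplified])
  qed
  \<comment> \<open>The integral of a non-integrable function is \<open>0\<close> by convention, so
    the value \<open>1\<close> proves integrability.\<close>
  have int: "integrable M (\<lambda>x. \<Omega> H x / H x)"
    using total not_integrable_integral_eq by fastforce
  have "AE x in M. \<Omega> H x = H x"
  proof (cases "\<forall>x. \<Omega> H x \<le> 1")
    case True
    then have le: "\<Omega> H x / H x \<le> 1" for x
      using H_fix[of x] W_D(3)[OF HW, of x] by (auto simp: divide_le_eq)
    have "AE x in M. \<Omega> H x / H x = 1"
      by (rule integral_ineq_eq_0_then_AE) (use le int total in \<open>auto simp: M.prob_space[simplified]\<close>)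
    then show ?thesis
      by eventually_elim (use W_D(3)[OF HW] in \<open>simp add: divide_eq_eq split: if_splits\<close>)
  next
    case False
    then obtain x' where x': "1 < \<Omega> H x'" by (auto simp: not_le)
    \<comment> \<open>The single number \<open>g\<close> controls all values:
      \<open>c * g \<le> \<Omega> H x \<le> C * g\<close>. A value above \<open>1\<close> gives
      \<open>g > 1 / C\<close>, hence \<open>\<Omega> H \<ge> c / C = \<epsilon>\<close> everywhere,
      and the lower clamp is idle.\<close>
    define g where "g = (\<integral>y. 1 / S H y \<partial>N)"
    have g_int: "integrable N (\<lambda>y. 1 / S H y)"
      using S_ge[OF HW] S_pos[OF HW] c
      by (intro N.integrable_const_bound[of _ "1 / c"]) (auto intro!: frac_le simp: less_imp_le)
    have "\<Omega> H x' \<le> (\<integral>y. C * (1 / S H y) \<partial>N)"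
      unfolding \<Omega>_def using S_pos[OF HW] p_le
      by (intro integral_mono[OF \<Omega>_int[OF HW] integrable_mult_right[OF g_int]]) (auto intro!: divide_right_mono simp: less_imp_le)
    then have "1 < C * g" using x' unfolding integral_mult_right_zero g_def by linarith
    then have g: "1 / C < g" using C by (simp add: field_simps)
    have "\<epsilon> \<le> \<Omega> H x" for x
    proof -
      have "\<epsilon> \<le> c * g" using mult_left_mono[of "1 / C" g c] g c by (simp add: \<epsilon>_def)
      also have "\<dots> = (\<integral>y. c * (1 / S H y) \<partial>N)" by (simp only: g_def integral_mult_right_zero)
      also have "\<dots> \<le> \<Omega> H x"
        unfolding \<Omega>_def using S_pos[OF HW] p_ge
        by (intro integral_mono[OF integrable_mult_right[OF g_int] \<Omega>_int[OF HW]]) (auto intro!: divide_right_mono simp: less_imp_le)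
      finally show ?thesis .
    qed
    then have ge: "1 \<le> \<Omega> H x / H x" for x
      using H_fix[of x] W_D(3)[OF HW, of x] by (auto simp: le_divide_eq)
    have "AE x in M. 1 = \<Omega> H x / H x"
      by (rule integral_ineq_eq_0_then_AE) (use ge int total in \<open>auto simp: M.prob_space[simplified]\<close>)
    then show ?thesis
      by eventually_elim (use W_D(3)[OF HW] in \<open>auto simp: eq_divide_eq split: if_splits\<close>)
  qed
  \<comment> \<open>As \<open>\<Omega> H = H\<close> holds only almost everywhere, the solution is
    taken to be \<open>1 / \<Omega> H\<close> and not \<open>1 / H\<close>. The integral
    \<open>S H\<close> stays the same, and both equations then hold at every point.\<close>
  then have S_eq: "S H y = (\<integral>x. p x y / \<Omega> H x \<partial>M)" for y
    unfolding S_def by (intro integral_cong_AE) auto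
  show ?thesis
  proof
    show "(\<lambda>x. 1 / \<Omega> H x) \<in> borel_measurable M" "(\<lambda>y. 1 / S H y) \<in> borel_measurable N"
      by measurable
    have \<Omega>0: "0 < \<Omega> H x" for x using \<Omega>_ge[OF HW, of x] l by linarith
    show "0 < 1 / \<Omega> H x \<and> 1 / \<Omega> H x \<le> max (1 / l) (1 / c)" for x
      using \<Omega>0[of x] \<Omega>_ge[OF HW, of x] l by (auto intro!: le_max_iff_disj[THEN iffD2] frac_le)
    show "0 < 1 / S H y \<and> 1 / S H y \<le> max (1 / l) (1 / c)" for y
      using S_pos[OF HW, of y] S_ge[OF HW, of y] c by (auto intro!: le_max_iff_disj[THEN iffD2] frac_le)
    show "1 / \<Omega> H x * (\<integral>y. p x y * (1 / S H y) \<partial>N) = 1" for x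
      using \<Omega>0[of x] by (simp add: \<Omega>_def)
    show "1 / S H y * (\<integral>x. p x y * (1 / \<Omega> H x) \<partial>M) = 1" for y
      using S_pos[OF HW, of y] S_eq[of y] by simp
  qed
qed

section \<open>Existence\<close>

text \<open>First \<open>k\<close> is chosen to make \<open>b k\<close> small, then \<open>n\<close>
  is sent to infinity in \<open>c k\<close>. In the application \<open>b\<close> is an error uniform
  in \<open>n\<close>, and \<open>c\<close> one that vanishes for each fixed truncation
  \<open>k\<close>.\<close>

lemma tendsto_zero_via_double_limit:
  fixes a :: "nat \<Rightarrow> real"
  assumes "\<And>n. 0 \<le> a n" "\<And>k. (l::nat) \<le> k \<Longrightarrow> \<forall>\<^sub>F n in sequentially. a n \<le> b k + c k n"
    "b \<longlonglongrightarrow> 0" "\<And>k. k \<ge> l \<Longrightarrow> c k \<longlonglongrightarrow> 0"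
  shows "a \<longlonglongrightarrow> 0"
proof (rule order_tendstoI)
  fix e :: real assume e: "0 < e"
  have "\<forall>\<^sub>F k in sequentially. k \<ge> l \<and> b k < e / 2"
    using order_tendstoD(2)[OF assms(3), of "e / 2"] e
    by (intro eventually_conj eventually_ge_at_top) auto
  then obtain k where k: "k \<ge> l" "b k < e / 2"
    by (auto simp: eventually_sequentially)
  have "\<forall>\<^sub>F n in sequentially. c k n < e / 2"
    using order_tendstoD(2)[OF assms(4)[OF k(1)], of "e / 2"] e by auto
  with assms(2)[OF k(1)] show "\<forall>\<^sub>F n in sequentially. a n < e"
    by eventually_elim (use k in linarith)
qed (use assms(1) in \<open>auto intro: always_eventually less_le_trans\<close>)

text \<open>In the applications \<open>U n k x = (\<integral>y\<in>B k. p x y * G n y)\<close> with \<open>B k\<close> exhausting the second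
  space, so \<open>1 - F n x * U n k x\<close> is the mass that the \<open>n\<close>-th coupling puts beyond \<open>B k\<close>: the
  tightness of its marginals is what makes \<open>F n\<close> converge strongly.\<close>

lemma reciprocal_limit:
  fixes M :: "'a measure" and F :: "nat \<Rightarrow> 'a \<Rightarrow> real" and U :: "nat \<Rightarrow> nat \<Rightarrow> 'a \<Rightarrow> real"
    and U' :: "nat \<Rightarrow> 'a \<Rightarrow> real" and A :: "nat \<Rightarrow> 'a set"
  assumes "finite_measure M"
    and A: "\<And>j. A j \<in> sets M" "incseq A" "(\<Union>j. A j) = space M"
    and F_meas: "\<And>n. F n \<in> borel_measurable M" and F_nonneg: "\<And>n x. 0 \<le> F n x"
    and U_meas: "\<And>n k. U n k \<in> borel_measurable M"
    and U_mono: "\<And>n k k' x. k \<le> k' \<Longrightarrow> U n k x \<le> U n k' x"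
    and FU_le: "\<And>n k x. k \<le> n \<Longrightarrow> x \<in> A k \<Longrightarrow> F n x * U n k x \<le> 1"
    and FU_int: "\<And>n k j. j \<le> k \<Longrightarrow> k \<le> n \<Longrightarrow> (\<integral>x\<in>A j. (1 - F n x * U n k x) \<partial>M) \<le> d k"
    and d: "d \<longlonglongrightarrow> 0"
    and u: "\<And>j. 0 < u j" "\<And>n k j x. j \<le> k \<Longrightarrow> k \<le> n \<Longrightarrow> x \<in> A j \<Longrightarrow> u j \<le> U n k x"
    and w: "\<And>n k x. k \<le> n \<Longrightarrow> x \<in> A k \<Longrightarrow> U n k x \<le> w k"
    and U_lim: "\<And>k x. x \<in> A k \<Longrightarrow> (\<lambda>n. U n k x) \<longlonglongrightarrow> U' k x"
  obtains F' where "F' \<in> borel_measurable M" "\<And>x. 0 \<le> F' x" "\<And>j x. x \<in> A j \<Longrightarrow> F' x \<le> 1 / u j"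
    "\<And>x. x \<in> space M \<Longrightarrow> (\<lambda>k. 1 / U' k x) \<longlonglongrightarrow> F' x"
    "\<And>j. (\<lambda>n. \<integral>x\<in>A j. \<bar>F n x - F' x\<bar> \<partial>M) \<longlonglongrightarrow> 0"
    "AE x in M. (\<lambda>k. F' x * U' k x) \<longlonglongrightarrow> 1"
proof -
  interpret finite_measure M by fact
  note [measurable] = A(1) F_meas U_meas
  have A_mono: "x \<in> A k" if "x \<in> A j" "j \<le> k" for x j k
    using that A(2) by (auto simp: incseq_def)
  \<comment> \<open>The limit \<open>U' k\<close> is known only on \<open>A k\<close>; the filler
    \<open>1\<close> elsewhere makes \<open>U'' k\<close> a pointwise limit on the whole space,
    hence measurable.\<close>
  define U'' where "U'' k x = (if x \<in> A k then U' k x else 1)" for k x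
  have U''_meas[measurable]: "U'' k \<in> borel_measurable M" for k
  proof (rule borel_measurable_LIMSEQ_real)
    show "(\<lambda>n. if x \<in> A k then U n k x else 1) \<longlonglongrightarrow> U'' k x" for x
      using U_lim by (auto simp: U''_def)
  qed measurable
  have U'_ge: "u j \<le> U' k x" if "x \<in> A j" "j \<le> k" for j k x
    by (rule LIMSEQ_le_const[OF U_lim]) (use that A_mono u(2) in \<open>auto intro!: exI[of _ k]\<close>)
  have U'_pos: "0 < U' k x" if "x \<in> A j" "j \<le> k" for j k x
    using U'_ge[OF that] u(1)[of j] by linarith
  have U'_mono: "U' k x \<le> U' k' x" if "x \<in> A k" "k \<le> k'" for k k' x
    by (rule LIMSEQ_le[OF U_lim U_lim]) (use that A_mono U_mono in auto)
  \<comment> \<open>As \<open>U' k x\<close> increases with the truncation,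
    \<open>1 / U' k x\<close> decreases as soon as \<open>x \<in> A k\<close>, so the limit
    exists.\<close>
  define F' where "F' x = (if x \<in> space M then lim (\<lambda>k. 1 / U'' k x) else 0)" for x
  have ev: "\<forall>\<^sub>F k in sequentially. U'' k x = U' k x" if x: "x \<in> space M" for x
  proof -
    obtain j where "x \<in> A j" using A(3) x by auto
    then have "U'' k x = U' k x" if "j \<le> k" for k
      using that A_mono by (auto simp: U''_def)
    then show ?thesis by (auto simp: eventually_sequentially)
  qed
  have F'_lim: "(\<lambda>k. 1 / U' k x) \<longlonglongrightarrow> F' x" "F' x \<le> 1 / U' k x" if x: "x \<in> space M" "x \<in> A k" for x k
  proof -
    have dec: "decseq (\<lambda>i. 1 / U' (i + k) x)"
      using x A_mono by (intro decseq_SucI) (auto intro!: frac_le U'_pos[of x k] U'_mono)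
    moreover have "\<And>i. 0 \<le> 1 / U' (i + k) x"
      using U'_pos[OF x(2)] by (simp add: less_imp_le)
    ultimately obtain L where L: "(\<lambda>i. 1 / U' (i + k) x) \<longlonglongrightarrow> L"
      using decseq_convergent[of "\<lambda>i. 1 / U' (i + k) x" 0] by metis
    then have L': "(\<lambda>k. 1 / U' k x) \<longlonglongrightarrow> L"
      by (rule LIMSEQ_offset)
    then have "(\<lambda>k. 1 / U'' k x) \<longlonglongrightarrow> L"
      by (rule Lim_transform_eventually) (use ev[OF x(1)] in eventually_elim, simp)
    then have "F' x = L"
      using x by (simp add: F'_def limI)
    with L' show "(\<lambda>k. 1 / U' k x) \<longlonglongrightarrow> F' x" by simp
    show "F' x \<le> 1 / U' k x"
      using decseq_ge[OF dec L, of 0] \<open>F' x = L\<close> by simp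
  qed
  have F'_lim': "(\<lambda>k. 1 / U' k x) \<longlonglongrightarrow> F' x" if x: "x \<in> space M" for x
    using A(3) F'_lim(1) x by auto
  have F'_meas[measurable]: "F' \<in> borel_measurable M"
    unfolding F'_def by measurable
  have F'_nonneg: "0 \<le> F' x" for x
  proof (cases "x \<in> space M")
    case True
    then obtain j where j: "x \<in> A j" using A(3) by auto
    show ?thesis
      by (rule LIMSEQ_le_const[OF F'_lim'[OF True]])
        (use U'_pos[OF j] in \<open>auto intro!: exI[of _ j] simp: less_imp_le\<close>)
  qed (simp add: F'_def)
  have sA: "x \<in> A j \<Longrightarrow> x \<in> space M" for x j
    using A(3) by auto
  have F'_le: "F' x \<le> 1 / u j" if "x \<in> A j" for j x
    using F'_lim(2)[OF sA[OF that] that] U'_ge[OF that order_refl] u(1)[of j]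
    by (smt (verit) frac_le)
  have F_le: "F n x \<le> 1 / u j" if "x \<in> A j" "j \<le> n" for n j x
  proof -
    have "F n x * u j \<le> F n x * U n j x"
      using u(2)[OF order_refl that(2,1)] F_nonneg by (intro mult_left_mono) auto
    also have "\<dots> \<le> 1" using FU_le that by auto
    finally show ?thesis using u(1)[of j] by (simp add: field_simps)
  qed
  have int: "integrable M (\<lambda>x. indicator (A j) x *\<^sub>R f x)"
    if "f \<in> borel_measurable M" "\<And>x. x \<in> A j \<Longrightarrow> \<bar>f x\<bar> \<le> K" for f :: "'a \<Rightarrow> real" and j K
    by (rule integrable_const_bound[of _ "max K 0"])
      (use that in \<open>auto simp: indicator_def le_max_iff_disj\<close>)
  \<comment> \<open>Dominated convergence on \<open>A j\<close> for a bound that holds only from the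
    index \<open>m\<close> on; the sequence is shifted by \<open>m\<close>.\<close>
  have lim0: "(\<lambda>n. \<integral>x\<in>A j. f n x \<partial>M) \<longlonglongrightarrow> (\<integral>x\<in>A j. g x \<partial>M)"
    if f: "\<And>n. f n \<in> borel_measurable M" "\<And>n x. n \<ge> m \<Longrightarrow> x \<in> A j \<Longrightarrow> \<bar>f n x\<bar> \<le> K"
      "\<And>x. x \<in> A j \<Longrightarrow> (\<lambda>n. f n x) \<longlonglongrightarrow> g x" for f :: "nat \<Rightarrow> 'a \<Rightarrow> real" and g j K m
    unfolding set_lebesgue_integral_def
  proof (rule LIMSEQ_offset[of _ m], rule bounded_convergence[where K = "max K 0"])
    show "\<bar>indicator (A j) x *\<^sub>R f (n + m) x\<bar> \<le> max K 0" for n x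
      using f(2)[of "n + m" x] by (auto simp: indicator_def le_max_iff_disj)
    show "(\<lambda>n. indicator (A j) x *\<^sub>R f (n + m) x) \<longlonglongrightarrow> indicator (A j) x *\<^sub>R g x" for x
      using LIMSEQ_ignore_initial_segment[OF f(3), of x m] by (auto simp: indicator_def)
  qed (use f(1) in measurable)
  have U''_eq: "U'' k x = U' k x" if "x \<in> A j" "j \<le> k" for j k x
    using that A_mono by (auto simp: U''_def)
  have inv_u: "0 \<le> 1 / z" "1 / z \<le> 1 / u j" if "u j \<le> z" for j z
    using u(1)[of j] that by (auto intro!: frac_le)
  have diff: "\<bar>a - a'\<bar> \<le> 2 / u j" if "0 \<le> a" "a \<le> 1 / u j" "0 \<le> a'" "a' \<le> 1 / u j" for a a' j
  proof -
    have "2 / u j = 1 / u j + 1 / u j" by simp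
    then show ?thesis using that by linarith
  qed

  \<comment> \<open>\<open>F n\<close> is compared with \<open>F'\<close> through
    \<open>1 / U n k\<close> and \<open>1 / U' k\<close>. The first distance is at most
    \<open>(1 - F n x * U n k x) / u j\<close>, with integral at most \<open>d k / u j\<close> for
    all \<open>n \<ge> k\<close>; the second vanishes as \<open>n\<close> grows with
    \<open>k\<close> fixed, the third as \<open>k\<close> grows.\<close>
  have conv: "(\<lambda>n. \<integral>x\<in>A j. \<bar>F n x - F' x\<bar> \<partial>M) \<longlonglongrightarrow> 0" for j
  proof (rule tendsto_zero_via_double_limit[where l = j
        and b = "\<lambda>k. d k / u j + (\<integral>x\<in>A j. \<bar>1 / U'' k x - F' x\<bar> \<partial>M)"
        and c = "\<lambda>k n. \<integral>x\<in>A j. \<bar>1 / U n k x - 1 / U'' k x\<bar> \<partial>M"])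
    show "0 \<le> (\<integral>x\<in>A j. \<bar>F n x - F' x\<bar> \<partial>M)" for n
      unfolding set_lebesgue_integral_def by (intro integral_nonneg_AE) auto
    have "(\<lambda>k. \<integral>x\<in>A j. \<bar>1 / U'' k x - F' x\<bar> \<partial>M) \<longlonglongrightarrow> (\<integral>x\<in>A j. 0 \<partial>M)"
    proof (rule lim0[where m = j and K = "2 / u j"])
      fix x assume x: "x \<in> A j"
      have "(\<lambda>k. 1 / U'' k x) \<longlonglongrightarrow> F' x"
        by (rule Lim_transform_eventually[OF F'_lim(1)[OF sA[OF x] x]])
          (use ev[OF sA[OF x]] in eventually_elim, simp)
      then show "(\<lambda>k. \<bar>1 / U'' k x - F' x\<bar>) \<longlonglongrightarrow> 0"
        using tendsto_rabs_zero LIM_zero by blast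
      show "\<bar>\<bar>1 / U'' k x - F' x\<bar>\<bar> \<le> 2 / u j" if "j \<le> k" for k
        unfolding U''_eq[OF x that] abs_abs
        by (rule diff[OF inv_u[OF U'_ge[OF x that]] F'_nonneg F'_le[OF x]])
    qed measurable
    then show "(\<lambda>k. d k / u j + (\<integral>x\<in>A j. \<bar>1 / U'' k x - F' x\<bar> \<partial>M)) \<longlonglongrightarrow> 0"
      using tendsto_add[OF tendsto_divide[OF d tendsto_const[of "u j"]]] u(1)[of j]
      by (fastforce simp: set_lebesgue_integral_def)
    fix k assume jk: "k \<ge> j"
    have "(\<lambda>n. \<integral>x\<in>A j. \<bar>1 / U n k x - 1 / U'' k x\<bar> \<partial>M) \<longlonglongrightarrow> (\<integral>x\<in>A j. 0 \<partial>M)"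
    proof (rule lim0[where m = k and K = "2 / u j"])
      fix x assume x: "x \<in> A j"
      have "(\<lambda>n. 1 / U n k x) \<longlonglongrightarrow> 1 / U'' k x"
        using U_lim[OF A_mono[OF x jk]] U''_eq[OF x jk] U'_pos[OF x jk] by (auto intro!: tendsto_intros)
      then show "(\<lambda>n. \<bar>1 / U n k x - 1 / U'' k x\<bar>) \<longlonglongrightarrow> 0"
        using tendsto_rabs_zero LIM_zero by blast
      show "\<bar>\<bar>1 / U n k x - 1 / U'' k x\<bar>\<bar> \<le> 2 / u j" if "k \<le> n" for n
        unfolding U''_eq[OF x jk] abs_abs
        by (rule diff[OF inv_u[OF u(2)[OF jk that x]] inv_u[OF U'_ge[OF x jk]]])
    qed measurable
    then show "(\<lambda>n. \<integral>x\<in>A j. \<bar>1 / U n k x - 1 / U'' k x\<bar> \<partial>M) \<longlonglongrightarrow> 0"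
      by (simp add: set_lebesgue_integral_def)
    have "(\<integral>x\<in>A j. \<bar>F n x - F' x\<bar> \<partial>M) \<le> d k / u j + (\<integral>x\<in>A j. \<bar>1 / U'' k x - F' x\<bar> \<partial>M) +
        (\<integral>x\<in>A j. \<bar>1 / U n k x - 1 / U'' k x\<bar> \<partial>M)" (is "?l \<le> _ + ?b + ?c") if n: "k \<le> n" for n
    proof -
      let ?e = "\<lambda>x. (1 - F n x * U n k x) / u j"
      have jn: "j \<le> n" using jk n by simp
      have b1: "\<bar>1 / U'' k x - F' x\<bar> \<le> 2 / u j" "\<bar>1 / U n k x - 1 / U'' k x\<bar> \<le> 2 / u j"
        "\<bar>F n x - F' x\<bar> \<le> 2 / u j" "0 \<le> ?e x" "?e x \<le> 1 / u j" if x: "x \<in> A j" for x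
      proof -
        show "\<bar>1 / U'' k x - F' x\<bar> \<le> 2 / u j" "\<bar>1 / U n k x - 1 / U'' k x\<bar> \<le> 2 / u j"
          "\<bar>F n x - F' x\<bar> \<le> 2 / u j"
          unfolding U''_eq[OF x jk]
          by (rule diff[OF inv_u[OF U'_ge[OF x jk]] F'_nonneg F'_le[OF x]] diff[OF F_nonneg F_le[OF x jn] F'_nonneg F'_le[OF x]]
              diff[OF inv_u[OF u(2)[OF jk n x]] inv_u[OF U'_ge[OF x jk]]])+
        show "0 \<le> ?e x" using u(1)[of j] FU_le[OF n A_mono[OF x jk]] by simp
        show "?e x \<le> 1 / u j" using u(1)[of j] F_nonneg[of n x] u(2)[OF jk n x] 
          by (intro divide_right_mono) auto
      qed
      have i: "integrable M (\<lambda>x. indicator (A j) x *\<^sub>R ?e x)"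
        "integrable M (\<lambda>x. indicator (A j) x *\<^sub>R \<bar>1 / U'' k x - F' x\<bar>)"
        "integrable M (\<lambda>x. indicator (A j) x *\<^sub>R \<bar>1 / U n k x - 1 / U'' k x\<bar>)"
        "integrable M (\<lambda>x. indicator (A j) x *\<^sub>R \<bar>F n x - F' x\<bar>)"
        by (rule int[where K = "2 / u j"]; use b1 u(1)[of j] in \<open>force simp: \<close>)+
      have pt: "\<bar>F n x - F' x\<bar> \<le> ?e x + \<bar>1 / U'' k x - F' x\<bar> + \<bar>1 / U n k x - 1 / U'' k x\<bar>"
        if x: "x \<in> A j" for x
      proof -
        have U0: "0 < U n k x" using u(2)[OF jk n x] u(1)[of j] by linarith
        have "\<bar>F n x - 1 / U n k x\<bar> = (1 - F n x * U n k x) / U n k x"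
          using FU_le[OF n A_mono[OF x jk]] U0 by (simp add: field_simps abs_if)
        also have "\<dots> \<le> ?e x"
          using FU_le[OF n A_mono[OF x jk]] u(2)[OF jk n x] u(1)[of j] by (intro frac_le) auto
        finally show ?thesis by linarith
      qed
      have "?l \<le> (\<integral>x\<in>A j. ?e x + \<bar>1 / U'' k x - F' x\<bar> + \<bar>1 / U n k x - 1 / U'' k x\<bar> \<partial>M)"
        unfolding set_lebesgue_integral_def scaleR_add_right
        by (rule integral_mono[OF i(4) Bochner_Integration.integrable_add[OF Bochner_Integration.integrable_add[OF i(1,2)] i(3)]])
          (use pt in \<open>auto simp: indicator_def\<close>)
      also have "\<dots> = (\<integral>x\<in>A j. ?e x \<partial>M) + ?b + ?c"
        using i unfolding set_lebesgue_integral_def scaleR_add_right by simp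
      also have "(\<integral>x\<in>A j. ?e x \<partial>M) = (\<integral>x\<in>A j. (1 - F n x * U n k x) \<partial>M) / u j"
        by (simp add: set_integral_divide_zero)
      also have "\<dots> \<le> d k / u j"
        using FU_int[OF jk n] u(1)[of j] by (intro divide_right_mono) auto
      finally show ?thesis by simp
    qed
    then show "\<forall>\<^sub>F n in sequentially. (\<integral>x\<in>A j. \<bar>F n x - F' x\<bar> \<partial>M) \<le>
        d k / u j + (\<integral>x\<in>A j. \<bar>1 / U'' k x - F' x\<bar> \<partial>M) + (\<integral>x\<in>A j. \<bar>1 / U n k x - 1 / U'' k x\<bar> \<partial>M)" 
      unfolding eventually_sequentially by blast
  qed

  \<comment> \<open>The increasing limit \<open>L\<close> of \<open>F' x * U' k x\<close> is at most
    \<open>1\<close>. The bound \<open>d k\<close> on the escaped mass survives the limit in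
    \<open>n\<close>, because \<open>F n\<close> converges in L^1 on \<open>A j\<close> while
    \<open>U n k\<close> stays below \<open>w k\<close>. Letting \<open>k\<close> grow, the integral
    of \<open>1 - L\<close> over \<open>A j\<close> is at most \<open>0\<close>, so
    \<open>L = 1\<close> almost everywhere there.\<close>
  have "AE x in M. x \<in> A j \<longrightarrow> (\<lambda>k. F' x * U' k x) \<longlonglongrightarrow> 1" for j
  proof -
    define L where "L x = lim (\<lambda>k. F' x * U'' k x)" for x
    have L_meas[measurable]: "L \<in> borel_measurable M"
      unfolding L_def by measurable
    have FU_le': "F' x * U' k x \<le> 1" and FU_nonneg: "0 \<le> F' x * U' k x" if x: "x \<in> A j" and k: "j \<le> k" for x k
      using F'_lim(2)[OF sA[OF x] A_mono[OF x k]] U'_pos[OF x k] F'_nonneg[of x]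
      by (auto simp: field_simps)
    have L: "(\<lambda>k. F' x * U'' k x) \<longlonglongrightarrow> L x" "(\<lambda>k. F' x * U' k x) \<longlonglongrightarrow> L x" "L x \<le> 1" if x: "x \<in> A j" for x
    proof -
      have inc: "incseq (\<lambda>i. F' x * U'' (i + j) x)"
        using x U'_mono[OF A_mono[OF x]] F'_nonneg[of x] 
        by (intro incseq_SucI) (auto intro!: mult_left_mono simp: U''_eq[OF x])
      then obtain l where l: "(\<lambda>i. F' x * U'' (i + j) x) \<longlonglongrightarrow> l"
        using incseq_convergent[OF inc, of 1] FU_le'[OF x] by (metis U''_eq[OF x] le_add2)
      then have l': "(\<lambda>k. F' x * U'' k x) \<longlonglongrightarrow> l"
        by (rule LIMSEQ_offset)
      then show l'': "(\<lambda>k. F' x * U'' k x) \<longlonglongrightarrow> L x"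
        by (simp add: L_def limI)
      show "(\<lambda>k. F' x * U' k x) \<longlonglongrightarrow> L x"
        by (rule Lim_transform_eventually[OF l'']) (use ev[OF sA[OF x]] in eventually_elim, simp)
      then show "L x \<le> 1"
        by (rule LIMSEQ_le_const2) (use FU_le'[OF x] in auto)
    qed
    have le_d: "(\<integral>x\<in>A j. (1 - F' x * U'' k x) \<partial>M) \<le> d k" if jk: "j \<le> k" for k
    proof (rule LIMSEQ_le)
      have w0: "\<bar>F' x * U n k x\<bar> \<le> 1 / u j * w k" if n: "k \<le> n" and x: "x \<in> A j" for n x
        unfolding abs_mult using F'_nonneg[of x] F'_le[OF x] u(2)[OF jk n x] u(1)[of j] w[OF n A_mono[OF x jk]]
        by (intro mult_mono) auto
      show "(\<lambda>n. \<integral>x\<in>A j. (1 - F' x * U n k x) \<partial>M) \<longlonglongrightarrow> (\<integral>x\<in>A j. (1 - F' x * U'' k x) \<partial>M)"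
      proof (rule lim0[where m = k and K = "1 + 1 / u j * w k"])
        show "(\<lambda>n. 1 - F' x * U n k x) \<longlonglongrightarrow> 1 - F' x * U'' k x" if x: "x \<in> A j" for x
          unfolding U''_eq[OF x jk] by (intro tendsto_intros U_lim A_mono[OF x jk])
        show "\<bar>1 - F' x * U n k x\<bar> \<le> 1 + 1 / u j * w k" if "k \<le> n" "x \<in> A j" for n x
          using w0[OF that] by linarith
      qed measurable
      show "(\<lambda>n. d k + w k * (\<integral>x\<in>A j. \<bar>F n x - F' x\<bar> \<partial>M)) \<longlonglongrightarrow> d k"
        using tendsto_add[OF tendsto_const[of "d k"] tendsto_mult[OF tendsto_const[of "w k"] conv[of j]]] by simp
      have "(\<integral>x\<in>A j. (1 - F' x * U n k x) \<partial>M) \<le> d k + w k * (\<integral>x\<in>A j. \<bar>F n x - F' x\<bar> \<partial>M)" if n: "k \<le> n" for n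
      proof -
        have jn: "j \<le> n" using jk n by simp
        have FnU: "\<bar>F n x * U n k x\<bar> \<le> 1" if x: "x \<in> A j" for x
          using FU_le[OF n A_mono[OF x jk]] F_nonneg[of n x] u(2)[OF jk n x] u(1)[of j]
          by (auto simp: abs_mult)
        have b1: "\<bar>1 - F' x * U n k x\<bar> \<le> 1 + 1 / u j * w k" "\<bar>1 - F n x * U n k x\<bar> \<le> 2"
          if x: "x \<in> A j" for x
          using w0[OF n x] FnU[OF x] by linarith+
        have i: "integrable M (\<lambda>x. indicator (A j) x *\<^sub>R (1 - F' x * U n k x))"
            "integrable M (\<lambda>x. indicator (A j) x *\<^sub>R (1 - F n x * U n k x))"
            "integrable M (\<lambda>x. indicator (A j) x *\<^sub>R \<bar>F n x - F' x\<bar>)"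
          by (rule int[OF _ b1(1)] int[OF _ b1(2)] int[where K = "2 / u j"]; 
              use diff[OF F_nonneg F_le[OF _ jn] F'_nonneg F'_le] in simp)+
        have pt: "1 - F' x * U n k x \<le> (1 - F n x * U n k x) + w k * \<bar>F n x - F' x\<bar>" if x: "x \<in> A j" for x
        proof -
          have "(F n x - F' x) * U n k x \<le> \<bar>F n x - F' x\<bar> * w k"
            using u(2)[OF jk n x] u(1)[of j] w[OF n A_mono[OF x jk]] by (intro mult_mono) auto
          then show ?thesis by (simp add: algebra_simps)
        qed
        have "(\<integral>x\<in>A j. (1 - F' x * U n k x) \<partial>M) \<le>
          (\<integral>x. indicator (A j) x *\<^sub>R (1 - F n x * U n k x) + w k * (indicator (A j) x *\<^sub>R \<bar>F n x - F' x\<bar>) \<partial>M)"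
          unfolding set_lebesgue_integral_def
          by (rule integral_mono[OF i(1) Bochner_Integration.integrable_add[OF i(2) integrable_mult_right[OF i(3)]]])
            (use pt in \<open>auto simp: indicator_def\<close>)
        also have "\<dots> = (\<integral>x\<in>A j. (1 - F n x * U n k x) \<partial>M) + w k * (\<integral>x\<in>A j. \<bar>F n x - F' x\<bar> \<partial>M)"
          unfolding set_lebesgue_integral_def using i by simp
        finally show ?thesis using FU_int[OF jk n] by linarith
      qed
      then show "\<exists>N. \<forall>n\<ge>N. (\<integral>x\<in>A j. (1 - F' x * U n k x) \<partial>M) \<le> d k + w k * (\<integral>x\<in>A j. \<bar>F n x - F' x\<bar> \<partial>M)"
        by blast
    qed
    have "(\<lambda>k. \<integral>x\<in>A j. (1 - F' x * U'' k x) \<partial>M) \<longlonglongrightarrow> (\<integral>x\<in>A j. (1 - L x) \<partial>M)"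
    proof (rule lim0[where m = j and K = 1])
      show "(\<lambda>k. 1 - F' x * U'' k x) \<longlonglongrightarrow> 1 - L x" if "x \<in> A j" for x
        by (intro tendsto_intros L that)
      show "\<bar>1 - F' x * U'' k x\<bar> \<le> 1" if "j \<le> k" "x \<in> A j" for k x
        using FU_le'[OF that(2,1)] FU_nonneg[OF that(2,1)] U''_eq[OF that(2,1)] by simp
    qed measurable
    then have "(\<integral>x\<in>A j. (1 - L x) \<partial>M) \<le> 0"
      by (rule LIMSEQ_le[OF _ d]) (use le_d in blast)
    moreover have "0 \<le> (\<integral>x\<in>A j. (1 - L x) \<partial>M)"
      unfolding set_lebesgue_integral_def
      by (intro integral_nonneg_AE) (use L(3) in \<open>auto simp: indicator_def\<close>)
    ultimately have "(\<integral>x. indicator (A j) x *\<^sub>R (1 - L x) \<partial>M) = 0"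
      by (simp add: set_lebesgue_integral_def)
    moreover have "integrable M (\<lambda>x. indicator (A j) x *\<^sub>R (1 - L x))"
    proof (rule int[where K = 1])
      have "0 \<le> L x" if "x \<in> A j" for x
        by (rule LIMSEQ_le_const[OF L(2)[OF that]]) (use FU_nonneg[OF that] in blast)
      then show "\<bar>1 - L x\<bar> \<le> 1" if "x \<in> A j" for x
        using L(3)[OF that] that by fastforce
    qed measurable
    ultimately have "AE x in M. indicator (A j) x *\<^sub>R (1 - L x) = 0"
      by (subst (asm) integral_nonneg_eq_0_iff_AE) (use L(3) in \<open>auto simp: indicator_def\<close>)
    then show ?thesis
    proof eventually_elim
      case (elim x)
      then show ?case using L(2)[of x] by (auto simp: indicator_def)
    qed
  qed
  then have "AE x in M. \<forall>j. x \<in> A j \<longrightarrow> (\<lambda>k. F' x * U' k x) \<longlonglongrightarrow> 1"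
    unfolding AE_all_countable by blast
  then have "AE x in M. (\<lambda>k. F' x * U' k x) \<longlonglongrightarrow> 1"
    using AE_space by eventually_elim (use A(3) in auto)
  with F'_meas F'_nonneg F'_le F'_lim' conv show ?thesis
    by (rule that)
qed

text \<open>A countable product of compact intervals is compact by Tychonoff and metrizable, hence
  sequentially compact; this takes the place of a diagonal argument.\<close>

lemma bounded_functions_convergent_subsequence:
  fixes f :: "nat \<Rightarrow> 'i \<Rightarrow> real"
  assumes "countable S" and bound: "\<And>n i. i \<in> S \<Longrightarrow> \<bar>f n i\<bar> \<le> b i"
  obtains s :: "nat \<Rightarrow> nat" where "strict_mono s" "\<And>i. i \<in> S \<Longrightarrow> convergent (\<lambda>n. f (s n) i)"
proof (cases "S = {}")
  case True
  then show ?thesis using that[of id] by (auto simp: strict_mono_def)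
next
  case False
  define e where "e = from_nat_into S"
  have e: "e j \<in> S" for j using from_nat_into[OF False] by (simp add: e_def)
  define K where "K = PiE UNIV (\<lambda>j. {- b (e j)..b (e j)})"
  have "compactin (product_topology (\<lambda>_. euclidean) UNIV) K"
    unfolding K_def compactin_PiE by auto
  then have "seq_compact K"
    by (simp add: euclidean_product_topology compact_eq_seq_compact_metric)
  moreover have "(\<lambda>j. f n (e j)) \<in> K" for n
    using bound[OF e, of n] by (auto simp: K_def abs_le_iff) (smt (verit))
  ultimately obtain l s where s: "strict_mono s" "((\<lambda>n j. f n (e j)) \<circ> s) \<longlonglongrightarrow> l"
    unfolding seq_compact_def by metis
  have "(\<lambda>n. f (s n) (e j)) \<longlonglongrightarrow> l j" for j
    using continuous_on_tendsto_compose[OF continuous_on_product_coordinates s(2), of j]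
    by (simp add: o_def)
  moreover have "\<exists>j. i = e j" if "i \<in> S" for i
    using that from_nat_into_surj[OF \<open>countable S\<close> that] by (auto simp: e_def)
  ultimately show ?thesis
    using that[OF s(1)] convergentI by metis
qed

text \<open>The integrals over \<open>B k\<close> are bounded on a countable dense subset of
  \<open>A k\<close>, so one subsequence converges there for all \<open>k\<close>. It converges on
  all of \<open>A k\<close> by equicontinuity: replacing \<open>x\<close> by \<open>d\<close> costs
  at most \<open>r k\<close> times the L^1 distance of \<open>p x\<close> and \<open>p d\<close> on
  \<open>B k\<close>, for every \<open>n \<ge> k\<close>, and dominated convergence makes this small
  for suitable \<open>d\<close> near \<open>x\<close>.\<close>

lemma integral_operator_convergent_subsequence:
  fixes p :: "'a::{metric_space, second_countable_topology} \<Rightarrow> 'b \<Rightarrow> real"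
    and G :: "nat \<Rightarrow> 'b \<Rightarrow> real"
  assumes "finite_measure N"
    and B: "\<And>k. B k \<in> sets N"
    and p_meas: "\<And>x. p x \<in> borel_measurable N"
    and p_cont: "\<And>k y. y \<in> B k \<Longrightarrow> continuous_on (A k) (\<lambda>x. p x y)"
    and p_bound: "\<And>k x y. x \<in> A k \<Longrightarrow> y \<in> B k \<Longrightarrow> \<bar>p x y\<bar> \<le> r k"
    and G_meas: "\<And>n. G n \<in> borel_measurable N"
    and G_bound: "\<And>n k y. k \<le> n \<Longrightarrow> y \<in> B k \<Longrightarrow> \<bar>G n y\<bar> \<le> r k"
    and r: "\<And>k. 0 \<le> r k"
  obtains s :: "nat \<Rightarrow> nat" where "strict_mono s"
    "\<And>k x. x \<in> A k \<Longrightarrow> convergent (\<lambda>n. \<integral>y\<in>B k. p x y * G (s n) y \<partial>N)"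
proof -
  interpret finite_measure N by fact
  note [measurable] = B p_meas G_meas
  obtain D where D: "\<And>k. countable (D k)" "\<And>k. D k \<subseteq> A k" "\<And>k. A k \<subseteq> closure (D k)"
  proof -
    have "\<forall>k. \<exists>T. countable T \<and> T \<subseteq> A k \<and> A k \<subseteq> closure T"
      using separable by metis
    then show ?thesis using that by metis
  qed
  define I where "I n k x = (\<integral>y\<in>B k. p x y * G n y \<partial>N)" for n k x
  have int: "integrable N (\<lambda>y. indicator (B k) y *\<^sub>R (f y * G n y))"
    if [measurable]: "f \<in> borel_measurable N" and f: "\<And>y. y \<in> B k \<Longrightarrow> \<bar>f y\<bar> \<le> c"
    and n: "k \<le> n" for f c k n
  proof (rule integrable_const_bound[of _ "\<bar>c\<bar> * r k"])
    have "\<bar>f y * G n y\<bar> \<le> \<bar>c\<bar> * r k" if "y \<in> B k" for y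
      unfolding abs_mult using f[OF that] G_bound[OF n that] by (intro mult_mono) auto
    then show "AE y in N. norm (indicator (B k) y *\<^sub>R (f y * G n y)) \<le> \<bar>c\<bar> * r k"
      using r[of k] by (auto simp: indicator_def)
  qed measurable
  \<comment> \<open>\<open>G n\<close> is bounded on \<open>B k\<close> only for
    \<open>n \<ge> k\<close>. The value \<open>0\<close> before that keeps every sequence bounded
    and does not affect its convergence.\<close>
  define J where "J n i = (if fst i \<le> n then I n (fst i) (snd i) else 0)" for n i
  have J_bound: "\<bar>J n i\<bar> \<le> r (fst i) * r (fst i) * measure N (space N)" if i: "i \<in> Sigma UNIV D" for n i
  proof -
    obtain k x where [simp]: "i = (k, x)" and x: "x \<in> A k" using i D(2) by fastforce
    have "\<bar>I n k x\<bar> \<le> r k * r k * measure N (space N)" if n: "k \<le> n"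
    proof -
      have le: "\<bar>p x y * G n y\<bar> \<le> r k * r k" if "y \<in> B k" for y
        unfolding abs_mult using p_bound[OF x that] G_bound[OF n that] r by (intro mult_mono) auto
      have "\<bar>I n k x\<bar> \<le> (\<integral>y. \<bar>indicator (B k) y *\<^sub>R (p x y * G n y)\<bar> \<partial>N)"
        unfolding I_def set_lebesgue_integral_def by (rule integral_abs_bound)
      also have "\<dots> \<le> (\<integral>y. r k * r k \<partial>N)"
        by (rule integral_mono[OF integrable_abs[OF int[OF p_meas p_bound[OF x] n]]])
          (use le r[of k] in \<open>auto simp: indicator_def\<close>)
      finally show ?thesis by (simp add: mult_ac)
    qed
    then show ?thesis by (simp add: J_def r)
  qed
  have "countable (Sigma UNIV D)" using D(1) by auto
  then obtain s where s: "strict_mono s" "\<And>i. i \<in> Sigma UNIV D \<Longrightarrow> convergent (\<lambda>n. J (s n) i)"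
    using bounded_functions_convergent_subsequence[of _ J, OF _ J_bound] by metis
  have "Cauchy (\<lambda>n. I (s n) k x)" if x: "x \<in> A k" for k x
  proof (rule metric_CauchyI)
    fix \<epsilon> :: real assume \<epsilon>: "0 < \<epsilon>"
    obtain z where z: "\<And>i. z i \<in> D k" "z \<longlonglongrightarrow> x"
      using x D(3) by (meson closure_sequential subsetD)
    have zA: "z i \<in> A k" for i using z D(2) by auto
    have "(\<lambda>i. \<integral>y. indicator (B k) y * \<bar>p (z i) y - p x y\<bar> \<partial>N) \<longlonglongrightarrow> (\<integral>y. 0 \<partial>N)"
    proof (rule bounded_convergence[where K = "2 * r k"])
      show "(\<lambda>i. indicator (B k) y * \<bar>p (z i) y - p x y\<bar>) \<longlonglongrightarrow> 0" for y
      proof (cases "y \<in> B k")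
        case True
        then have "(\<lambda>i. p (z i) y) \<longlonglongrightarrow> p x y"
          using continuous_on_tendsto_compose[OF p_cont[OF True] z(2) x] zA by auto
        then show ?thesis using True tendsto_rabs_zero LIM_zero by fastforce
      qed auto
      show "\<bar>indicator (B k) y * \<bar>p (z i) y - p x y\<bar>\<bar> \<le> 2 * r k" for i y
        using p_bound[OF zA, of y i] p_bound[OF x, of y] r[of k] by (auto simp: indicator_def)
    qed measurable
    then have lim: "(\<lambda>i. r k * (\<integral>y. indicator (B k) y * \<bar>p (z i) y - p x y\<bar> \<partial>N)) \<longlonglongrightarrow> 0"
      using tendsto_mult_right_zero by fastforce
    then obtain i where i: "r k * (\<integral>y. indicator (B k) y * \<bar>p (z i) y - p x y\<bar> \<partial>N) < \<epsilon> / 3"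
      using order_tendstoD(2)[OF lim, of "\<epsilon> / 3"] \<epsilon> by (auto simp: eventually_sequentially)
    define d where "d = z i"
    have d: "d \<in> A k" "d \<in> D k" using z zA by (auto simp: d_def)
    have near: "\<bar>I n k d - I n k x\<bar> < \<epsilon> / 3" if n: "k \<le> n" for n
    proof -
      have i1: "integrable N (\<lambda>y. indicator (B k) y *\<^sub>R (p d y * G n y))"
        "integrable N (\<lambda>y. indicator (B k) y *\<^sub>R (p x y * G n y))"
        using int[OF p_meas p_bound[OF d(1)] n] int[OF p_meas p_bound[OF x] n] by auto
      have i2: "integrable N (\<lambda>y. indicator (B k) y *\<^sub>R \<bar>p d y - p x y\<bar>)"
        by (rule integrable_const_bound[of _ "2 * r k"])
          (use p_bound[OF d(1)] p_bound[OF x] r[of k] in \<open>fastforce simp: indicator_def\<close>, measurable)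
      have "I n k d - I n k x = (\<integral>y. indicator (B k) y *\<^sub>R ((p d y - p x y) * G n y) \<partial>N)"
        unfolding I_def set_lebesgue_integral_def
        by (subst Bochner_Integration.integral_diff[OF i1, symmetric])
          (simp add: algebra_simps)
      then have "\<bar>I n k d - I n k x\<bar> \<le> (\<integral>y. \<bar>indicator (B k) y *\<^sub>R ((p d y - p x y) * G n y)\<bar> \<partial>N)"
        by (simp add: integral_abs_bound)
      also have "\<dots> \<le> (\<integral>y. r k * (indicator (B k) y *\<^sub>R \<bar>p d y - p x y\<bar>) \<partial>N)"
      proof (rule integral_mono)
        show "integrable N (\<lambda>y. \<bar>indicator (B k) y *\<^sub>R ((p d y - p x y) * G n y)\<bar>)"
          using Bochner_Integration.integrable_diff[OF i1] by (intro integrable_abs) (simp add: algebra_simps)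
        show "integrable N (\<lambda>y. r k * (indicator (B k) y *\<^sub>R \<bar>p d y - p x y\<bar>))"
          using i2 by (rule integrable_mult_right)
        show "\<bar>indicator (B k) y *\<^sub>R ((p d y - p x y) * G n y)\<bar> \<le> r k * (indicator (B k) y *\<^sub>R \<bar>p d y - p x y\<bar>)" for y
          using mult_left_mono[OF G_bound[OF n, of y], of "\<bar>p d y - p x y\<bar>"]
          by (auto simp: indicator_def abs_mult mult.commute)
      qed
      also have "\<dots> < \<epsilon> / 3" using i by (simp add: d_def)
      finally show ?thesis .
    qed
    have "Cauchy (\<lambda>n. J (s n) (k, d))"
      using s(2)[of "(k, d)"] d by (intro convergent_Cauchy) auto
    then obtain m where m: "\<And>n n'. m \<le> n \<Longrightarrow> m \<le> n' \<Longrightarrow> \<bar>J (s n) (k, d) - J (s n') (k, d)\<bar> < \<epsilon> / 3"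
      using \<epsilon> unfolding Cauchy_def dist_real_def by (metis zero_less_divide_iff zero_less_numeral)
    have "\<bar>I (s n) k x - I (s n') k x\<bar> < \<epsilon>" if "max m k \<le> n" "max m k \<le> n'" for n n'
    proof -
      have "k \<le> s n" "k \<le> s n'" using seq_suble[OF s(1)] that by (meson le_trans max.boundedE)+
      moreover from this have "\<bar>I (s n) k d - I (s n') k d\<bar> < \<epsilon> / 3"
        using m[of n n'] that by (simp add: J_def)
      ultimately show ?thesis
        using near[of "s n"] near[of "s n'"] by linarith
    qed
    then show "\<exists>M. \<forall>m\<ge>M. \<forall>n\<ge>M. dist (I (s m) k x) (I (s n) k x) < \<epsilon>"
      unfolding dist_real_def by blast
  qed
  with s(1) show ?thesis
    unfolding I_def by (intro that[of s] real_Cauchy_convergent)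
qed

text \<open>By Fubini, integrating over \<open>M\<close> first and using the equation for
  \<open>G\<close> leaves the indicator of \<open>S\<close>. The mass over \<open>S\<close> is thus
  independent of the size of \<open>F\<close> and \<open>G\<close>: this is the source of tightness
  uniform in \<open>n\<close>. The bounds \<open>C\<close> and \<open>K\<close> secure
  integrability.\<close>

lemma coupling_mass:
  fixes M :: "'a measure" and N :: "'b measure" and p :: "'a \<Rightarrow> 'b \<Rightarrow> real"
  assumes "prob_space M" "prob_space N" and [simp]: "space M = UNIV" "space N = UNIV"
    and p_meas: "(\<lambda>(x, y). p x y) \<in> borel_measurable (M \<Otimes>\<^sub>M N)"
    and [measurable]: "F \<in> borel_measurable M" "G \<in> borel_measurable N" "S \<in> sets N"
    and bounds: "\<And>x y. \<bar>p x y\<bar> \<le> C" "\<And>x. \<bar>F x\<bar> \<le> K" "\<And>y. \<bar>G y\<bar> \<le> K"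
    and G: "\<And>y. G y * (\<integral>x. p x y * F x \<partial>M) = 1"
  shows "integrable M (\<lambda>x. F x * (\<integral>y\<in>S. p x y * G y \<partial>N))"
    "(\<integral>x. F x * (\<integral>y\<in>S. p x y * G y \<partial>N) \<partial>M) = measure N S"
proof -
  interpret M: prob_space M by fact
  interpret N: prob_space N by fact
  interpret MN: pair_prob_space M N ..
  note [measurable] = p_meas
  let ?f = "\<lambda>(x, y). F x * (indicator S y *\<^sub>R (p x y * G y))"
  have K: "0 \<le> K" "0 \<le> C" using bounds(2)[of undefined] bounds(1)[of undefined undefined] by linarith+
  have "\<bar>F x * (indicator S y *\<^sub>R (p x y * G y))\<bar> \<le> K * (1 * (C * K))" for x y
    unfolding abs_mult real_scaleR_def using bounds K
    by (intro mult_mono) (auto intro!: mult_nonneg_nonneg simp: indicator_def)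
  then have int: "integrable (M \<Otimes>\<^sub>M N) ?f"
    by (intro MN.integrable_const_bound[of _ "K * (1 * (C * K))"]) auto
  then show "integrable M (\<lambda>x. F x * (\<integral>y\<in>S. p x y * G y \<partial>N))"
    using MN.integrable_fst[OF int] by (simp add: set_lebesgue_integral_def)
  have "(\<integral>x. F x * (\<integral>y\<in>S. p x y * G y \<partial>N) \<partial>M) = (\<integral>x. \<integral>y. F x * (indicator S y *\<^sub>R (p x y * G y)) \<partial>N \<partial>M)"
    by (simp add: set_lebesgue_integral_def)
  also have "\<dots> = (\<integral>y. \<integral>x. F x * (indicator S y *\<^sub>R (p x y * G y)) \<partial>M \<partial>N)"
    by (rule MN.Fubini_integral[OF int, symmetric])
  also have "\<dots> = (\<integral>y. indicator S y * (G y * (\<integral>x. p x y * F x \<partial>M)) \<partial>N)"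
    by (simp only: integral_mult_right_zero[symmetric] real_scaleR_def mult_ac)
  also have "\<dots> = measure N S"
    by (simp add: G)
  finally show "(\<integral>x. F x * (\<integral>y\<in>S. p x y * G y \<partial>N) \<partial>M) = measure N S" .
qed

text \<open>The bound on \<open>f\<close> carries L^1 convergence over to the products; the bounds
  by \<open>K\<close> give integrability. They start at an index \<open>m\<close> because the
  approximate solutions are controlled on the \<open>k\<close>-th set only from \<open>n = k\<close>
  on.\<close>

lemma set_integral_mult_L1_limit:
  fixes f g :: "'a \<Rightarrow> real" and F :: "nat \<Rightarrow> 'a \<Rightarrow> real"
  assumes "finite_measure M"
    and [measurable]: "A \<in> sets M" "f \<in> borel_measurable M" "\<And>n. F n \<in> borel_measurable M" "g \<in> borel_measurable M"
    and f: "\<And>x. x \<in> A \<Longrightarrow> \<bar>f x\<bar> \<le> r"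
    and F: "\<And>n x. m \<le> n \<Longrightarrow> x \<in> A \<Longrightarrow> \<bar>F n x\<bar> \<le> K" and g: "\<And>x. x \<in> A \<Longrightarrow> \<bar>g x\<bar> \<le> K"
    and lim: "(\<lambda>n. \<integral>x\<in>A. \<bar>F n x - g x\<bar> \<partial>M) \<longlonglongrightarrow> 0"
  shows "(\<lambda>n. \<integral>x\<in>A. f x * F n x \<partial>M) \<longlonglongrightarrow> (\<integral>x\<in>A. f x * g x \<partial>M)"
proof -
  interpret finite_measure M by fact
  have int: "integrable M (\<lambda>x. indicator A x *\<^sub>R h x)"
    if "h \<in> borel_measurable M" "\<And>x. x \<in> A \<Longrightarrow> \<bar>h x\<bar> \<le> c" for h :: "'a \<Rightarrow> real" and c
    by (rule integrable_const_bound[of _ "max c 0"])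
      (use that in \<open>auto simp: indicator_def le_max_iff_disj\<close>)
  have bound: "\<bar>(\<integral>x\<in>A. f x * F n x \<partial>M) - (\<integral>x\<in>A. f x * g x \<partial>M)\<bar> \<le> r * (\<integral>x\<in>A. \<bar>F n x - g x\<bar> \<partial>M)"
    if n: "m \<le> n" for n
  proof -
    have le: "\<bar>f x * F n x\<bar> \<le> r * K" "\<bar>f x * g x\<bar> \<le> r * K" "\<bar>F n x - g x\<bar> \<le> 2 * K"
      "\<bar>f x\<bar> * \<bar>F n x - g x\<bar> \<le> r * \<bar>F n x - g x\<bar>" if "x \<in> A" for x
      unfolding abs_mult using f[OF that] F[OF n that] g[OF that]
      by (auto intro!: mult_mono)
    have i: "integrable M (\<lambda>x. indicator A x *\<^sub>R (f x * F n x))"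
      "integrable M (\<lambda>x. indicator A x *\<^sub>R (f x * g x))"
      "integrable M (\<lambda>x. indicator A x *\<^sub>R \<bar>F n x - g x\<bar>)"
      by (rule int[OF _ le(1)] int[OF _ le(2)] int[where c = "2 * K"]; use le(3) in simp)+
    have "(\<integral>x\<in>A. f x * F n x \<partial>M) - (\<integral>x\<in>A. f x * g x \<partial>M) =
        (\<integral>x. indicator A x *\<^sub>R (f x * F n x) - indicator A x *\<^sub>R (f x * g x) \<partial>M)"
      unfolding set_lebesgue_integral_def using i by simp
    also have "\<bar>\<dots>\<bar> \<le> (\<integral>x. \<bar>indicator A x *\<^sub>R (f x * F n x) - indicator A x *\<^sub>R (f x * g x)\<bar> \<partial>M)"
      by (rule integral_abs_bound)
    also have "\<dots> \<le> (\<integral>x. r * (indicator A x *\<^sub>R \<bar>F n x - g x\<bar>) \<partial>M)"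
      by (rule integral_mono[OF integrable_abs[OF Bochner_Integration.integrable_diff[OF i(1,2)]] integrable_mult_right[OF i(3)]])
        (use le(4) in \<open>auto simp: indicator_def abs_mult simp flip: right_diff_distrib\<close>)
    also have "\<dots> = r * (\<integral>x\<in>A. \<bar>F n x - g x\<bar> \<partial>M)"
      by (simp only: set_lebesgue_integral_def integral_mult_right_zero)
    finally show ?thesis .
  qed
  show ?thesis
  proof (rule LIM_zero_cancel, rule Lim_null_comparison)
    show "\<forall>\<^sub>F n in sequentially. norm ((\<integral>x\<in>A. f x * F n x \<partial>M) - (\<integral>x\<in>A. f x * g x \<partial>M))
        \<le> r * (\<integral>x\<in>A. \<bar>F n x - g x\<bar> \<partial>M)"
      using bound by (auto simp: eventually_sequentially)
    show "(\<lambda>n. r * (\<integral>x\<in>A. \<bar>F n x - g x\<bar> \<partial>M)) \<longlonglongrightarrow> 0"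
      using tendsto_mult_right_zero[OF lim] .
  qed
qed

text \<open>Monotone convergence turns a limit of truncated real integrals into an equation for the
  full integral in \<open>[0, \<infinity>]\<close>. Integrability starts at \<open>k = j\<close>
  because the kernel is bounded on the \<open>k\<close>-th set only once the other variable lies in
  its own \<open>k\<close>-th set.\<close>

lemma nn_integral_mult_eq_one_of_exhaustion:
  fixes f :: "'a \<Rightarrow> real"
  assumes A: "\<And>j. A j \<in> sets M" "incseq A" "(\<Union>j. A j) = UNIV"
    and [measurable]: "f \<in> borel_measurable M" and f: "\<And>x. 0 \<le> f x"
    and int: "\<And>k. j \<le> k \<Longrightarrow> integrable M (\<lambda>x. indicator (A k) x *\<^sub>R f x)"
    and c: "0 \<le> c" and lim: "(\<lambda>k. c * (\<integral>x\<in>A k. f x \<partial>M)) \<longlonglongrightarrow> 1"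
  shows "ennreal c * (\<integral>\<^sup>+x. ennreal (f x) \<partial>M) = 1"
proof (rule LIMSEQ_unique)
  note [measurable] = A(1)
  have "(\<lambda>k. \<integral>\<^sup>+x. indicator (A k) x * ennreal (f x) \<partial>M) \<longlonglongrightarrow> (\<integral>\<^sup>+x. ennreal (f x) \<partial>M)"
  proof (rule nn_integral_LIMSEQ)
    show "incseq (\<lambda>k x. indicator (A k) x * ennreal (f x))"
      using A(2) by (auto simp: incseq_def le_fun_def indicator_def)
  next
    fix x
    obtain i where "x \<in> A i" using A(3) by auto
    then have "indicator (A k) x * ennreal (f x) = ennreal (f x)" if "i \<le> k" for k
      using that A(2) by (auto simp: incseq_def indicator_def)
    then show "(\<lambda>k. indicator (A k) x * ennreal (f x)) \<longlonglongrightarrow> ennreal (f x)"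
      by (intro tendsto_eventually) (auto simp: eventually_sequentially)
  qed measurable
  then show "(\<lambda>k. ennreal c * (\<integral>\<^sup>+x. indicator (A k) x * ennreal (f x) \<partial>M)) \<longlonglongrightarrow>
      ennreal c * (\<integral>\<^sup>+x. ennreal (f x) \<partial>M)"
    by (rule ennreal_tendsto_cmult[rotated]) simp
  have "(\<lambda>k. ennreal (c * (\<integral>x\<in>A k. f x \<partial>M))) \<longlonglongrightarrow> 1"
    using tendsto_ennrealI[OF lim] by simp
  moreover have "ennreal (c * (\<integral>x\<in>A k. f x \<partial>M)) = ennreal c * (\<integral>\<^sup>+x. indicator (A k) x * ennreal (f x) \<partial>M)"
    if "j \<le> k" for k
  proof -
    have "(\<integral>\<^sup>+x. indicator (A k) x * ennreal (f x) \<partial>M) = (\<integral>\<^sup>+x. ennreal (indicator (A k) x *\<^sub>R f x) \<partial>M)"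
      by (intro nn_integral_cong) (auto simp: indicator_def)
    also have "\<dots> = ennreal (\<integral>x\<in>A k. f x \<partial>M)"
      unfolding set_lebesgue_integral_def
      by (rule nn_integral_eq_integral[OF int[OF that]]) (use f in auto)
    finally show ?thesis
      by (simp add: c ennreal_mult')
  qed
  ultimately show "(\<lambda>k. ennreal c * (\<integral>\<^sup>+x. indicator (A k) x * ennreal (f x) \<partial>M)) \<longlonglongrightarrow> 1"
    by (intro Lim_transform_eventually[OF \<open>(\<lambda>k. ennreal (c * (\<integral>x\<in>A k. f x \<partial>M))) \<longlonglongrightarrow> 1\<close>])
      (rule eventually_sequentiallyI[of j])
qed

text \<open>Replace \<open>p\<close> by \<open>1\<close> off \<open>A n \<times> B n\<close>, take the solution \<open>F n\<close>, \<open>G n\<close> of this bounded problem and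
  normalise it by \<open>\<integral>x\<in>A 0. F n x = 1\<close>. Since the marginals are fixed, a definite part of the mass of
  the coupling stays in \<open>A 0 \<times> B 0\<close>, which bounds \<open>F n\<close> on each \<open>A k\<close> and \<open>G n\<close> on each \<open>B k\<close>.\<close>

lemma schroedinger_pair_exists_aux:
  fixes M :: "'a::{metric_space, second_countable_topology} measure" and N :: "'b measure"
    and p :: "'a \<Rightarrow> 'b \<Rightarrow> real"
  assumes "prob_space M" "prob_space N" and [simp]: "space M = UNIV" "space N = UNIV"
    and p_meas: "(\<lambda>(x, y). p x y) \<in> borel_measurable (M \<Otimes>\<^sub>M N)" and p_nonneg: "\<And>x y. 0 \<le> p x y"
    and A: "\<And>k. A k \<in> sets M" "incseq A" "(\<Union>k. A k) = UNIV"
    and B: "\<And>k. B k \<in> sets N" "incseq B" "(\<Union>k. B k) = UNIV"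
    and p_bounds: "\<And>k x y. x \<in> A k \<Longrightarrow> y \<in> B k \<Longrightarrow> 1 / r k \<le> p x y \<and> p x y \<le> r k"
    and r: "\<And>k. 1 \<le> r k"
    and p_cont: "\<And>k y. y \<in> B k \<Longrightarrow> continuous_on (A k) (\<lambda>x. p x y)"
    and A0: "3 / 4 \<le> measure M (A 0)" and B0: "3 / 4 \<le> measure N (B 0)"
  shows "\<exists>F G. schroedinger_pair M N p F G"
proof -
  interpret M: prob_space M by fact
  interpret N: prob_space N by fact
  interpret MN: pair_prob_space M N ..
  note [measurable] = p_meas A(1) B(1)
  have [measurable]: "p x \<in> borel_measurable N" "(\<lambda>x. p x y) \<in> borel_measurable M" for x y
    using measurable_Pair2[OF p_meas, of x] measurable_Pair1[OF p_meas, of y] by simp_all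
  have r0: "0 < r k" for k using r[of k] by linarith
  have A_mono: "x \<in> A k" if "x \<in> A j" "j \<le> k" for x j k
    using that A(2) by (auto simp: incseq_def)
  have B_mono: "y \<in> B k" if "y \<in> B j" "j \<le> k" for y j k
    using that B(2) by (auto simp: incseq_def)
  have M_int: "integrable M (\<lambda>x. indicator S x *\<^sub>R f x)"
    if "S \<in> sets M" "f \<in> borel_measurable M" "\<And>x. x \<in> S \<Longrightarrow> \<bar>f x\<bar> \<le> c" for f :: "'a \<Rightarrow> real" and S c
    by (rule M.integrable_const_bound[of _ "max c 0"])
      (use that in \<open>auto simp: indicator_def le_max_iff_disj\<close>)
  have N_int: "integrable N (\<lambda>x. indicator S x *\<^sub>R f x)"
    if "S \<in> sets N" "f \<in> borel_measurable N" "\<And>x. x \<in> S \<Longrightarrow> \<bar>f x\<bar> \<le> c" for f :: "'b \<Rightarrow> real" and S c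
    by (rule N.integrable_const_bound[of _ "max c 0"])
      (use that in \<open>auto simp: indicator_def le_max_iff_disj\<close>)

  define P where "P n x y = (if x \<in> A n \<and> y \<in> B n then p x y else 1)" for n x y
  have P_eq: "P n x y = p x y" if "x \<in> A k" "y \<in> B k" "k \<le> n" for n k x y
    using that A_mono B_mono by (auto simp: P_def)
  have P_bounds: "1 / r n \<le> P n x y" "P n x y \<le> r n" for n x y
    using p_bounds[of x n y] r[of n] by (auto simp: P_def)
  have P_nonneg: "0 \<le> P n x y" for n x y by (simp add: P_def p_nonneg)
  have P_meas[measurable]: "(\<lambda>(x, y). P n x y) \<in> borel_measurable (M \<Otimes>\<^sub>M N)" for n
    unfolding P_def by measurable
  have P_meas_swap: "(\<lambda>(y, x). P n x y) \<in> borel_measurable (N \<Otimes>\<^sub>M M)" for n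
    using measurable_pair_swap[OF P_meas[of n]] by (simp add: split_def)
  have [measurable]: "P n x \<in> borel_measurable N" "(\<lambda>x. P n x y) \<in> borel_measurable M" for n x y
    using measurable_Pair2[OF P_meas, of x n] measurable_Pair1[OF P_meas, of y n] by simp_all
  define Q where "Q n F G K \<longleftrightarrow> F \<in> borel_measurable M \<and> G \<in> borel_measurable N \<and>
    (\<forall>x. 0 < F x \<and> F x \<le> K) \<and> (\<forall>y. 0 < G y \<and> G y \<le> K) \<and>
    (\<forall>x. F x * (\<integral>y. P n x y * G y \<partial>N) = 1) \<and> (\<forall>y. G y * (\<integral>x. P n x y * F x \<partial>M) = 1)" for n F G K
  have "\<exists>F G K. Q n F G K" for n
    unfolding Q_def
    by (rule bounded_kernel_schroedinger_pair[OF assms(1-4) P_meas _ P_bounds, of n])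
      (use r0 in \<open>simp, blast\<close>)
  then obtain F0 G0 K0 where "\<And>n. Q n (F0 n) (G0 n) (K0 n)"
    by metis
  then have FG0: "\<And>n. F0 n \<in> borel_measurable M" "\<And>n. G0 n \<in> borel_measurable N"
    "\<And>n x. 0 < F0 n x \<and> F0 n x \<le> K0 n" "\<And>n y. 0 < G0 n y \<and> G0 n y \<le> K0 n"
    "\<And>n x. F0 n x * (\<integral>y. P n x y * G0 n y \<partial>N) = 1" "\<And>n y. G0 n y * (\<integral>x. P n x y * F0 n x \<partial>M) = 1"
    unfolding Q_def by blast+
  define a where "a n = (\<integral>x\<in>A 0. F0 n x \<partial>M)" for n
  have a: "0 < a n" for n
  proof -
    have "0 \<le> a n"
      unfolding a_def set_lebesgue_integral_def using FG0(3)
      by (intro integral_nonneg_AE) (auto simp: indicator_def less_imp_le)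
    moreover have "a n \<noteq> 0"
    proof
      have i: "integrable M (\<lambda>x. indicator (A 0) x *\<^sub>R F0 n x)"
        by (rule M_int[OF A(1) FG0(1), of _ _ "K0 n"]) (use FG0(3) in \<open>simp add: less_imp_le\<close>)
      assume "a n = 0"
      then have "AE x in M. indicator (A 0) x *\<^sub>R F0 n x = 0"
        using integral_nonneg_eq_0_iff_AE[OF i] FG0(3)
        unfolding a_def set_lebesgue_integral_def by (simp add: less_imp_le)
      then have "AE x in M. x \<notin> A 0"
        by eventually_elim (use FG0(3) in \<open>force simp: indicator_def less_imp_neq[symmetric]\<close>)
      then have "measure M (A 0) = 0"
        using AE_iff_null_sets[OF A(1)] measure_eq_0_null_sets by blast
      with A0 show False by simp
    qed
    ultimately show ?thesis by simp
  qed
  define F where "F n x = F0 n x / a n" for n x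
  define G where "G n y = G0 n y * a n" for n y
  have FG_meas[measurable]: "F n \<in> borel_measurable M" "G n \<in> borel_measurable N" for n
    using FG0(1,2)[of n] by (simp_all add: F_def[abs_def] G_def[abs_def])
  \<comment> \<open>These bounds depend on \<open>n\<close> and serve for integrability; the bounds
    uniform in \<open>n\<close> are \<open>G_le\<close> and \<open>F_le\<close> below.\<close>
  define K where "K n = max (K0 n / a n) (K0 n * a n)" for n
  have F_pos: "0 < F n x" and G_pos: "0 < G n y" and FK: "F n x \<le> K n" and GK: "G n y \<le> K n" for n x y
    using FG0(3)[of n x] FG0(4)[of n y] a[of n]
    by (auto simp: F_def G_def K_def le_max_iff_disj divide_right_mono mult_right_mono)
  have F_nonneg: "0 \<le> F n x" and G_nonneg: "0 \<le> G n y" for n x y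
    using F_pos[of n x] G_pos[of n y] by simp_all
  have F_eq: "F n x * (\<integral>y. P n x y * G n y \<partial>N) = 1" for n x
    using FG0(5)[of n x] a[of n] by (simp add: F_def G_def mult.assoc[symmetric])
  have G_eq: "G n y * (\<integral>x. P n x y * F n x \<partial>M) = 1" for n y
    using FG0(6)[of n y] a[of n] by (simp add: F_def G_def)
  have F_A0: "(\<integral>x\<in>A 0. F n x \<partial>M) = 1" for n
    using a[of n] by (simp add: F_def a_def[symmetric] set_integral_divide_zero)

  \<comment> \<open>For \<open>k \<le> n\<close>, \<open>P n\<close> agrees with \<open>p\<close> on
    \<open>A k \<times> B k\<close>, so on \<open>A k\<close> and \<open>B k\<close> these truncated
    integrals involve the original kernel.\<close>
  define U where "U n k x = (\<integral>y\<in>B k. P n x y * G n y \<partial>N)" for n k x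
  define V where "V n k y = (\<integral>x\<in>A k. P n x y * F n x \<partial>M)" for n k y
  have PF_bound: "\<bar>P n x y * F n x\<bar> \<le> r n * K n" and PG_bound: "\<bar>P n x y * G n y\<bar> \<le> r n * K n" for n x y
    unfolding abs_mult using P_bounds[of n x y] P_nonneg[of n x y] F_nonneg[of n x] G_nonneg[of n y] FK[of n x] GK[of n y]
    by (auto intro!: mult_mono)
  have U_int: "integrable N (\<lambda>y. indicator S y *\<^sub>R (P n x y * G n y))" if [measurable]: "S \<in> sets N" for n x S
    by (rule N_int[OF that _ PG_bound]) measurable
  have V_int: "integrable M (\<lambda>x. indicator S x *\<^sub>R (P n x y * F n x))" if [measurable]: "S \<in> sets M" for n y S
    by (rule M_int[OF that _ PF_bound]) measurable
  have PG_int: "integrable N (\<lambda>y. P n x y * G n y)" for n x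
    by (rule N.integrable_const_bound[of _ "r n * K n"]) (use PG_bound in auto)
  have PF_int: "integrable M (\<lambda>x. P n x y * F n x)" for n y
    by (rule M.integrable_const_bound[of _ "r n * K n"]) (use PF_bound in auto)
  have F_int: "integrable M (\<lambda>x. indicator S x *\<^sub>R F n x)" if [measurable]: "S \<in> sets M" for n S
    by (rule M_int[OF that, of _ "K n"]) (use FK F_nonneg in auto)
  have G_int: "integrable N (\<lambda>y. indicator S y *\<^sub>R G n y)" if [measurable]: "S \<in> sets N" for n S
    by (rule N_int[OF that, of _ "K n"]) (use GK G_nonneg in auto)
  have U_meas[measurable]: "U n k \<in> borel_measurable M" for n k
    unfolding U_def set_lebesgue_integral_def by measurable
  have V_meas[measurable]: "V n k \<in> borel_measurable N" for n k
    unfolding V_def set_lebesgue_integral_def by measurable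
  have U_mono: "U n k x \<le> U n k' x" if "k \<le> k'" for n k k' x
    unfolding U_def set_lebesgue_integral_def using that B_mono P_nonneg G_nonneg
    by (intro integral_mono U_int) (auto simp: indicator_def)
  have V_mono: "V n k y \<le> V n k' y" if "k \<le> k'" for n k k' y
    unfolding V_def set_lebesgue_integral_def using that A_mono P_nonneg F_nonneg
    by (intro integral_mono V_int) (auto simp: indicator_def)
  have FU_le: "F n x * U n k x \<le> 1" for n k x
  proof -
    have "U n k x \<le> (\<integral>y. P n x y * G n y \<partial>N)"
      unfolding U_def set_lebesgue_integral_def using P_nonneg G_nonneg
      by (intro integral_mono[OF U_int[OF B(1)] PG_int]) (auto simp: indicator_def)
    then show ?thesis using mult_left_mono[OF _ F_nonneg] F_eq by metis
  qed
  have GV_le: "G n y * V n k y \<le> 1" for n k y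
  proof -
    have "V n k y \<le> (\<integral>x. P n x y * F n x \<partial>M)"
      unfolding V_def set_lebesgue_integral_def using P_nonneg F_nonneg
      by (intro integral_mono[OF V_int[OF A(1)] PF_int]) (auto simp: indicator_def)
    then show ?thesis using mult_left_mono[OF _ G_nonneg] G_eq by metis
  qed
  have abs_bounds: "\<bar>P n x y\<bar> \<le> r n" "\<bar>F n x\<bar> \<le> K n" "\<bar>G n y\<bar> \<le> K n" for n x y
    using P_bounds[of n x y] P_nonneg[of n x y] F_nonneg[of n x] G_nonneg[of n y] FK[of n x] GK[of n y] by auto
  have FU_mass: "integrable M (\<lambda>x. F n x * U n k x)" "(\<integral>x. F n x * U n k x \<partial>M) = measure N (B k)" for n k
    unfolding U_def using coupling_mass[OF assms(1-4) P_meas FG_meas B(1) abs_bounds G_eq] by auto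
  have GV_mass: "integrable N (\<lambda>y. G n y * V n k y)" "(\<integral>y. G n y * V n k y \<partial>N) = measure M (A k)" for n k
    unfolding V_def using coupling_mass[OF assms(2,1,4,3) P_meas_swap FG_meas(2,1) A(1) abs_bounds(1,3,2) F_eq] by auto
  have FU_int: "(\<integral>x\<in>S. (1 - F n x * U n k x) \<partial>M) \<le> 1 - measure N (B k)" if [measurable]: "S \<in> sets M" for n k S
  proof -
    have "(\<integral>x\<in>S. (1 - F n x * U n k x) \<partial>M) \<le> (\<integral>x. 1 - F n x * U n k x \<partial>M)"
      unfolding set_lebesgue_integral_def
      by (rule integral_mono[OF integrable_mult_indicator[OF that]])
        (use FU_mass(1)[of n k] FU_le[of n _ k] in \<open>auto simp: indicator_def\<close>)
    then show ?thesis using FU_mass[of n k] by (simp add: M.prob_space[simplified])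
  qed
  have GV_int: "(\<integral>y\<in>S. (1 - G n y * V n k y) \<partial>N) \<le> 1 - measure M (A k)" if [measurable]: "S \<in> sets N" for n k S
  proof -
    have "(\<integral>y\<in>S. (1 - G n y * V n k y) \<partial>N) \<le> (\<integral>y. 1 - G n y * V n k y \<partial>N)"
      unfolding set_lebesgue_integral_def
      by (rule integral_mono[OF integrable_mult_indicator[OF that]])
        (use GV_mass(1)[of n k] GV_le[of n _ k] in \<open>auto simp: indicator_def\<close>)
    then show ?thesis using GV_mass[of n k] by (simp add: N.prob_space[simplified])
  qed

  have V_ge: "1 / r j \<le> V n k y" if "j \<le> k" "k \<le> n" "y \<in> B j" for j k n y
  proof -
    have "1 / r j = (\<integral>x. (1 / r j) * (indicator (A 0) x *\<^sub>R F n x) \<partial>M)"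
      using F_A0[of n] by (simp only: integral_mult_right_zero set_lebesgue_integral_def)
    also have "\<dots> \<le> V n 0 y"
      unfolding V_def set_lebesgue_integral_def
    proof (rule integral_mono[OF integrable_mult_right[OF F_int[OF A(1)]] V_int[OF A(1)]])
      fix x show "1 / r j * (indicator (A 0) x *\<^sub>R F n x) \<le> indicator (A 0) x *\<^sub>R (P n x y * F n x)"
      proof (cases "x \<in> A 0")
        case True
        then have "x \<in> A j" using A_mono by blast
        then have "1 / r j \<le> P n x y" using that P_eq[of x j y n] p_bounds[of x j y] by simp
        from mult_right_mono[OF this F_nonneg[of n x]] True show ?thesis by simp
      qed simp
    qed
    also have "\<dots> \<le> V n k y" by (rule V_mono) simp
    finally show ?thesis .
  qed
  have G_le: "G n y \<le> r k" if "k \<le> n" "y \<in> B k" for n k y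
  proof -
    have "G n y * (1 / r k) \<le> G n y * V n k y"
      using V_ge[OF order_refl that] G_nonneg by (rule mult_left_mono)
    also have "\<dots> \<le> 1" by (rule GV_le)
    finally show ?thesis using r0[of k] by (simp add: field_simps)
  qed
  \<comment> \<open>The coupling has at least mass \<open>3 / 4 - 1 / 4 = 1 / 2\<close> on
    \<open>A 0 \<times> B 0\<close>: the strip over \<open>B 0\<close> has mass
    \<open>measure N (B 0)\<close>, and at most \<open>measure M (- A 0)\<close> of it lies off
    \<open>A 0\<close>. On that product the kernel is at most \<open>r 0\<close>, and
    \<open>F n\<close> has integral \<open>1\<close> over \<open>A 0\<close>.\<close>
  have half: "1 / 2 \<le> r 0 * (\<integral>y\<in>B 0. G n y \<partial>N)" for n
  proof -
    have cA[measurable]: "- A 0 \<in> sets M"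
      using sets.compl_sets[OF A(1)[of 0]] by (simp add: Compl_eq_Diff_UNIV)
    have i: "integrable M (\<lambda>x. indicator (- A 0) x :: real)"
      by (rule M.integrable_const_bound[of _ 1]) auto
    have "measure N (B 0) - measure M (- A 0) = (\<integral>x. F n x * U n 0 x - indicator (- A 0) x \<partial>M)"
      using FU_mass[of n 0] i by simp
    also have "\<dots> \<le> (\<integral>x. (r 0 * (\<integral>y\<in>B 0. G n y \<partial>N)) * (indicator (A 0) x *\<^sub>R F n x) \<partial>M)"
    proof (rule integral_mono)
      show "integrable M (\<lambda>x. F n x * U n 0 x - indicator (- A 0) x)"
        using FU_mass(1)[of n 0] i by (rule Bochner_Integration.integrable_diff)
      show "integrable M (\<lambda>x. r 0 * (\<integral>y\<in>B 0. G n y \<partial>N) * (indicator (A 0) x *\<^sub>R F n x))"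
        by (rule integrable_mult_right[OF F_int[OF A(1)]])
      fix x
      show "F n x * U n 0 x - indicator (- A 0) x \<le> r 0 * (\<integral>y\<in>B 0. G n y \<partial>N) * (indicator (A 0) x *\<^sub>R F n x)"
      proof (cases "x \<in> A 0")
        case True
        have "U n 0 x \<le> (\<integral>y. r 0 * (indicator (B 0) y *\<^sub>R G n y) \<partial>N)"
          unfolding U_def set_lebesgue_integral_def
          by (rule integral_mono[OF U_int[OF B(1)] integrable_mult_right[OF G_int[OF B(1)]]])
            (use True P_eq[of x 0 _ n] p_bounds[of x 0] G_nonneg in \<open>simp add: indicator_def mult_right_mono\<close>)
        then have "U n 0 x \<le> r 0 * (\<integral>y\<in>B 0. G n y \<partial>N)"
          by (simp only: integral_mult_right_zero set_lebesgue_integral_def)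
        from mult_right_mono[OF this F_nonneg[of n x]] True show ?thesis
          by (simp add: mult.commute)
      next
        case False
        then show ?thesis using FU_le[of n x 0] by simp
      qed
    qed
    also have "\<dots> = r 0 * (\<integral>y\<in>B 0. G n y \<partial>N)"
      using F_A0[of n] by (simp only: integral_mult_right_zero set_lebesgue_integral_def)
    finally show ?thesis
      using A0 B0 M.prob_compl[OF A(1)[of 0]] by (simp add: Compl_eq_Diff_UNIV)
  qed
  define u where "u j = 1 / r j * (1 / (2 * r 0))" for j
  have u: "0 < u j" for j using r0 by (simp add: u_def)
  have U_ge: "u j \<le> U n k x" if "j \<le> k" "k \<le> n" "x \<in> A j" for j k n x
  proof -
    have "1 / (2 * r 0) \<le> (\<integral>y\<in>B 0. G n y \<partial>N)"
      using half[of n] r0[of 0] by (simp add: field_simps)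
    then have "u j \<le> 1 / r j * (\<integral>y\<in>B 0. G n y \<partial>N)"
      unfolding u_def using r0[of j] by (intro mult_left_mono) auto
    also have "\<dots> = (\<integral>y. (1 / r j) * (indicator (B 0) y *\<^sub>R G n y) \<partial>N)"
      by (simp only: integral_mult_right_zero set_lebesgue_integral_def)
    also have "\<dots> \<le> U n 0 x"
      unfolding U_def set_lebesgue_integral_def
    proof (rule integral_mono[OF integrable_mult_right[OF G_int[OF B(1)]] U_int[OF B(1)]])
      fix y show "1 / r j * (indicator (B 0) y *\<^sub>R G n y) \<le> indicator (B 0) y *\<^sub>R (P n x y * G n y)"
      proof (cases "y \<in> B 0")
        case True
        then have "y \<in> B j" using B_mono by blast
        then have "1 / r j \<le> P n x y" using that P_eq[of x j y n] p_bounds[of x j y] by simp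
        from mult_right_mono[OF this G_nonneg[of n y]] True show ?thesis by simp
      qed simp
    qed
    also have "\<dots> \<le> U n k x" by (rule U_mono) simp
    finally show ?thesis .
  qed
  have F_le: "F n x \<le> 1 / u k" if "k \<le> n" "x \<in> A k" for n k x
  proof -
    have "F n x * u k \<le> F n x * U n k x"
      using U_ge[OF order_refl that] F_nonneg by (rule mult_left_mono)
    also have "\<dots> \<le> 1" by (rule FU_le)
    finally show ?thesis using u[of k] by (simp add: field_simps)
  qed
  have U_le: "U n k x \<le> r k * r k" if "k \<le> n" "x \<in> A k" for n k x
    unfolding U_def set_lebesgue_integral_def
    by (rule N.integral_le_const[OF U_int[OF B(1)]])
      (use that P_eq[of x k _ n] p_bounds[of x k] G_le[OF that(1)] G_nonneg r0[of k] in
        \<open>auto simp: indicator_def intro!: mult_mono AE_I2\<close>)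
  have V_le: "V n k y \<le> r k * (1 / u k)" if "k \<le> n" "y \<in> B k" for n k y
    unfolding V_def set_lebesgue_integral_def
    by (rule M.integral_le_const[OF V_int[OF A(1)]], rule AE_I2)
      (use that P_eq[of _ k y n] p_bounds[of _ k y] F_le[OF that(1)] F_nonneg r0[of k] u[of k] in
        \<open>auto simp: indicator_def less_imp_le simp del: times_divide_eq_right intro!: mult_mono\<close>)

  \<comment> \<open>Only the integrals of \<open>G n\<close> against \<open>p x\<close> are made to
    converge here; convergence of \<open>G n\<close> itself comes last.\<close>
  obtain s :: "nat \<Rightarrow> nat" where s: "strict_mono s"
    and conv: "\<And>k x. x \<in> A k \<Longrightarrow> convergent (\<lambda>n. \<integral>y\<in>B k. p x y * G (s n) y \<partial>N)"
  proof (rule integral_operator_convergent_subsequence[of N B p A r G])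
    show "\<bar>p x y\<bar> \<le> r k" if "x \<in> A k" "y \<in> B k" for k x y
      using p_bounds[OF that] p_nonneg[of x y] by simp
    show "\<bar>G n y\<bar> \<le> r k" if "k \<le> n" "y \<in> B k" for n k y
      using G_le[OF that] G_nonneg[of n y] by simp
    show "0 \<le> r k" for k using r0[of k] by simp
  qed (use p_cont N.finite_measure_axioms B(1) FG_meas in auto)
  have s_ge: "k \<le> s n" if "k \<le> n" for k n
    using seq_suble[OF s, of n] that by simp
  define U' where "U' k x = lim (\<lambda>n. \<integral>y\<in>B k. p x y * G (s n) y \<partial>N)" for k x
  have pG_lim: "(\<lambda>n. \<integral>y\<in>B k. p x y * G (s n) y \<partial>N) \<longlonglongrightarrow> U' k x" if "x \<in> A k" for k x
    unfolding U'_def using conv[OF that] by (simp add: convergent_LIMSEQ_iff)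
  have U_eq: "U (s n) k x = (\<integral>y\<in>B k. p x y * G (s n) y \<partial>N)" if "k \<le> n" "x \<in> A k" for n k x
    unfolding U_def by (rule set_lebesgue_integral_cong) (use that s_ge[of k n] P_eq[of x k _ "s n"] in auto)
  have V_eq: "V (s n) k y = (\<integral>x\<in>A k. p x y * F (s n) x \<partial>M)" if "k \<le> n" "y \<in> B k" for n k y
    unfolding V_def by (rule set_lebesgue_integral_cong) (use that s_ge[of k n] P_eq[of _ k y "s n"] in auto)
  have U_lim: "(\<lambda>n. U (s n) k x) \<longlonglongrightarrow> U' k x" if "x \<in> A k" for k x
    by (rule Lim_transform_eventually[OF pG_lim[OF that]], rule eventually_sequentiallyI[of k])
      (use U_eq that in auto)
  have dB: "(\<lambda>k. 1 - measure N (B k)) \<longlonglongrightarrow> 0"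
    using tendsto_diff[OF tendsto_const[of 1] N.finite_Lim_measure_incseq[of B]] B N.prob_space
    by (simp add: image_subset_iff)
  have dA: "(\<lambda>k. 1 - measure M (A k)) \<longlonglongrightarrow> 0"
    using tendsto_diff[OF tendsto_const[of 1] M.finite_Lim_measure_incseq[of A]] A M.prob_space
    by (simp add: image_subset_iff)

  obtain F' where [measurable]: "F' \<in> borel_measurable M" and F'_nonneg: "\<And>x. 0 \<le> F' x"
    and F'_le: "\<And>j x. x \<in> A j \<Longrightarrow> F' x \<le> 1 / u j"
    and F'_lim: "\<And>j. (\<lambda>n. \<integral>x\<in>A j. \<bar>F (s n) x - F' x\<bar> \<partial>M) \<longlonglongrightarrow> 0"
    and F'_AE: "AE x in M. (\<lambda>k. F' x * U' k x) \<longlonglongrightarrow> 1"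
  proof (rule reciprocal_limit[of M A "\<lambda>n. F (s n)" "\<lambda>n. U (s n)" "\<lambda>k. 1 - measure N (B k)" u
        "\<lambda>k. r k * r k" U'])
    show "u j \<le> U (s n) k x" if "j \<le> k" "k \<le> n" "x \<in> A j" for n k j x
      using U_ge[OF that(1) s_ge[OF that(2)] that(3)] .
    show "U (s n) k x \<le> r k * r k" if "k \<le> n" "x \<in> A k" for n k x
      using U_le[OF s_ge[OF that(1)] that(2)] .
  qed (use A M.finite_measure_axioms F_nonneg U_mono FU_le FU_int dB u U_lim in auto)
  \<comment> \<open>Strong convergence of \<open>F\<close> makes the integrals \<open>V\<close>
    converge along the same subsequence, so \<open>reciprocal_limit\<close> applies again with the
    two spaces exchanged.\<close>
  have pF_lim: "(\<lambda>n. \<integral>x\<in>A k. p x y * F (s n) x \<partial>M) \<longlonglongrightarrow> (\<integral>x\<in>A k. p x y * F' x \<partial>M)" if "y \<in> B k" for k y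
  proof (rule set_integral_mult_L1_limit[of M "A k" "\<lambda>x. p x y" "\<lambda>n. F (s n)" F' "r k" k "1 / u k"])
    show "\<bar>p x y\<bar> \<le> r k" if "x \<in> A k" for x
      using p_bounds[OF that \<open>y \<in> B k\<close>] p_nonneg[of x y] by simp
    show "\<bar>F (s n) x\<bar> \<le> 1 / u k" if "k \<le> n" "x \<in> A k" for n x
      using F_le[OF s_ge[OF that(1)] that(2)] F_nonneg[of "s n" x] by simp
    show "\<bar>F' x\<bar> \<le> 1 / u k" if "x \<in> A k" for x
      using F'_le[OF that] F'_nonneg[of x] by simp
  qed (use M.finite_measure_axioms F'_lim A(1) in auto)
  have V_lim: "(\<lambda>n. V (s n) k y) \<longlonglongrightarrow> (\<integral>x\<in>A k. p x y * F' x \<partial>M)" if "y \<in> B k" for k y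
    by (rule Lim_transform_eventually[OF pF_lim[OF that]], rule eventually_sequentiallyI[of k])
      (use V_eq that in auto)
  have inv_r: "0 < 1 / r j" for j using r0 by simp
  obtain G' where [measurable]: "G' \<in> borel_measurable N" and G'_nonneg: "\<And>y. 0 \<le> G' y"
    and G'_le: "\<And>j y. y \<in> B j \<Longrightarrow> G' y \<le> 1 / (1 / r j)"
    and G'_lim: "\<And>j. (\<lambda>n. \<integral>y\<in>B j. \<bar>G (s n) y - G' y\<bar> \<partial>N) \<longlonglongrightarrow> 0"
    and G'_AE: "AE y in N. (\<lambda>k. G' y * (\<integral>x\<in>A k. p x y * F' x \<partial>M)) \<longlonglongrightarrow> 1"
  proof (rule reciprocal_limit[of N B "\<lambda>n. G (s n)" "\<lambda>n. V (s n)" "\<lambda>k. 1 - measure M (A k)" "\<lambda>j. 1 / r j"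
        "\<lambda>k. r k * (1 / u k)" "\<lambda>k y. \<integral>x\<in>A k. p x y * F' x \<partial>M"])
    show "1 / r j \<le> V (s n) k y" if "j \<le> k" "k \<le> n" "y \<in> B j" for n k j y
      using V_ge[OF that(1) s_ge[OF that(2)] that(3)] .
    show "V (s n) k y \<le> r k * (1 / u k)" if "k \<le> n" "y \<in> B k" for n k y
      using V_le[OF s_ge[OF that(1)] that(2)] .
  qed (use B N.finite_measure_axioms G_nonneg V_mono GV_le GV_int dA V_lim inv_r in auto)
  \<comment> \<open>\<open>U'\<close> came from compactness, as a bare limit. Strong convergence of
    \<open>G\<close> identifies it as an integral against \<open>G'\<close>, which closes the first
    equation.\<close>
  have U'_eq: "U' k x = (\<integral>y\<in>B k. p x y * G' y \<partial>N)" if "x \<in> A k" for k x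
  proof (rule LIMSEQ_unique[OF pG_lim[OF that]],
      rule set_integral_mult_L1_limit[of N "B k" "p x" "\<lambda>n. G (s n)" G' "r k" k "r k"])
    show "\<bar>p x y\<bar> \<le> r k" if "y \<in> B k" for y
      using p_bounds[OF \<open>x \<in> A k\<close> that] p_nonneg[of x y] by simp
    show "\<bar>G (s n) y\<bar> \<le> r k" if "k \<le> n" "y \<in> B k" for n y
      using G_le[OF s_ge[OF that(1)] that(2)] G_nonneg[of "s n" y] by simp
    show "\<bar>G' y\<bar> \<le> r k" if "y \<in> B k" for y
      using G'_le[OF that] G'_nonneg[of y] by simp
  qed (use N.finite_measure_axioms G'_lim B(1) in auto)

  have "AE x in M. ennreal (F' x) * (\<integral>\<^sup>+y. ennreal (p x y * G' y) \<partial>N) = 1"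
    using F'_AE
  proof eventually_elim
    fix x assume lim: "(\<lambda>k. F' x * U' k x) \<longlonglongrightarrow> 1"
    obtain j where j: "x \<in> A j" using A(3) by blast
    show "ennreal (F' x) * (\<integral>\<^sup>+y. ennreal (p x y * G' y) \<partial>N) = 1"
    proof (rule nn_integral_mult_eq_one_of_exhaustion[OF B, where j = j])
      show "integrable N (\<lambda>y. indicator (B k) y *\<^sub>R (p x y * G' y))" if "j \<le> k" for k
      proof (rule N_int[OF B(1)])
        show "\<bar>p x y * G' y\<bar> \<le> r k * r k" if y: "y \<in> B k" for y
          unfolding abs_mult using p_bounds[OF A_mono[OF j \<open>j \<le> k\<close>] y] G'_le[OF y] p_nonneg[of x y] G'_nonneg[of y]
          by (intro mult_mono) auto
      qed measurable
      show "(\<lambda>k. F' x * (\<integral>y\<in>B k. p x y * G' y \<partial>N)) \<longlonglongrightarrow> 1"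
        by (rule Lim_transform_eventually[OF lim], rule eventually_sequentiallyI[of j])
          (use U'_eq A_mono[OF j] in auto)
    qed (use p_nonneg G'_nonneg F'_nonneg in auto)
  qed
  moreover have "AE y in N. ennreal (G' y) * (\<integral>\<^sup>+x. ennreal (p x y * F' x) \<partial>M) = 1"
    using G'_AE
  proof eventually_elim
    fix y assume lim: "(\<lambda>k. G' y * (\<integral>x\<in>A k. p x y * F' x \<partial>M)) \<longlonglongrightarrow> 1"
    obtain j where j: "y \<in> B j" using B(3) by blast
    show "ennreal (G' y) * (\<integral>\<^sup>+x. ennreal (p x y * F' x) \<partial>M) = 1"
    proof (rule nn_integral_mult_eq_one_of_exhaustion[OF A, where j = j])
      show "integrable M (\<lambda>x. indicator (A k) x *\<^sub>R (p x y * F' x))" if "j \<le> k" for k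
      proof (rule M_int[OF A(1)])
        show "\<bar>p x y * F' x\<bar> \<le> r k * (1 / u k)" if x: "x \<in> A k" for x
          unfolding abs_mult using p_bounds[OF x B_mono[OF j \<open>j \<le> k\<close>]] F'_le[OF x] p_nonneg[of x y] F'_nonneg[of x]
          by (intro mult_mono) auto
      qed measurable
    qed (use lim p_nonneg G'_nonneg F'_nonneg in auto)
  qed
  ultimately show ?thesis
    unfolding schroedinger_pair_def using F'_nonneg G'_nonneg
    by (intro exI[of _ F'] exI[of _ G']) auto
qed

lemma UN_incseq_shift:
  assumes "incseq S" "(\<Union>k. S k) = UNIV"
  shows "(\<Union>k. S (k + l)) = UNIV"
proof (intro equalityI subset_UNIV subsetI)
  fix z
  obtain k where "z \<in> S k" using assms(2) by blast
  moreover have "S k \<subseteq> S (k + l)" using assms(1) by (simp add: incseqD)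
  ultimately show "z \<in> (\<Union>k. S (k + l))" by blast
qed

text \<open>Dropping finitely many sets leaves \<open>A 0\<close> and \<open>B 0\<close> with mass
  above \<open>3 / 4\<close>, so that every coupling charges their product. One number dominating
  \<open>1\<close>, \<open>1 / c\<close> and \<open>C\<close> bounds the kernel on both
  sides.\<close>

theorem schroedinger_pair_exists:
  fixes M :: "'a::{metric_space, second_countable_topology} measure" and N :: "'b measure"
    and p :: "'a \<Rightarrow> 'b \<Rightarrow> real"
  assumes "prob_space M" "prob_space N" "space M = UNIV" "space N = UNIV"
    and p_meas: "(\<lambda>(x, y). p x y) \<in> borel_measurable (M \<Otimes>\<^sub>M N)" and p_nonneg: "\<And>x y. 0 \<le> p x y"
    and A: "\<And>k. A k \<in> sets M" "incseq A" "(\<Union>k. A k) = UNIV"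
    and B: "\<And>k. B k \<in> sets N" "incseq B" "(\<Union>k. B k) = UNIV"
    and p_bounds: "\<And>k. \<exists>c>0. \<exists>C. \<forall>x\<in>A k. \<forall>y\<in>B k. c \<le> p x y \<and> p x y \<le> C"
    and p_cont: "\<And>k y. y \<in> B k \<Longrightarrow> continuous_on (A k) (\<lambda>x. p x y)"
  shows "\<exists>F G. schroedinger_pair M N p F G"
proof -
  interpret M: prob_space M by fact
  interpret N: prob_space N by fact
  have "(\<lambda>k. measure M (A k)) \<longlonglongrightarrow> 1" "(\<lambda>k. measure N (B k)) \<longlonglongrightarrow> 1"
    using M.finite_Lim_measure_incseq[of A] N.finite_Lim_measure_incseq[of B] A B M.prob_space N.prob_space assms(3,4)
    by (auto simp: image_subset_iff)
  from order_tendstoD(1)[OF this(1), of "3 / 4"] order_tendstoD(1)[OF this(2), of "3 / 4"]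
  have "\<forall>\<^sub>F k in sequentially. 3 / 4 < measure M (A k) \<and> 3 / 4 < measure N (B k)"
    by (intro eventually_conj) auto
  then obtain l where l: "3 / 4 < measure M (A l)" "3 / 4 < measure N (B l)"
    by (auto simp: eventually_sequentially)
  have "\<exists>r\<ge>1. \<forall>x\<in>A (k + l). \<forall>y\<in>B (k + l). 1 / r \<le> p x y \<and> p x y \<le> r" for k
  proof -
    obtain c C where c: "0 < c" and cC: "\<And>x y. x \<in> A (k + l) \<Longrightarrow> y \<in> B (k + l) \<Longrightarrow> c \<le> p x y \<and> p x y \<le> C"
      using p_bounds[of "k + l"] by blast
    define R where "R = max 1 (max (1 / c) C)"
    have R: "1 \<le> R" "1 / c \<le> R" "C \<le> R" by (auto simp: R_def)
    have "1 / R \<le> 1 / (1 / c)" using R c by (intro divide_left_mono) auto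
    with cC R show ?thesis by (intro exI[of _ R]) (auto intro: order_trans)
  qed
  then obtain r where r: "\<And>k. 1 \<le> r k"
    "\<And>k x y. x \<in> A (k + l) \<Longrightarrow> y \<in> B (k + l) \<Longrightarrow> 1 / r k \<le> p x y \<and> p x y \<le> r k"
    by metis
  show ?thesis
    by (rule schroedinger_pair_exists_aux[of M N p "\<lambda>k. A (k + l)" "\<lambda>k. B (k + l)" r])
      (use assms r l UN_incseq_shift[OF A(2,3)] UN_incseq_shift[OF B(2,3)] in \<open>auto simp: incseq_def\<close>)
qed

section \<open>Uniqueness\<close>

text \<open>Tonelli in the two orders of integration: the density \<open>F x * p x y * G y\<close>
  has marginals \<open>M\<close> and \<open>N\<close>, tested here against nonnegative functions of
  one coordinate.\<close>

lemma schroedinger_pair_weighted_mass: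
  fixes M :: "'a measure" and N :: "'b measure" and p :: "'a \<Rightarrow> 'b \<Rightarrow> real"
  assumes "sigma_finite_measure M" "sigma_finite_measure N"
    and p_meas[measurable]: "(\<lambda>(x, y). p x y) \<in> borel_measurable (M \<Otimes>\<^sub>M N)"
    and p_nonneg: "\<And>x y. 0 \<le> p x y"
    and pair: "schroedinger_pair M N p F G"
  shows "a \<in> borel_measurable M \<Longrightarrow> (\<And>x. 0 \<le> a x) \<Longrightarrow>
      (\<integral>\<^sup>+(x, y). ennreal (F x * p x y * G y * a x) \<partial>(M \<Otimes>\<^sub>M N)) = (\<integral>\<^sup>+x. ennreal (a x) \<partial>M)"
    and "b \<in> borel_measurable N \<Longrightarrow> (\<And>y. 0 \<le> b y) \<Longrightarrow>
      (\<integral>\<^sup>+(x, y). ennreal (F x * p x y * G y * b y) \<partial>(M \<Otimes>\<^sub>M N)) = (\<integral>\<^sup>+y. ennreal (b y) \<partial>N)"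
proof -
  interpret M: sigma_finite_measure M by fact
  interpret N: sigma_finite_measure N by fact
  interpret MN: pair_sigma_finite M N ..
  have [measurable]: "F \<in> borel_measurable M" "G \<in> borel_measurable N"
    and nonneg: "\<And>x. 0 \<le> F x" "\<And>y. 0 \<le> G y"
    and F: "AE x in M. ennreal (F x) * (\<integral>\<^sup>+y. ennreal (p x y * G y) \<partial>N) = 1"
    and G: "AE y in N. ennreal (G y) * (\<integral>\<^sup>+x. ennreal (p x y * F x) \<partial>M) = 1"
    using pair by (auto simp: schroedinger_pair_def)
  show "(\<integral>\<^sup>+(x, y). ennreal (F x * p x y * G y * a x) \<partial>(M \<Otimes>\<^sub>M N)) = (\<integral>\<^sup>+x. ennreal (a x) \<partial>M)"
    if [measurable]: "a \<in> borel_measurable M" and a: "\<And>x. 0 \<le> a x"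
  proof -
    have "(\<integral>\<^sup>+(x, y). ennreal (F x * p x y * G y * a x) \<partial>(M \<Otimes>\<^sub>M N)) =
        (\<integral>\<^sup>+x. \<integral>\<^sup>+y. ennreal (F x * p x y * G y * a x) \<partial>N \<partial>M)"
      by (subst N.nn_integral_fst[symmetric]) auto
    also have "\<dots> = (\<integral>\<^sup>+x. ennreal (a x) * (ennreal (F x) * (\<integral>\<^sup>+y. ennreal (p x y * G y) \<partial>N)) \<partial>M)"
    proof (rule nn_integral_cong)
      fix x assume x: "x \<in> space M"
      have "(\<integral>\<^sup>+y. ennreal (F x * p x y * G y * a x) \<partial>N) = (\<integral>\<^sup>+y. ennreal (a x * F x) * ennreal (p x y * G y) \<partial>N)"
        using a nonneg p_nonneg by (simp add: ennreal_mult[symmetric] mult_ac)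
      also have "\<dots> = ennreal (a x * F x) * (\<integral>\<^sup>+y. ennreal (p x y * G y) \<partial>N)"
        using x by (intro nn_integral_cmult) simp
      finally show "(\<integral>\<^sup>+y. ennreal (F x * p x y * G y * a x) \<partial>N) =
          ennreal (a x) * (ennreal (F x) * (\<integral>\<^sup>+y. ennreal (p x y * G y) \<partial>N))"
        using a nonneg by (simp add: ennreal_mult mult.assoc)
    qed
    also have "\<dots> = (\<integral>\<^sup>+x. ennreal (a x) \<partial>M)"
      by (rule nn_integral_cong_AE) (use F in eventually_elim, simp)
    finally show ?thesis .
  qed
  show "(\<integral>\<^sup>+(x, y). ennreal (F x * p x y * G y * b y) \<partial>(M \<Otimes>\<^sub>M N)) = (\<integral>\<^sup>+y. ennreal (b y) \<partial>N)"
    if [measurable]: "b \<in> borel_measurable N" and b: "\<And>y. 0 \<le> b y"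
  proof -
    have "(\<integral>\<^sup>+(x, y). ennreal (F x * p x y * G y * b y) \<partial>(M \<Otimes>\<^sub>M N)) =
        (\<integral>\<^sup>+y. \<integral>\<^sup>+x. ennreal (F x * p x y * G y * b y) \<partial>M \<partial>N)"
      by (subst MN.nn_integral_snd[symmetric]) auto
    also have "\<dots> = (\<integral>\<^sup>+y. ennreal (b y) * (ennreal (G y) * (\<integral>\<^sup>+x. ennreal (p x y * F x) \<partial>M)) \<partial>N)"
    proof (rule nn_integral_cong)
      fix y assume y: "y \<in> space N"
      have "(\<integral>\<^sup>+x. ennreal (F x * p x y * G y * b y) \<partial>M) = (\<integral>\<^sup>+x. ennreal (b y * G y) * ennreal (p x y * F x) \<partial>M)"
        using b nonneg p_nonneg by (simp add: ennreal_mult[symmetric] mult_ac)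
      also have "\<dots> = ennreal (b y * G y) * (\<integral>\<^sup>+x. ennreal (p x y * F x) \<partial>M)"
        using y by (intro nn_integral_cmult) simp
      finally show "(\<integral>\<^sup>+x. ennreal (F x * p x y * G y * b y) \<partial>M) =
          ennreal (b y) * (ennreal (G y) * (\<integral>\<^sup>+x. ennreal (p x y * F x) \<partial>M))"
        using b nonneg by (simp add: ennreal_mult mult.assoc)
    qed
    also have "\<dots> = (\<integral>\<^sup>+y. ennreal (b y) \<partial>N)"
      by (rule nn_integral_cong_AE) (use G in eventually_elim, simp)
    finally show ?thesis .
  qed
qed

text \<open>Both couplings \<open>F x * p x y * G y\<close> and \<open>F' x * p x y * G' y\<close> have marginals \<open>M\<close> and \<open>N\<close>, so
  they integrate \<open>a x - b y\<close> to the same value, where \<open>a = F' / (F + F')\<close> and \<open>b = G / (G + G')\<close>.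
  But the difference of the couplings is \<open>p x y * (F' x * G' y - F x * G y)\<close>, which has the sign of
  \<open>a x - b y\<close>.\<close>

theorem schroedinger_pair_unique:
  fixes M :: "'a measure" and N :: "'b measure" and p :: "'a \<Rightarrow> 'b \<Rightarrow> real"
  assumes "prob_space M" "prob_space N"
    and p_meas[measurable]: "(\<lambda>(x, y). p x y) \<in> borel_measurable (M \<Otimes>\<^sub>M N)"
    and p_pos: "\<And>x y. 0 < p x y"
    and pair: "schroedinger_pair M N p F G" and pair': "schroedinger_pair M N p F' G'"
  obtains \<kappa> where "0 < \<kappa>" "AE x in M. F' x = \<kappa> * F x" "AE y in N. G' y = inverse \<kappa> * G y"
proof -
  interpret M: prob_space M by fact
  interpret N: prob_space N by fact
  interpret MN: pair_prob_space M N ..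
  have p_nonneg: "0 \<le> p x y" for x y using p_pos[of x y] by simp
  have [measurable]: "F \<in> borel_measurable M" "G \<in> borel_measurable N"
      "F' \<in> borel_measurable M" "G' \<in> borel_measurable N"
    and nonneg: "\<And>x. 0 \<le> F x" "\<And>y. 0 \<le> G y" "\<And>x. 0 \<le> F' x" "\<And>y. 0 \<le> G' y"
    using pair pair' by (auto simp: schroedinger_pair_def)
  have FG_pos: "(AE x in M. 0 < F x) \<and> (AE y in N. 0 < G y)" if "schroedinger_pair M N p F G" for F G
  proof -
    have *: "0 < c" if "ennreal c * i = 1" for c i
      using that by (cases "0 < c") (auto simp: ennreal_neg not_less)
    show ?thesis
      using that by (auto simp: schroedinger_pair_def elim!: eventually_mono intro: *)
  qed
  \<comment> \<open>The weights increase with \<open>F' / F\<close> and with \<open>G / G'\<close>.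
    Logarithms of these ratios would give the same sign but need not be integrable, whereas
    \<open>a\<close> and \<open>b\<close> lie between \<open>0\<close> and \<open>1\<close>.\<close>
  define a where "a x = F' x / (F x + F' x)" for x
  define b where "b y = G y / (G y + G' y)" for y
  have [measurable]: "a \<in> borel_measurable M" "b \<in> borel_measurable N"
    by (simp_all add: a_def[abs_def] b_def[abs_def])
  have ab: "0 \<le> a x" "a x \<le> 1" "0 \<le> b y" "b y \<le> 1" for x y
    using nonneg by (auto simp: a_def b_def divide_le_eq_1 add_nonneg_nonneg less_le)
  define D where "D x y = p x y * (F' x * G' y - F x * G y)\<^sup>2 / ((F x + F' x) * (G y + G' y))" for x y
  have D_nonneg: "0 \<le> D x y" for x y
    using nonneg p_nonneg by (simp add: D_def)
  have [measurable]: "(\<lambda>(x, y). D x y) \<in> borel_measurable (M \<Otimes>\<^sub>M N)"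
    unfolding D_def by measurable
  have pos: "AE x in M. 0 < F x \<and> 0 < F' x" "AE y in N. 0 < G y \<and> 0 < G' y"
    using FG_pos[OF pair] FG_pos[OF pair'] by auto
  have pos_pair: "AE z in M \<Otimes>\<^sub>M N. (0 < F (fst z) \<and> 0 < F' (fst z)) \<and> (0 < G (snd z) \<and> 0 < G' (snd z))"
  proof (rule MN.AE_pair_measure)
    show "AE x in M. AE y in N. (0 < F (fst (x, y)) \<and> 0 < F' (fst (x, y))) \<and> (0 < G (snd (x, y)) \<and> 0 < G' (snd (x, y)))"
      using pos(1) by eventually_elim (use pos(2) in simp)
  qed measurable
  let ?w = "\<lambda>x y. F x * p x y * G y" and ?w' = "\<lambda>x y. F' x * p x y * G' y"
  \<comment> \<open>The negative terms of the product of \<open>a x - b y\<close> with the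
    difference of the couplings are moved across, so that all summands are nonnegative and can be
    integrated in \<open>[0, \<infinity>]\<close>. Both sides then contain the same finite
    \<open>?A + ?B\<close>, which cancels and leaves a zero integral of \<open>D\<close>.\<close>
  have "?w' x y * a x + ?w x y * b y = ?w x y * a x + ?w' x y * b y + D x y"
    if "0 < F x" "0 < F' x" "0 < G y" "0 < G' y" for x y
  proof -
    have "a x - b y = (F' x * G' y - F x * G y) / ((F x + F' x) * (G y + G' y))"
      using that by (simp add: a_def b_def diff_frac_eq add_pos_pos less_imp_neq[symmetric] algebra_simps)
    then have "D x y = p x y * (F' x * G' y - F x * G y) * (a x - b y)"
      by (simp add: D_def power2_eq_square)
    then show ?thesis by (simp add: algebra_simps)
  qed
  then have eq: "ennreal (?w' x y * a x) + ennreal (?w x y * b y) =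
      ennreal (?w x y * a x) + ennreal (?w' x y * b y) + ennreal (D x y)"
    if "0 < F x" "0 < F' x" "0 < G y" "0 < G' y" for x y
    using that nonneg p_nonneg ab D_nonneg by (simp add: ennreal_plus[symmetric] del: ennreal_plus)
  let ?A = "\<integral>\<^sup>+x. ennreal (a x) \<partial>M" and ?B = "\<integral>\<^sup>+y. ennreal (b y) \<partial>N"
  have le1: "?A \<le> 1" "?B \<le> 1"
    using nn_integral_mono[of M "\<lambda>x. ennreal (a x)" "\<lambda>_. 1"] nn_integral_mono[of N "\<lambda>x. ennreal (b x)" "\<lambda>_. 1"] ab
    by (auto simp: M.emeasure_space_1 N.emeasure_space_1)
  note mass = schroedinger_pair_weighted_mass[OF M.sigma_finite_measure_axioms N.sigma_finite_measure_axioms p_meas p_nonneg]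
  have "?A + ?B = (\<integral>\<^sup>+(x, y). ennreal (?w' x y * a x) \<partial>(M \<Otimes>\<^sub>M N)) + (\<integral>\<^sup>+(x, y). ennreal (?w x y * b y) \<partial>(M \<Otimes>\<^sub>M N))"
    using mass(1)[OF pair' _ ab(1)] mass(2)[OF pair _ ab(3)] by simp
  also have "\<dots> = (\<integral>\<^sup>+z. (case z of (x, y) \<Rightarrow> ennreal (?w' x y * a x)) + (case z of (x, y) \<Rightarrow> ennreal (?w x y * b y)) \<partial>(M \<Otimes>\<^sub>M N))"
    by (rule nn_integral_add[symmetric]) measurable
  also have "\<dots> = (\<integral>\<^sup>+z. ((case z of (x, y) \<Rightarrow> ennreal (?w x y * a x)) + (case z of (x, y) \<Rightarrow> ennreal (?w' x y * b y))) +
      (case z of (x, y) \<Rightarrow> ennreal (D x y)) \<partial>(M \<Otimes>\<^sub>M N))"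
    by (rule nn_integral_cong_AE) (use pos_pair in eventually_elim, use eq in \<open>auto simp: split_beta\<close>)
  also have "\<dots> = ((\<integral>\<^sup>+(x, y). ennreal (?w x y * a x) \<partial>(M \<Otimes>\<^sub>M N)) + (\<integral>\<^sup>+(x, y). ennreal (?w' x y * b y) \<partial>(M \<Otimes>\<^sub>M N))) +
      (\<integral>\<^sup>+(x, y). ennreal (D x y) \<partial>(M \<Otimes>\<^sub>M N))"
    by (rule trans[OF nn_integral_add arg_cong2[where f = "(+)", OF nn_integral_add refl]]) measurable
  also have "\<dots> = (?A + ?B) + (\<integral>\<^sup>+(x, y). ennreal (D x y) \<partial>(M \<Otimes>\<^sub>M N))"
    using mass(1)[OF pair _ ab(1)] mass(2)[OF pair' _ ab(3)] by simp
  finally have "(\<integral>\<^sup>+(x, y). ennreal (D x y) \<partial>(M \<Otimes>\<^sub>M N)) = 0"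
    using le1 by (metis add.right_neutral ennreal_add_left_cancel ennreal_add_eq_top ennreal_one_neq_top neq_top_trans)
  then have "AE z in M \<Otimes>\<^sub>M N. (case z of (x, y) \<Rightarrow> ennreal (D x y)) = 0"
    by (subst (asm) nn_integral_0_iff_AE) auto
  with pos_pair have "AE z in M \<Otimes>\<^sub>M N. F' (fst z) * G' (snd z) = F (fst z) * G (snd z)"
    by eventually_elim (use D_nonneg p_pos in \<open>auto simp: D_def split_beta less_imp_neq[symmetric] add_pos_pos\<close>)
  from MN.AE_pair[OF this] have "AE x in M. AE y in N. F' x * G' y = F x * G y"
    by simp
  with pos have AE_x: "AE x in M. 0 < F x \<and> 0 < F' x \<and> (AE y in N. F' x * G' y = F x * G y)"
    by auto
  then obtain x0 where x0: "0 < F x0" "0 < F' x0" "AE y in N. F' x0 * G' y = F x0 * G y"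
    using eventually_happens'[OF M.ae_filter_bot AE_x] by blast
  \<comment> \<open>Fixing one point \<open>x0\<close> separates the variables in
    \<open>F' x * G' y = F x * G y\<close>.\<close>
  define \<kappa> where "\<kappa> = F' x0 / F x0"
  have \<kappa>: "0 < \<kappa>" using x0 by (simp add: \<kappa>_def)
  have G': "AE y in N. G' y = inverse \<kappa> * G y"
    using x0(3) by eventually_elim (use x0 in \<open>simp add: \<kappa>_def field_simps\<close>)
  have "AE x in M. F' x = \<kappa> * F x"
    using AE_x
  proof eventually_elim
    fix x assume x: "0 < F x \<and> 0 < F' x \<and> (AE y in N. F' x * G' y = F x * G y)"
    then have "AE y in N. F' x * G' y = F x * G y" by simp
    with pos(2) G' have "AE y in N. 0 < G y \<and> G' y = inverse \<kappa> * G y \<and> F' x * G' y = F x * G y"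
      by eventually_elim simp
    then obtain y where "0 < G y" "G' y = inverse \<kappa> * G y" "F' x * G' y = F x * G y"
      using eventually_happens'[OF N.ae_filter_bot] by blast
    then have "(F' x * inverse \<kappa>) * G y = F x * G y" by simp
    with \<open>0 < G y\<close> have "F' x * inverse \<kappa> = F x" by simp
    with \<kappa> show "F' x = \<kappa> * F x" by (auto simp: field_simps)
  qed
  with \<kappa> G' show ?thesis using that by blast
qed

section \<open>The killed diffusion\<close>

lemma AE_lborel_open_witness:
  fixes S :: "'a::euclidean_space set"
  assumes "AE x in lborel. P x" "open S" "S \<noteq> {}"
  obtains x where "x \<in> S" "P x"
proof (rule ccontr)
  assume "\<not> thesis"
  with that have "\<And>x. P x \<Longrightarrow> x \<notin> S" by blast
  with assms(1) have "AE x in lborel. x \<notin> S" by (auto elim: eventually_mono)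
  then have "S \<in> null_sets lborel"
    using assms(2) by (subst AE_iff_null_sets) auto
  then have "negligible S"
    by (simp add: negligible_iff_null_sets null_sets_completionI)
  with open_not_negligible assms(2,3) show False by blast
qed

locale killed_kernel =
  fixes V :: "real \<Rightarrow> real ^ 'n::finite \<Rightarrow> real"
    and q :: "real \<Rightarrow> real ^ 'n \<Rightarrow> real \<Rightarrow> real ^ 'n \<Rightarrow> real"
  assumes V_cont: "continuous_on ({0..1} \<times> UNIV) (\<lambda>(t, x). V t x)"
    and V_nonneg: "\<And>t x. t \<in> {0..1} \<Longrightarrow> 0 \<le> V t x"
    and V_nonzero: "\<exists>t\<in>{0..1}. \<exists>x. V t x \<noteq> 0"
    and q_transition: "killed_transition_density V q"
    and q_cont: "continuous_on {(s, x, t, y). 0 \<le> s \<and> s < t \<and> t \<le> 1} (\<lambda>(s, x, t, y). q s x t y)"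
    and q_pos: "\<And>s x t y. 0 \<le> s \<Longrightarrow> s < t \<Longrightarrow> t \<le> 1 \<Longrightarrow> 0 < q s x t y"
begin

section \<open>Measurability of the kernel, and the killing probability\<close>

lemma q_continuous:
  assumes "0 \<le> s" "s < t" "t \<le> 1" "continuous_on S f" "continuous_on S g"
  shows "continuous_on S (\<lambda>w. q s (f w) t (g w))"
proof -
  have "continuous_on S (\<lambda>w. (s, f w, t, g w))"
    by (intro continuous_intros assms)
  from continuous_on_compose2[OF q_cont this] show ?thesis
    using assms by auto
qed

lemma q_measurable:
  assumes "0 \<le> s" "s < t" "t \<le> 1" "f \<in> borel_measurable M" "g \<in> borel_measurable M"
  shows "(\<lambda>w. q s (f w) t (g w)) \<in> borel_measurable M"
proof -
  have "(\<lambda>z. q s (fst z) t (snd z)) \<in> borel_measurable borel"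
    by (intro borel_measurable_continuous_onI q_continuous assms continuous_intros)
  from measurable_compose[OF borel_measurable_Pair[OF assms(4,5)] this] show ?thesis
    by simp
qed

text \<open>Continuity of \<open>q\<close> is given only for \<open>s < t \<le> 1\<close>. The
  indicator puts \<open>0\<close> elsewhere and makes the kernel measurable in the arrival time too,
  as Tonelli over the time of death requires.\<close>

lemma q_time_measurable:
  assumes "0 \<le> s" "f \<in> borel_measurable M" "\<tau> \<in> borel_measurable M" "g \<in> borel_measurable M"
  shows "(\<lambda>w. indicator {s<..1} (\<tau> w) * ennreal (q s (f w) (\<tau> w) (g w))) \<in> borel_measurable M"
proof -
  let ?S = "UNIV \<times> {s<..1} \<times> UNIV :: ((real ^ 'n) \<times> real \<times> (real ^ 'n)) set"
  have cont: "continuous_on ?S (\<lambda>z. (s, fst z, fst (snd z), snd (snd z)))"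
    by (intro continuous_intros)
  have img: "(\<lambda>z. (s, fst z, fst (snd z), snd (snd z))) ` ?S \<subseteq> {(s, x, t, y). 0 \<le> s \<and> s < t \<and> t \<le> 1}"
    using assms(1) by auto
  have "continuous_on ?S (\<lambda>z. q s (fst z) (fst (snd z)) (snd (snd z)))"
    using continuous_on_compose2[OF q_cont cont img] by (simp only: case_prod_conv)
  moreover have "?S \<in> sets borel"
    by (intro borel_Times) auto
  ultimately have "(\<lambda>z. indicator ?S z *\<^sub>R q s (fst z) (fst (snd z)) (snd (snd z))) \<in> borel_measurable borel"
    by (rule borel_measurable_continuous_on_indicator[rotated])
  from measurable_compose[OF borel_measurable_Pair[OF assms(2) borel_measurable_Pair[OF assms(3,4)]] this]
  have "(\<lambda>w. ennreal (indicator {s<..1} (\<tau> w) * q s (f w) (\<tau> w) (g w))) \<in> borel_measurable M"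
    by (auto simp: indicator_times)
  also have "(\<lambda>w. ennreal (indicator {s<..1} (\<tau> w) * q s (f w) (\<tau> w) (g w))) =
      (\<lambda>w. indicator {s<..1} (\<tau> w) * ennreal (q s (f w) (\<tau> w) (g w)))"
    by (auto simp: indicator_def)
  finally show ?thesis .
qed

lemma V_measurable:
  assumes "\<tau> \<in> borel_measurable M" "g \<in> borel_measurable M"
  shows "(\<lambda>w. indicator {0..1} (\<tau> w) * ennreal (V (\<tau> w) (g w))) \<in> borel_measurable M"
proof -
  let ?S = "{0..1} \<times> UNIV :: (real \<times> (real ^ 'n)) set"
  have "(\<lambda>z. indicator ?S z *\<^sub>R (case z of (t, x) \<Rightarrow> V t x)) \<in> borel_measurable borel"
    by (intro borel_measurable_continuous_on_indicator V_cont borel_Times) auto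
  from measurable_compose[OF borel_measurable_Pair[OF assms] this]
  have "(\<lambda>w. ennreal (indicator {0..1} (\<tau> w) * V (\<tau> w) (g w))) \<in> borel_measurable M"
    by (auto simp: indicator_times)
  also have "(\<lambda>w. ennreal (indicator {0..1} (\<tau> w) * V (\<tau> w) (g w))) =
      (\<lambda>w. indicator {0..1} (\<tau> w) * ennreal (V (\<tau> w) (g w)))"
    by (auto simp: indicator_def)
  finally show ?thesis .
qed

text \<open>The density of the place and time of death of a particle started at \<open>x\<close> at time \<open>s\<close>,
  extended by \<open>0\<close> to make it jointly measurable.\<close>

definition qV :: "real \<Rightarrow> real ^ 'n \<Rightarrow> real \<Rightarrow> real ^ 'n \<Rightarrow> ennreal"
  where "qV s x r y = indicator {s<..1} r * ennreal (q s x r y) * (indicator {0..1} r * ennreal (V r y))"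

definition kill :: "real \<Rightarrow> real ^ 'n \<Rightarrow> ennreal"
  where "kill s x = (\<integral>\<^sup>+r. (\<integral>\<^sup>+y. qV s x r y \<partial>lborel) \<partial>lborel)"

lemma qV_measurable:
  assumes "0 \<le> s" "f \<in> borel_measurable M" "\<tau> \<in> borel_measurable M" "g \<in> borel_measurable M"
  shows "(\<lambda>w. qV s (f w) (\<tau> w) (g w)) \<in> borel_measurable M"
  unfolding qV_def by (intro borel_measurable_times_ennreal q_time_measurable V_measurable assms)

lemma kill_measurable[measurable]: "0 \<le> s \<Longrightarrow> kill s \<in> borel_measurable borel"
  unfolding kill_def
  by (intro lborel.borel_measurable_nn_integral, subst split_beta', intro lborel.borel_measurable_nn_integral,
      subst split_beta', intro qV_measurable) measurable

lemma kill_eq: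
  assumes "0 \<le> s"
  shows "(\<integral>\<^sup>+r\<in>{s..1}. (\<integral>\<^sup>+y. ennreal (q s x r y) * ennreal (V r y) \<partial>lborel) \<partial>lborel) = kill s x"
  unfolding kill_def
proof (rule nn_integral_cong_AE)
  \<comment> \<open>The two integrands can differ only at \<open>r = s\<close>, where
    \<open>q s x r y\<close> has no meaning.\<close>
  have "AE r in lborel. r \<noteq> s" by (rule AE_lborel_singleton)
  then show "AE r in lborel. (\<integral>\<^sup>+y. ennreal (q s x r y) * ennreal (V r y) \<partial>lborel) * indicator {s..1} r =
      (\<integral>\<^sup>+y. qV s x r y \<partial>lborel)"
    by eventually_elim (use assms in \<open>auto simp: indicator_def qV_def\<close>)
qed

lemma survive_plus_kill: "(\<integral>\<^sup>+y. ennreal (q 0 x 1 y) \<partial>lborel) + kill 0 x = 1"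
  using q_transition unfolding kill_eq[of 0 x, simplified, symmetric] killed_transition_density_def by auto

lemma kill_le_1: "kill 0 x \<le> 1"
  by (subst survive_plus_kill[of x, symmetric]) simp

text \<open>\<open>V\<close> is positive near some point by continuity and \<open>q\<close> is
  positive, so the density \<open>qV\<close> of death is positive on a nonempty open set of times
  and places.\<close>

lemma kill_pos: "0 < kill 0 x"
proof (rule ccontr)
  assume "\<not> 0 < kill 0 x"
  then have "kill 0 x = 0" by simp
  obtain t0 x0 where t0: "t0 \<in> {0..1}" "0 < V t0 x0"
    using V_nonzero V_nonneg by (metis order_le_less)
  have "continuous (at (t0, x0) within {0..1} \<times> UNIV) (\<lambda>(t, x). V t x)"
    using V_cont t0 by (simp add: continuous_on_eq_continuous_within)
  then have "\<forall>\<^sub>F z in at (t0, x0) within {0..1} \<times> UNIV. 0 < (case z of (t, x) \<Rightarrow> V t x)"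
    using t0(2) by (intro order_tendstoD(1)[of _ "V t0 x0"]) (simp_all add: continuous_within)
  then obtain \<delta> where \<delta>: "0 < \<delta>"
    "\<And>t x. t \<in> {0..1} \<Longrightarrow> dist (t, x) (t0, x0) < \<delta> \<Longrightarrow> 0 < V t x"
    unfolding eventually_at using t0(2) by (metis (no_types, lifting) Pair_inject SigmaI UNIV_I case_prod_conv)
  define I where "I = {0<..<1} \<inter> ball t0 (\<delta> / 2)"
  \<comment> \<open>\<open>t0\<close> may be an end point of the time interval; the witness moves it
    inwards, so that \<open>I\<close> is a nonempty open set of interior times.\<close>
  have "(if t0 \<le> 1 / 2 then t0 + min (\<delta> / 4) (1 / 4) else t0 - min (\<delta> / 4) (1 / 4)) \<in> I"
    using t0(1) \<delta>(1) by (auto simp: I_def dist_real_def min_def)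
  then have I: "open I" "I \<noteq> {}" by (auto simp: I_def)
  have "AE r in lborel. (\<integral>\<^sup>+y. qV 0 x r y \<partial>lborel) = 0"
    using \<open>kill 0 x = 0\<close> unfolding kill_def
    by (subst (asm) nn_integral_0_iff_AE)
      (auto intro!: lborel.borel_measurable_nn_integral qV_measurable simp: split_beta')
  from AE_lborel_open_witness[OF this I] obtain r where r: "r \<in> I" "(\<integral>\<^sup>+y. qV 0 x r y \<partial>lborel) = 0" .
  then have "AE y in lborel. qV 0 x r y = 0"
    by (subst (asm) nn_integral_0_iff_AE) (auto intro!: qV_measurable)
  from AE_lborel_open_witness[OF this open_ball, of x0 "\<delta> / 2"] \<delta>(1)
  obtain y where y: "y \<in> ball x0 (\<delta> / 2)" "qV 0 x r y = 0" by auto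
  have "dist (r, y) (t0, x0) \<le> dist r t0 + dist y x0"
    unfolding dist_Pair_Pair by (rule sqrt_sum_squares_le_sum) auto
  also have "\<dots> < \<delta>" using r(1) y(1) by (auto simp: I_def dist_commute)
  finally have "0 < V r y" using \<delta>(2)[of r y] r(1) by (auto simp: I_def)
  then show False
    using y(2) r(1) q_pos[of 0 r x y] by (auto simp: qV_def I_def ennreal_eq_0_iff)
qed

definition killing_prob :: "real ^ 'n \<Rightarrow> real"
  where "killing_prob x = enn2real (kill 0 x)"

lemma ennreal_killing_prob: "ennreal (killing_prob x) = kill 0 x"
  using kill_le_1[of x] by (simp add: killing_prob_def le_less_trans[OF _ ennreal_one_less_top])

lemma killing_prob_pos: "0 < killing_prob x"
  using kill_pos[of x] by (simp flip: ennreal_killing_prob)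

text \<open>By Fatou's lemma the probabilities of being killed and of surviving are both lower
  semicontinuous in the starting point; as they add up to \<open>1\<close>, they are continuous.\<close>

lemma continuous_killing_prob: "continuous_on UNIV killing_prob"
proof (rule continuous_on_sequentiallyI)
  fix z x assume z: "z \<longlonglongrightarrow> (x :: real ^ 'n)"
  define surv where "surv x = (\<integral>\<^sup>+y. ennreal (q 0 x 1 y) \<partial>lborel)" for x
  have surv_real: "enn2real (surv x) = 1 - killing_prob x" for x
  proof -
    have "surv x + ennreal (killing_prob x) = 1"
      using survive_plus_kill by (simp add: surv_def ennreal_killing_prob)
    moreover from this have "surv x \<noteq> \<infinity>"
      using ennreal_add_eq_top by force
    ultimately show ?thesis
      using killing_prob_pos[of x] by (cases "surv x") (auto simp flip: ennreal_plus)
  qed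
  have q_lim: "(\<lambda>j. q 0 (z j) t y) \<longlonglongrightarrow> q 0 x t y" if "0 < t" "t \<le> 1" for t y
    using continuous_on_tendsto_compose[OF q_continuous[of 0 t UNIV "\<lambda>x. x" "\<lambda>_. y"] z] that
    by auto
  have surv_le: "surv x \<le> liminf (\<lambda>j. surv (z j))"
  proof -
    have [measurable]: "(\<lambda>y. q 0 (z j) 1 y) \<in> borel_measurable borel" for j
      by (intro q_measurable) auto
    have "surv x = (\<integral>\<^sup>+y. liminf (\<lambda>j. ennreal (q 0 (z j) 1 y)) \<partial>lborel)"
      unfolding surv_def
      by (intro nn_integral_cong lim_imp_Liminf[symmetric] tendsto_ennrealI q_lim) auto
    also have "\<dots> \<le> liminf (\<lambda>j. surv (z j))"
      unfolding surv_def by (intro nn_integral_liminf) measurable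
    finally show ?thesis .
  qed
  have kill_le: "kill 0 x \<le> liminf (\<lambda>j. kill 0 (z j))"
  proof -
    have lim: "(\<lambda>j. qV 0 (z j) r y) \<longlonglongrightarrow> qV 0 x r y" for r y
    proof (cases "r \<in> {0<..1}")
      case True
      have "(\<lambda>j. ennreal (q 0 (z j) r y * V r y)) \<longlonglongrightarrow> ennreal (q 0 x r y * V r y)"
        using True by (intro tendsto_ennrealI tendsto_mult tendsto_const q_lim) auto
      with True V_nonneg[of r y] show ?thesis by (simp add: qV_def ennreal_mult'')
    qed (simp add: qV_def)
    have "kill 0 x = (\<integral>\<^sup>+r. \<integral>\<^sup>+y. liminf (\<lambda>j. qV 0 (z j) r y) \<partial>lborel \<partial>lborel)"
      unfolding kill_def by (intro nn_integral_cong lim_imp_Liminf[symmetric] lim) auto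
    also have "\<dots> \<le> (\<integral>\<^sup>+r. liminf (\<lambda>j. \<integral>\<^sup>+y. qV 0 (z j) r y \<partial>lborel) \<partial>lborel)"
      by (intro nn_integral_mono nn_integral_liminf qV_measurable) auto
    also have "\<dots> \<le> liminf (\<lambda>j. kill 0 (z j))"
      unfolding kill_def
      by (intro nn_integral_liminf lborel.borel_measurable_nn_integral, subst split_beta', intro qV_measurable)
        auto
    finally show ?thesis .
  qed
  \<comment> \<open>Passage to real numbers. Negative \<open>c\<close> is treated apart because
    \<open>ennreal c = 0\<close> would then demand strictly positive values.\<close>
  have lsc: "\<forall>\<^sub>F j in sequentially. c < enn2real (u (z j))"
    if "u x \<le> liminf (\<lambda>j. u (z j))" "\<And>x. u x \<le> 1" "c < enn2real (u x)" for u :: "real ^ 'n \<Rightarrow> ennreal" and c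
  proof (cases "c < 0")
    case True
    then show ?thesis
      by (intro always_eventually allI less_le_trans[OF _ enn2real_nonneg])
  next
    case False
    have fin: "ennreal (enn2real (u y)) = u y" for y
      using that(2)[of y] by (simp add: le_less_trans[OF _ ennreal_one_less_top])
    have "ennreal c < ennreal (enn2real (u x))"
      using that(3) False by (simp add: ennreal_less_iff)
    then have "ennreal c < liminf (\<lambda>j. u (z j))"
      using that(1) fin by simp
    then have "\<forall>\<^sub>F j in sequentially. ennreal c < u (z j)"
      by (rule less_LiminfD)
    then show ?thesis
      by eventually_elim (metis False fin ennreal_less_iff not_less)
  qed
  have surv_le_1: "surv x \<le> 1" for x
    unfolding surv_def by (subst survive_plus_kill[of x, symmetric]) simp
  show "(\<lambda>j. killing_prob (z j)) \<longlonglongrightarrow> killing_prob x"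
  proof (rule order_tendstoI)
    show "\<forall>\<^sub>F j in sequentially. c < killing_prob (z j)" if "c < killing_prob x" for c
      using lsc[of "kill 0", OF kill_le kill_le_1] that by (simp add: killing_prob_def)
    show "\<forall>\<^sub>F j in sequentially. killing_prob (z j) < c" if "killing_prob x < c" for c
      using lsc[of surv "1 - c", OF surv_le surv_le_1] that by (simp add: surv_real)
  qed
qed

section \<open>Backward and forward evolution, and the killed mass\<close>

definition backward :: "(real ^ 'n \<Rightarrow> ennreal) \<Rightarrow> ennreal \<Rightarrow> real \<Rightarrow> real ^ 'n \<Rightarrow> ennreal"
  where "backward g c s x = (\<integral>\<^sup>+y. ennreal (q s x 1 y) * g y \<partial>lborel) + c * kill s x"

definition forward :: "(real ^ 'n \<Rightarrow> ennreal) \<Rightarrow> real \<Rightarrow> real ^ 'n \<Rightarrow> ennreal"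
  where "forward f t x = (\<integral>\<^sup>+x0. ennreal (q 0 x0 t x) * f x0 \<partial>lborel)"

lemma backward_measurable[measurable]:
  assumes "0 \<le> s" "s < 1" and [measurable]: "g \<in> borel_measurable borel"
  shows "backward g c s \<in> borel_measurable borel"
proof -
  have [measurable]: "(\<lambda>w. q s (fst w) 1 (snd w)) \<in> borel_measurable (borel \<Otimes>\<^sub>M lborel)"
    using assms by (intro q_measurable) auto
  show ?thesis
    unfolding backward_def using assms
    by (intro borel_measurable_add borel_measurable_times_ennreal lborel.borel_measurable_nn_integral kill_measurable)
      (auto simp: split_beta')
qed

lemma forward_measurable[measurable]:
  assumes "0 < t" "t \<le> 1" and [measurable]: "f \<in> borel_measurable borel"
  shows "forward f t \<in> borel_measurable borel"
proof -
  have [measurable]: "(\<lambda>w. q 0 (snd w) t (fst w)) \<in> borel_measurable (borel \<Otimes>\<^sub>M lborel)"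
    using assms by (intro q_measurable) auto
  show ?thesis
    unfolding forward_def
    by (intro lborel.borel_measurable_nn_integral) (auto simp: split_beta')
qed

text \<open>Surviving to time \<open>t\<close> and dying later is one way of dying. By
  Chapman-Kolmogorov the death densities agree at times after \<open>t\<close>; deaths up to
  \<open>t\<close> are dropped, whence an inequality.\<close>

lemma nn_integral_q_kill_le:
  assumes "0 < t" "t < 1"
  shows "(\<integral>\<^sup>+x. ennreal (q 0 x0 t x) * kill t x \<partial>lborel) \<le> kill 0 x0"
proof -
  have [measurable]: "(\<lambda>x. q 0 x0 t x) \<in> borel_measurable borel"
    using assms by (intro q_measurable) auto
  have [measurable]: "(\<lambda>w. qV t (f w) (g w) (h w)) \<in> borel_measurable M"
    if "f \<in> borel_measurable M" "g \<in> borel_measurable M" "h \<in> borel_measurable M" for f g h M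
    using assms that by (intro qV_measurable) auto
  have "(\<integral>\<^sup>+x. ennreal (q 0 x0 t x) * kill t x \<partial>lborel) =
      (\<integral>\<^sup>+x. \<integral>\<^sup>+r. \<integral>\<^sup>+y. ennreal (q 0 x0 t x) * qV t x r y \<partial>lborel \<partial>lborel \<partial>lborel)"
    unfolding kill_def by (simp add: nn_integral_cmult)
  also have "\<dots> = (\<integral>\<^sup>+r. \<integral>\<^sup>+x. \<integral>\<^sup>+y. ennreal (q 0 x0 t x) * qV t x r y \<partial>lborel \<partial>lborel \<partial>lborel)"
    by (rule lborel_pair.Fubini') measurable
  also have "\<dots> = (\<integral>\<^sup>+r. \<integral>\<^sup>+y. \<integral>\<^sup>+x. ennreal (q 0 x0 t x) * qV t x r y \<partial>lborel \<partial>lborel \<partial>lborel)"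
    by (rule nn_integral_cong, rule lborel_pair.Fubini') measurable
  also have "\<dots> \<le> (\<integral>\<^sup>+r. \<integral>\<^sup>+y. qV 0 x0 r y \<partial>lborel \<partial>lborel)"
  proof (rule nn_integral_mono)
    fix r :: real
    show "(\<integral>\<^sup>+y. \<integral>\<^sup>+x. ennreal (q 0 x0 t x) * qV t x r y \<partial>lborel \<partial>lborel) \<le> (\<integral>\<^sup>+y. qV 0 x0 r y \<partial>lborel)"
    proof (cases "r \<in> {t<..1}")
      case True
      have [measurable]: "(\<lambda>x. q t x r y) \<in> borel_measurable borel" for y
        using assms True by (intro q_measurable) auto
      have "AE y in lborel. (\<integral>\<^sup>+x. ennreal (q 0 x0 t x) * ennreal (q t x r y) \<partial>lborel) = ennreal (q 0 x0 r y)"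
        using q_transition assms True by (auto simp: killed_transition_density_def)
      then have "AE y in lborel. (\<integral>\<^sup>+x. ennreal (q 0 x0 t x) * qV t x r y \<partial>lborel) = qV 0 x0 r y"
      proof eventually_elim
        fix y
        assume eq: "(\<integral>\<^sup>+x. ennreal (q 0 x0 t x) * ennreal (q t x r y) \<partial>lborel) = ennreal (q 0 x0 r y)"
        have "(\<integral>\<^sup>+x. ennreal (q 0 x0 t x) * qV t x r y \<partial>lborel) =
            (\<integral>\<^sup>+x. ennreal (q 0 x0 t x) * ennreal (q t x r y) * ennreal (V r y) \<partial>lborel)"
          using True assms by (simp add: qV_def mult.assoc)
        also have "\<dots> = qV 0 x0 r y"
          using True assms eq by (simp add: nn_integral_multc qV_def)
        finally show "(\<integral>\<^sup>+x. ennreal (q 0 x0 t x) * qV t x r y \<partial>lborel) = qV 0 x0 r y" .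
      qed
      then show ?thesis by (intro eq_refl nn_integral_cong_AE)
    qed (simp add: qV_def)
  qed
  finally show ?thesis by (simp add: kill_def)
qed

text \<open>Chapman-Kolmogorov preserves the surviving part, and the killing part can only decrease:
  \<open>backward g c\<close> behaves like a supermartingale along the killed process.\<close>

lemma nn_integral_q_backward_le:
  assumes t: "0 < t" "t < 1" and [measurable]: "g \<in> borel_measurable borel"
  shows "(\<integral>\<^sup>+x. ennreal (q 0 x0 t x) * backward g c t x \<partial>lborel) \<le> backward g c 0 x0"
proof -
  have [measurable]: "(\<lambda>w. q 0 x0 t (f w)) \<in> borel_measurable M" 
    if "f \<in> borel_measurable M" for f M
    using t that by (intro q_measurable) auto
  have [measurable]: "(\<lambda>w. q t (f w) 1 (h w)) \<in> borel_measurable M"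
    if "f \<in> borel_measurable M" "h \<in> borel_measurable M" for f h M
    using t that by (intro q_measurable) auto
  have [measurable]: "kill t \<in> borel_measurable borel" using t by simp
  have "(\<integral>\<^sup>+x. ennreal (q 0 x0 t x) * backward g c t x \<partial>lborel) =
      (\<integral>\<^sup>+x. \<integral>\<^sup>+y. ennreal (q 0 x0 t x) * ennreal (q t x 1 y) * g y \<partial>lborel \<partial>lborel) +
      c * (\<integral>\<^sup>+x. ennreal (q 0 x0 t x) * kill t x \<partial>lborel)"
    unfolding backward_def
    by (simp add: distrib_left nn_integral_add mult.assoc nn_integral_cmult mult.left_commute[of _ c])
  also have "(\<integral>\<^sup>+x. \<integral>\<^sup>+y. ennreal (q 0 x0 t x) * ennreal (q t x 1 y) * g y \<partial>lborel \<partial>lborel) =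
      (\<integral>\<^sup>+y. \<integral>\<^sup>+x. ennreal (q 0 x0 t x) * ennreal (q t x 1 y) * g y \<partial>lborel \<partial>lborel)"
    by (rule lborel_pair.Fubini') measurable
  also have "\<dots> = (\<integral>\<^sup>+y. (\<integral>\<^sup>+x. ennreal (q 0 x0 t x) * ennreal (q t x 1 y) \<partial>lborel) * g y \<partial>lborel)"
    by (simp add: nn_integral_multc)
  also have "\<dots> = (\<integral>\<^sup>+y. ennreal (q 0 x0 1 y) * g y \<partial>lborel)"
  proof (rule nn_integral_cong_AE)
    have "AE y in lborel. (\<integral>\<^sup>+x. ennreal (q 0 x0 t x) * ennreal (q t x 1 y) \<partial>lborel) = ennreal (q 0 x0 1 y)"
      using q_transition t by (auto simp: killed_transition_density_def)
    then show "AE y in lborel. (\<integral>\<^sup>+x. ennreal (q 0 x0 t x) * ennreal (q t x 1 y) \<partial>lborel) * g y =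
        ennreal (q 0 x0 1 y) * g y"
      by eventually_elim simp
  qed
  finally show ?thesis
    unfolding backward_def using nn_integral_q_kill_le[OF t, of x0]
    by (auto intro!: add_left_mono mult_left_mono)
qed

text \<open>For a solution the right-hand side is the mass of \<open>\<rho>0\<close>. This yields
  the finiteness of the product density at interior times.\<close>

lemma nn_integral_forward_backward_le:
  assumes t: "0 < t" "t < 1" and [measurable]: "f \<in> borel_measurable borel" "g \<in> borel_measurable borel"
  shows "(\<integral>\<^sup>+x. forward f t x * backward g c t x \<partial>lborel) \<le> (\<integral>\<^sup>+x. f x * backward g c 0 x \<partial>lborel)"
proof -
  have [measurable]: "(\<lambda>w. q 0 (f w) t (h w)) \<in> borel_measurable M"
    if "f \<in> borel_measurable M" "h \<in> borel_measurable M" for f h M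
    using t that by (intro q_measurable) auto
  have [measurable]: "backward g c t \<in> borel_measurable borel" using t by simp
  have "(\<integral>\<^sup>+x. forward f t x * backward g c t x \<partial>lborel) =
      (\<integral>\<^sup>+x. \<integral>\<^sup>+x0. f x0 * (ennreal (q 0 x0 t x) * backward g c t x) \<partial>lborel \<partial>lborel)"
    unfolding forward_def by (subst nn_integral_multc[symmetric]) (auto simp: mult_ac)
  also have "\<dots> = (\<integral>\<^sup>+x0. \<integral>\<^sup>+x. f x0 * (ennreal (q 0 x0 t x) * backward g c t x) \<partial>lborel \<partial>lborel)"
    by (rule lborel_pair.Fubini') measurable
  also have "\<dots> = (\<integral>\<^sup>+x0. f x0 * (\<integral>\<^sup>+x. ennreal (q 0 x0 t x) * backward g c t x \<partial>lborel) \<partial>lborel)"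
    by (simp add: nn_integral_cmult)
  also have "\<dots> \<le> (\<integral>\<^sup>+x. f x * backward g c 0 x \<partial>lborel)"
    by (intro nn_integral_mono mult_left_mono nn_integral_q_backward_le t) auto
  finally show ?thesis .
qed

text \<open>At \<open>s = 0\<close> the function \<open>h\<close> is an initial datum, unrelated to
  \<open>forward f 0\<close>, but a single time is negligible. The integrand on the right is jointly
  measurable, which prepares for Tonelli.\<close>

lemma killed_mass_upto:
  assumes [measurable]: "f \<in> borel_measurable borel" and t: "t \<le> 1"
    and h: "\<And>s x. s \<in> {0<..1} \<Longrightarrow> h s x = forward f s x"
  shows "(\<integral>\<^sup>+s\<in>{0..t}. (\<integral>\<^sup>+x. ennreal (V s x) * h s x \<partial>lborel) \<partial>lborel) =
    (\<integral>\<^sup>+s\<in>{0..t}. (\<integral>\<^sup>+x. \<integral>\<^sup>+x0. qV 0 x0 s x * f x0 \<partial>lborel \<partial>lborel) \<partial>lborel)"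
proof (rule nn_integral_cong_AE)
  have "AE s in lborel. s \<noteq> (0::real)" by (rule AE_lborel_singleton)
  then show "AE s in lborel. (\<integral>\<^sup>+x. ennreal (V s x) * h s x \<partial>lborel) * indicator {0..t} s =
      (\<integral>\<^sup>+x. \<integral>\<^sup>+x0. qV 0 x0 s x * f x0 \<partial>lborel \<partial>lborel) * indicator {0..t} s"
  proof eventually_elim
    fix s :: real assume "s \<noteq> 0"
    show "(\<integral>\<^sup>+x. ennreal (V s x) * h s x \<partial>lborel) * indicator {0..t} s =
      (\<integral>\<^sup>+x. \<integral>\<^sup>+x0. qV 0 x0 s x * f x0 \<partial>lborel \<partial>lborel) * indicator {0..t} s"
    proof (cases "s \<in> {0..t}")
      case True
      with \<open>s \<noteq> 0\<close> t have s: "s \<in> {0<..1}" by auto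
      have [measurable]: "(\<lambda>x0. q 0 x0 s x) \<in> borel_measurable borel" for x
        using s by (intro q_measurable) auto
      have "ennreal (V s x) * h s x = (\<integral>\<^sup>+x0. qV 0 x0 s x * f x0 \<partial>lborel)" for x
        unfolding h[OF s] forward_def using s
        by (subst nn_integral_cmult[symmetric]) (auto simp: qV_def mult_ac)
      then show ?thesis by simp
    qed simp
  qed
qed

text \<open>Integrating over the starting point last collects the death probability of each
  \<open>x0\<close>; the condition on \<open>\<psi>h 1\<close> becomes one on
  \<open>\<phi>h 0\<close>.\<close>

lemma killed_mass_eq:
  assumes [measurable]: "f \<in> borel_measurable borel"
    and h: "\<And>s x. s \<in> {0<..1} \<Longrightarrow> h s x = forward f s x"
  shows "(\<integral>\<^sup>+s\<in>{0..1}. (\<integral>\<^sup>+x. ennreal (V s x) * h s x \<partial>lborel) \<partial>lborel) = (\<integral>\<^sup>+x0. kill 0 x0 * f x0 \<partial>lborel)"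
proof -
  have [measurable]: "(\<lambda>w. qV 0 (f w) (g w) (h w)) \<in> borel_measurable M"
    if "f \<in> borel_measurable M" "g \<in> borel_measurable M" "h \<in> borel_measurable M" for f g h M
    using that by (intro qV_measurable) auto
  have "(\<integral>\<^sup>+s\<in>{0..1}. (\<integral>\<^sup>+x. ennreal (V s x) * h s x \<partial>lborel) \<partial>lborel) =
      (\<integral>\<^sup>+s\<in>{0..1}. (\<integral>\<^sup>+x. \<integral>\<^sup>+x0. qV 0 x0 s x * f x0 \<partial>lborel \<partial>lborel) \<partial>lborel)"
    by (rule killed_mass_upto[OF assms(1) order_refl h])
  also have "\<dots> = (\<integral>\<^sup>+s. \<integral>\<^sup>+x. \<integral>\<^sup>+x0. qV 0 x0 s x * f x0 \<partial>lborel \<partial>lborel \<partial>lborel)"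
    by (intro nn_integral_cong) (auto simp: indicator_def qV_def)
  also have "\<dots> = (\<integral>\<^sup>+s. \<integral>\<^sup>+x0. \<integral>\<^sup>+x. qV 0 x0 s x * f x0 \<partial>lborel \<partial>lborel \<partial>lborel)"
    by (rule nn_integral_cong, rule lborel_pair.Fubini') measurable
  also have "\<dots> = (\<integral>\<^sup>+x0. \<integral>\<^sup>+s. \<integral>\<^sup>+x. qV 0 x0 s x * f x0 \<partial>lborel \<partial>lborel \<partial>lborel)"
    by (rule lborel_pair.Fubini') measurable
  also have "\<dots> = (\<integral>\<^sup>+x0. kill 0 x0 * f x0 \<partial>lborel)"
    by (simp add: kill_def nn_integral_multc)
  finally show ?thesis .
qed

lemma killed_mass_upto_scale:
  assumes [measurable]: "f \<in> borel_measurable borel" "f' \<in> borel_measurable borel" and t: "t \<le> 1"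
    and h: "\<And>s x. s \<in> {0<..1} \<Longrightarrow> h s x = forward f s x"
    and h': "\<And>s x. s \<in> {0<..1} \<Longrightarrow> h' s x = forward f' s x"
    and f': "AE x in lborel. f' x = k * f x"
  shows "(\<integral>\<^sup>+s\<in>{0..t}. (\<integral>\<^sup>+x. ennreal (V s x) * h' s x \<partial>lborel) \<partial>lborel) =
    k * (\<integral>\<^sup>+s\<in>{0..t}. (\<integral>\<^sup>+x. ennreal (V s x) * h s x \<partial>lborel) \<partial>lborel)"
proof -
  have [measurable]: "(\<lambda>w. qV 0 (f w) (g w) (h w)) \<in> borel_measurable M"
    if "f \<in> borel_measurable M" "g \<in> borel_measurable M" "h \<in> borel_measurable M" for f g h M
    using that by (intro qV_measurable) auto
  have "(\<integral>\<^sup>+x0. qV 0 x0 s x * f' x0 \<partial>lborel) = k * (\<integral>\<^sup>+x0. qV 0 x0 s x * f x0 \<partial>lborel)" for s x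
  proof -
    have "(\<integral>\<^sup>+x0. qV 0 x0 s x * f' x0 \<partial>lborel) = (\<integral>\<^sup>+x0. k * (qV 0 x0 s x * f x0) \<partial>lborel)"
      by (intro nn_integral_cong_AE) (use f' in eventually_elim, simp add: mult.left_commute)
    then show ?thesis by (simp add: nn_integral_cmult)
  qed
  then have "(\<integral>\<^sup>+s\<in>{0..t}. (\<integral>\<^sup>+x. \<integral>\<^sup>+x0. qV 0 x0 s x * f' x0 \<partial>lborel \<partial>lborel) \<partial>lborel) =
      (\<integral>\<^sup>+s. k * ((\<integral>\<^sup>+x. \<integral>\<^sup>+x0. qV 0 x0 s x * f x0 \<partial>lborel \<partial>lborel) * indicator {0..t} s) \<partial>lborel)"
    by (simp add: nn_integral_cmult mult.assoc)
  also have "\<dots> = k * (\<integral>\<^sup>+s\<in>{0..t}. (\<integral>\<^sup>+x. \<integral>\<^sup>+x0. qV 0 x0 s x * f x0 \<partial>lborel \<partial>lborel) \<partial>lborel)"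
    by (rule nn_integral_cmult) measurable
  finally show ?thesis
    using killed_mass_upto[of f t h] killed_mass_upto[of f' t h'] assms by simp
qed

end

section \<open>Reduction to an initial function, a terminal function and a constant\<close>

locale schroedinger_data = killed_kernel V q
  for V :: "real \<Rightarrow> real ^ 'n::finite \<Rightarrow> real" and q +
  fixes \<rho>0 \<rho>1 :: "real ^ 'n \<Rightarrow> real"
  assumes rho0: "integrable lborel \<rho>0" "\<And>x. 0 \<le> \<rho>0 x" "(\<integral>x. \<rho>0 x \<partial>lborel) = 1"
    and rho1: "integrable lborel \<rho>1" "\<And>x. 0 \<le> \<rho>1 x" "(\<integral>x. \<rho>1 x \<partial>lborel) \<le> 1"
begin

lemma rho_measurable[measurable]: "\<rho>0 \<in> borel_measurable borel" "\<rho>1 \<in> borel_measurable borel"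
  using rho0(1) rho1(1) by (auto dest: borel_measurable_integrable)

lemma nn_integral_rho0: "(\<integral>\<^sup>+x. ennreal (\<rho>0 x) \<partial>lborel) = 1"
  using nn_integral_eq_integral[OF rho0(1)] rho0(2,3) by simp

lemma rho0_AE_witness:
  assumes "AE x in lborel. P x"
  obtains x where "0 < \<rho>0 x" "P x"
proof (rule ccontr)
  assume "\<not> thesis"
  with that have *: "\<not> 0 < \<rho>0 x" if "P x" for x using that by blast
  from assms have "AE x in lborel. ennreal (\<rho>0 x) = 0"
    by eventually_elim (use * rho0(2) in \<open>auto simp: not_less intro: antisym\<close>)
  then have "(\<integral>\<^sup>+x. ennreal (\<rho>0 x) \<partial>lborel) = 0"
    by (subst nn_integral_0_iff_AE) auto
  with nn_integral_rho0 show False by simp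
qed

definition killed_mass :: real
  where "killed_mass = 1 - (\<integral>x. \<rho>1 x \<partial>lborel)"

lemma killed_mass_nonneg: "0 \<le> killed_mass"
  using rho1(3) by (simp add: killed_mass_def)

text \<open>The reduced unknowns are \<open>f = \<phi>h 0\<close>, \<open>g = \<phi> 1\<close> and \<open>c = \<psi>\<close>.\<close>

definition reduced_system :: "(real ^ 'n \<Rightarrow> ennreal) \<Rightarrow> (real ^ 'n \<Rightarrow> ennreal) \<Rightarrow> ennreal \<Rightarrow> bool"
  where "reduced_system f g c \<longleftrightarrow>
    f \<in> borel_measurable borel \<and> g \<in> borel_measurable borel \<and> c < \<infinity> \<and>
    (AE x in lborel. ennreal (\<rho>0 x) = backward g c 0 x * f x) \<and>
    (AE x in lborel. ennreal (\<rho>1 x) = g x * forward f 1 x) \<and>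
    c * (\<integral>\<^sup>+x. kill 0 x * f x \<partial>lborel) = ennreal killed_mass"

lemma schroedinger_systemD:
  assumes "schroedinger_system V q \<rho>0 \<rho>1 \<phi>h \<psi>h \<phi> \<psi>"
  shows "\<And>t x. t \<in> {0<..1} \<Longrightarrow> \<phi>h t x = forward (\<phi>h 0) t x"
    and "\<And>t x. t \<in> {0..<1} \<Longrightarrow> \<phi> t x = backward (\<phi> 1) (\<psi> 0) t x"
    and "\<And>t. t \<in> {0..1} \<Longrightarrow> \<psi> t = \<psi> 0"
    and "\<And>t. t \<in> {0..1} \<Longrightarrow> \<psi>h t = (\<integral>\<^sup>+s\<in>{0..t}. (\<integral>\<^sup>+x. ennreal (V s x) * \<phi>h s x \<partial>lborel) \<partial>lborel)"
    and "reduced_system (\<phi>h 0) (\<phi> 1) (\<psi> 0)"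
proof -
  note S = assms[unfolded schroedinger_system_def]
  note S2 = S[THEN conjunct2, THEN conjunct2] and S5 = S[THEN conjunct2, THEN conjunct2, THEN conjunct2, THEN conjunct2]
  have S_meas: "\<phi>h 0 \<in> borel_measurable borel" "\<phi> 1 \<in> borel_measurable borel"
    using S[THEN conjunct1] by simp_all
  have S_fin: "\<psi> 0 < \<infinity>"
    using S[THEN conjunct2, THEN conjunct1] by simp
  show forward: "\<phi>h t x = forward (\<phi>h 0) t x" if "t \<in> {0<..1}" for t x
    using S2[THEN conjunct1] that unfolding forward_def by blast
  show \<psi>h: "\<psi>h t = (\<integral>\<^sup>+s\<in>{0..t}. (\<integral>\<^sup>+x. ennreal (V s x) * \<phi>h s x \<partial>lborel) \<partial>lborel)" if "t \<in> {0..1}" for t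
    using S2[THEN conjunct2, THEN conjunct1] that by blast
  show const: "\<psi> t = \<psi> 0" if "t \<in> {0..1}" for t
    using S5[THEN conjunct2, THEN conjunct1] that by (rule bspec)
  show backward: "\<phi> t x = backward (\<phi> 1) (\<psi> 0) t x" if "t \<in> {0..<1}" for t x
  proof -
    have "\<phi> t x = (\<integral>\<^sup>+y. ennreal (q t x 1 y) * \<phi> 1 y \<partial>lborel) +
        \<psi> t * (\<integral>\<^sup>+s\<in>{t..1}. (\<integral>\<^sup>+y. ennreal (q t x s y) * ennreal (V s y) \<partial>lborel) \<partial>lborel)"
      using S5[THEN conjunct1] that by blast
    with that const[of t] show ?thesis by (simp add: kill_eq backward_def)
  qed
  have "\<psi>h 1 = (\<integral>\<^sup>+x. kill 0 x * \<phi>h 0 x \<partial>lborel)"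
    using killed_mass_eq[OF S_meas(1) forward] \<psi>h[of 1] by simp
  then have "\<psi> 0 * (\<integral>\<^sup>+x. kill 0 x * \<phi>h 0 x \<partial>lborel) = ennreal killed_mass"
    using S5[THEN conjunct2, THEN conjunct2, THEN conjunct2, THEN conjunct2, THEN conjunct2] const[of 1]
    by (simp add: killed_mass_def)
  moreover have "AE x in lborel. ennreal (\<rho>0 x) = backward (\<phi> 1) (\<psi> 0) 0 x * \<phi>h 0 x"
    using S5[THEN conjunct2, THEN conjunct2, THEN conjunct1] backward[of 0] by simp
  moreover have "AE x in lborel. ennreal (\<rho>1 x) = \<phi> 1 x * forward (\<phi>h 0) 1 x"
    using S5[THEN conjunct2, THEN conjunct2, THEN conjunct2, THEN conjunct1] forward[of 1] by simp
  ultimately show "reduced_system (\<phi>h 0) (\<phi> 1) (\<psi> 0)"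
    using S_meas S_fin by (simp add: reduced_system_def)
qed

lemma schroedinger_system_of_reduced:
  assumes "reduced_system f g c"
  defines "\<phi>h \<equiv> \<lambda>t. if t = 0 then f else forward f t"
    and "\<phi> \<equiv> \<lambda>t. if t = 1 then g else backward g c t"
  defines "\<psi>h \<equiv> \<lambda>t. \<integral>\<^sup>+s\<in>{0..t}. (\<integral>\<^sup>+x. ennreal (V s x) * \<phi>h s x \<partial>lborel) \<partial>lborel"
  shows "schroedinger_system V q \<rho>0 \<rho>1 \<phi>h \<psi>h \<phi> (\<lambda>_. c)"
proof -
  have [measurable]: "f \<in> borel_measurable borel" "g \<in> borel_measurable borel" and c: "c < \<infinity>"
    and f0: "AE x in lborel. ennreal (\<rho>0 x) = backward g c 0 x * f x"
    and g1: "AE x in lborel. ennreal (\<rho>1 x) = g x * forward f 1 x"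
    and mass: "c * (\<integral>\<^sup>+x. kill 0 x * f x \<partial>lborel) = ennreal killed_mass"
    using assms(1) by (auto simp: reduced_system_def)
  have \<psi>h_0: "\<psi>h 0 = 0"
  proof -
    have "AE s in lborel. s \<noteq> (0::real)" by (rule AE_lborel_singleton)
    then have "\<psi>h 0 = (\<integral>\<^sup>+s. 0 \<partial>(lborel :: real measure))"
      unfolding \<psi>h_def by (intro nn_integral_cong_AE) (auto elim!: eventually_mono)
    then show ?thesis by simp
  qed
  have \<psi>h_1: "\<psi>h 1 = (\<integral>\<^sup>+x. kill 0 x * f x \<partial>lborel)"
    unfolding \<psi>h_def by (rule killed_mass_eq) (auto simp: \<phi>h_def)
  \<comment> \<open>At the end points the product is \<open>\<rho>0\<close> or
    \<open>\<rho>1\<close>. In between its integral is at most that of \<open>\<rho>0\<close>, so it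
    is finite almost everywhere although a single factor may be infinite.\<close>
  have fin: "AE x in lborel. \<phi>h t x * \<phi> t x < \<infinity>" if t: "t \<in> {0..1}" for t
  proof -
    consider "t = 0" | "t = 1" | "0 < t" "t < 1" using t by fastforce
    then show ?thesis
    proof cases
      case 1
      from f0 show ?thesis
        by eventually_elim (simp add: 1 \<phi>h_def \<phi>_def mult.commute, metis ennreal_less_top)
    next
      case 2
      from g1 show ?thesis
        by eventually_elim (simp add: 2 \<phi>h_def \<phi>_def mult.commute, metis ennreal_less_top)
    next
      case 3
      have [measurable]: "forward f t \<in> borel_measurable borel" "backward g c t \<in> borel_measurable borel"
        using 3 by simp_all
      have "(\<integral>\<^sup>+x. forward f t x * backward g c t x \<partial>lborel) \<le> (\<integral>\<^sup>+x. f x * backward g c 0 x \<partial>lborel)"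
        using 3 by (rule nn_integral_forward_backward_le) measurable
      also have "\<dots> = (\<integral>\<^sup>+x. ennreal (\<rho>0 x) \<partial>lborel)"
        by (rule nn_integral_cong_AE) (use f0 in eventually_elim, simp add: mult.commute)
      finally have "(\<integral>\<^sup>+x. forward f t x * backward g c t x \<partial>lborel) \<noteq> \<infinity>"
        using nn_integral_rho0 by (auto simp: top_unique)
      then have "AE x in lborel. forward f t x * backward g c t x \<noteq> \<infinity>"
        by (intro nn_integral_PInf_AE) measurable
      then show ?thesis
        by eventually_elim (use 3 in \<open>simp add: \<phi>h_def \<phi>_def less_top\<close>)
    qed
  qed
  have meas: "\<phi>h t \<in> borel_measurable borel" "\<phi> t \<in> borel_measurable borel" if "t \<in> {0..1}" for t
    using that by (auto simp: \<phi>h_def \<phi>_def)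
  show ?thesis
    unfolding schroedinger_system_def
  proof (intro conjI ballI allI)
    show "\<phi>h t x = (\<integral>\<^sup>+x0. ennreal (q 0 x0 t x) * \<phi>h 0 x0 \<partial>lborel)" if "t \<in> {0<..1}" for t x
      using that by (simp add: \<phi>h_def forward_def)
    show "\<phi> t x = (\<integral>\<^sup>+y. ennreal (q t x 1 y) * \<phi> 1 y \<partial>lborel) +
        c * (\<integral>\<^sup>+s\<in>{t..1}. (\<integral>\<^sup>+y. ennreal (q t x s y) * ennreal (V s y) \<partial>lborel) \<partial>lborel)"
      if "t \<in> {0..<1}" for t x
      using that by (simp add: \<phi>_def backward_def kill_eq)
    show "c * \<psi>h 1 = ennreal (1 - (\<integral>x. \<rho>1 x \<partial>lborel))"
      using mass by (simp add: \<psi>h_1 killed_mass_def)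
    show "AE x in lborel. ennreal (\<rho>0 x) = \<phi> 0 x * \<phi>h 0 x"
      using f0 by (simp add: \<phi>h_def \<phi>_def)
    show "AE x in lborel. ennreal (\<rho>1 x) = \<phi> 1 x * \<phi>h 1 x"
      using g1 by (simp add: \<phi>h_def \<phi>_def)
  qed (use fin meas c \<psi>h_0 in \<open>auto simp: \<psi>h_def\<close>)
qed

text \<open>The cemetery is spread out over a second copy of the space, with density \<open>\<rho>0\<close>, so that the
  particles arrive in \<open>real ^ 'n \<times> bool\<close>, where \<open>True\<close> means alive. The conditional arrival density
  of the killed particles does not depend on the point of this copy.\<close>

definition start_measure :: "(real ^ 'n) measure"
  where "start_measure = density lborel (\<lambda>x. ennreal (\<rho>0 x))"

definition end_measure :: "((real ^ 'n) \<times> bool) measure"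
  where "end_measure = density (lborel \<Otimes>\<^sub>M count_space UNIV)
    (\<lambda>z. ennreal (if snd z then \<rho>1 (fst z) else killed_mass * \<rho>0 (fst z)))"

definition kernel :: "real ^ 'n \<Rightarrow> (real ^ 'n) \<times> bool \<Rightarrow> real"
  where "kernel x z = (if snd z then q 0 x 1 (fst z) else killing_prob x)"

sublocale lborel_bool: pair_sigma_finite "lborel :: (real ^ 'n) measure" "count_space (UNIV :: bool set)"
  by (intro pair_sigma_finite.intro lborel.sigma_finite_measure_axioms
      sigma_finite_measure_count_space_finite) simp

lemma sets_start_measure[simp, measurable_cong]: "sets start_measure = sets borel"
  by (simp add: start_measure_def)

lemma sets_end_measure[measurable_cong]: "sets end_measure = sets (lborel \<Otimes>\<^sub>M count_space UNIV)"
  by (simp add: end_measure_def)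

lemma space_start_measure[simp]: "space start_measure = UNIV"
  by (simp add: start_measure_def)

lemma space_end_measure[simp]: "space end_measure = UNIV"
  by (simp add: end_measure_def space_pair_measure)

lemma prob_space_start_measure: "prob_space start_measure"
  by (rule prob_spaceI) (simp add: start_measure_def emeasure_density nn_integral_rho0)

lemma nn_integral_end_measure:
  assumes [measurable]: "h \<in> borel_measurable (lborel \<Otimes>\<^sub>M count_space UNIV)"
  shows "(\<integral>\<^sup>+z. h z \<partial>end_measure) = (\<integral>\<^sup>+y. ennreal (\<rho>1 y) * h (y, True) \<partial>lborel) +
    (\<integral>\<^sup>+y. ennreal (killed_mass * \<rho>0 y) * h (y, False) \<partial>lborel)"
proof -
  have meas: "(\<lambda>z. ennreal (if snd z then \<rho>1 (fst z) else killed_mass * \<rho>0 (fst z)) * h z)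
      \<in> borel_measurable (lborel \<Otimes>\<^sub>M count_space UNIV)"
    by measurable
  have "(\<integral>\<^sup>+z. h z \<partial>end_measure) =
      (\<integral>\<^sup>+z. ennreal (if snd z then \<rho>1 (fst z) else killed_mass * \<rho>0 (fst z)) * h z \<partial>(lborel \<Otimes>\<^sub>M count_space UNIV))"
    unfolding end_measure_def by (rule nn_integral_density) measurable
  also have "\<dots> = (\<integral>\<^sup>+y. \<integral>\<^sup>+b. ennreal (if b then \<rho>1 y else killed_mass * \<rho>0 y) * h (y, b) \<partial>count_space UNIV \<partial>lborel)"
    by (simp only: lborel_bool.M2.nn_integral_fst[OF meas, symmetric] fst_conv snd_conv)
  also have "\<dots> = (\<integral>\<^sup>+y. ennreal (\<rho>1 y) * h (y, True) + ennreal (killed_mass * \<rho>0 y) * h (y, False) \<partial>lborel)"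
    by (simp add: nn_integral_count_space_finite UNIV_bool add.commute)
  also have "\<dots> = (\<integral>\<^sup>+y. ennreal (\<rho>1 y) * h (y, True) \<partial>lborel) +
    (\<integral>\<^sup>+y. ennreal (killed_mass * \<rho>0 y) * h (y, False) \<partial>lborel)"
    by (rule nn_integral_add) measurable
  finally show ?thesis .
qed

lemma prob_space_end_measure: "prob_space end_measure"
proof (rule prob_spaceI)
  have "emeasure end_measure (space end_measure) = (\<integral>\<^sup>+z. 1 \<partial>end_measure)"
    by simp
  also have "\<dots> = (\<integral>\<^sup>+y. ennreal (\<rho>1 y) \<partial>lborel) + ennreal killed_mass"
    by (subst nn_integral_end_measure)
      (simp_all add: ennreal_mult' killed_mass_nonneg nn_integral_cmult nn_integral_rho0)
  also have "\<dots> = ennreal (\<integral>y. \<rho>1 y \<partial>lborel) + ennreal killed_mass"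
    using nn_integral_eq_integral[OF rho1(1)] rho1(2) by simp
  also have "\<dots> = 1"
    using rho1(2,3) by (simp add: killed_mass_def flip: ennreal_plus)
  finally show "emeasure end_measure (space end_measure) = 1" .
qed

lemma AE_start_measure: "(AE x in start_measure. P x) \<longleftrightarrow> (AE x in lborel. 0 < \<rho>0 x \<longrightarrow> P x)"
  unfolding start_measure_def by (subst AE_density) auto

text \<open>The guard on the second claim reflects that the cemetery copy is a null set when
  \<open>killed_mass = 0\<close>.\<close>

lemma AE_end_measureD:
  assumes "AE z in end_measure. P z"
  shows "AE y in lborel. 0 < \<rho>1 y \<longrightarrow> P (y, True)"
    and "0 < killed_mass \<Longrightarrow> AE y in lborel. 0 < \<rho>0 y \<longrightarrow> P (y, False)"
proof -
  have "AE z in lborel \<Otimes>\<^sub>M count_space UNIV. 0 < (if snd z then \<rho>1 (fst z) else killed_mass * \<rho>0 (fst z)) \<longrightarrow> P z"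
    using assms unfolding end_measure_def by (subst (asm) AE_density) auto
  from lborel_bool.AE_pair[OF this]
  have *: "AE y in lborel. \<forall>b. 0 < (if b then \<rho>1 y else killed_mass * \<rho>0 y) \<longrightarrow> P (y, b)"
    by (simp only: AE_count_space fst_conv snd_conv ball_UNIV)
  show "AE y in lborel. 0 < \<rho>1 y \<longrightarrow> P (y, True)"
    using * by eventually_elim (metis (full_types))
  show "AE y in lborel. 0 < \<rho>0 y \<longrightarrow> P (y, False)" if "0 < killed_mass"
    using * by eventually_elim (metis (full_types) that mult_pos_pos)
qed

lemma AE_end_measureI:
  assumes [measurable]: "Measurable.pred (lborel \<Otimes>\<^sub>M count_space UNIV) P"
    and "AE y in lborel. 0 < \<rho>1 y \<longrightarrow> P (y, True)"
    and "0 < killed_mass \<Longrightarrow> AE y in lborel. 0 < \<rho>0 y \<longrightarrow> P (y, False)"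
  shows "AE z in end_measure. P z"
proof -
  have "AE z in lborel \<Otimes>\<^sub>M count_space UNIV. 0 < (if snd z then \<rho>1 (fst z) else killed_mass * \<rho>0 (fst z)) \<longrightarrow> P z"
  proof (rule lborel_bool.AE_pair_measure)
    have "AE y in lborel. 0 < killed_mass \<longrightarrow> 0 < \<rho>0 y \<longrightarrow> P (y, False)"
      using assms(3) by (cases "0 < killed_mass") auto
    with assms(2) show "AE y in lborel. AE b in count_space UNIV.
        0 < (if snd (y, b) then \<rho>1 (fst (y, b)) else killed_mass * \<rho>0 (fst (y, b))) \<longrightarrow> P (y, b)"
    proof eventually_elim
      case (elim y)
      then show ?case
        using rho0(2)[of y] killed_mass_nonneg by (auto simp: AE_count_space zero_less_mult_iff)
    qed
  qed measurable
  then show ?thesis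
    unfolding end_measure_def by (subst AE_density) auto
qed

lemma kernel_pos: "0 < kernel x z"
  using q_pos[of 0 1 x "fst z"] killing_prob_pos[of x] by (simp add: kernel_def)

lemma killing_prob_measurable[measurable]: "killing_prob \<in> borel_measurable borel"
  by (rule borel_measurable_continuous_onI[OF continuous_killing_prob])

lemma kernel_measurable[measurable]:
  "(\<lambda>(x, z). kernel x z) \<in> borel_measurable (start_measure \<Otimes>\<^sub>M end_measure)"
proof -
  have [measurable]: "(\<lambda>w. q 0 (fst w) 1 (fst (snd w))) \<in> borel_measurable (start_measure \<Otimes>\<^sub>M end_measure)"
    by (intro q_measurable) auto
  show ?thesis
    unfolding kernel_def split_beta' by measurable
qed

text \<open>With \<open>nn_integral_kernel_start_measure\<close> this is the dictionary to the
  reduced system: \<open>g\<close> is \<open>\<rho>1\<close> times \<open>G\<close> on the living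
  copy, and \<open>c\<close> is the integral of \<open>G\<close> over the cemetery, where the kernel
  is constant in the end point.\<close>

lemma nn_integral_kernel_end_measure:
  assumes [measurable]: "G \<in> borel_measurable (lborel \<Otimes>\<^sub>M count_space UNIV)" and G: "\<And>z. 0 \<le> G z"
  shows "(\<integral>\<^sup>+z. ennreal (kernel x z * G z) \<partial>end_measure) =
    backward (\<lambda>y. ennreal (\<rho>1 y * G (y, True))) (\<integral>\<^sup>+y. ennreal (killed_mass * \<rho>0 y * G (y, False)) \<partial>lborel) 0 x"
proof -
  have [measurable]: "(\<lambda>z. kernel x z) \<in> borel_measurable (lborel \<Otimes>\<^sub>M count_space UNIV)"
    using measurable_Pair2[OF kernel_measurable, of x] by (simp cong: measurable_cong_sets add: sets_end_measure)
  have k: "0 \<le> kernel x z" for z using kernel_pos[of x z] by simp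
  have "(\<integral>\<^sup>+y. ennreal (\<rho>1 y) * ennreal (kernel x (y, True) * G (y, True)) \<partial>lborel) =
      (\<integral>\<^sup>+y. ennreal (q 0 x 1 y) * ennreal (\<rho>1 y * G (y, True)) \<partial>lborel)"
    using rho1(2) G q_pos[of 0 1 x] by (simp add: kernel_def ennreal_mult less_imp_le mult_ac)
  moreover have "(\<integral>\<^sup>+y. ennreal (killed_mass * \<rho>0 y) * ennreal (kernel x (y, False) * G (y, False)) \<partial>lborel) =
      (\<integral>\<^sup>+y. kill 0 x * ennreal (killed_mass * \<rho>0 y * G (y, False)) \<partial>lborel)"
    using rho0(2) G killed_mass_nonneg killing_prob_pos[of x]
    by (simp add: kernel_def ennreal_mult less_imp_le mult_ac ennreal_killing_prob)
  ultimately show ?thesis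
    by (subst nn_integral_end_measure) (auto simp: backward_def nn_integral_cmult mult.commute)
qed

lemma nn_integral_kernel_start_measure:
  assumes [measurable]: "F \<in> borel_measurable borel" and F: "\<And>x. 0 \<le> F x"
  shows "(\<integral>\<^sup>+x. ennreal (kernel x (y, True) * F x) \<partial>start_measure) = forward (\<lambda>x. ennreal (\<rho>0 x * F x)) 1 y"
    and "(\<integral>\<^sup>+x. ennreal (kernel x (y, False) * F x) \<partial>start_measure) = (\<integral>\<^sup>+x. kill 0 x * ennreal (\<rho>0 x * F x) \<partial>lborel)"
proof -
  have [measurable]: "(\<lambda>x. q 0 x 1 y) \<in> borel_measurable borel"
    by (intro q_measurable) auto
  have "(\<integral>\<^sup>+x. ennreal (q 0 x 1 y * F x) \<partial>start_measure) = (\<integral>\<^sup>+x. ennreal (\<rho>0 x) * ennreal (q 0 x 1 y * F x) \<partial>lborel)"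
    unfolding start_measure_def by (rule nn_integral_density) measurable
  then show "(\<integral>\<^sup>+x. ennreal (kernel x (y, True) * F x) \<partial>start_measure) = forward (\<lambda>x. ennreal (\<rho>0 x * F x)) 1 y"
    using rho0(2) F q_pos[of 0 1 _ y] by (simp add: kernel_def forward_def ennreal_mult less_imp_le mult_ac)
  have "(\<integral>\<^sup>+x. ennreal (killing_prob x * F x) \<partial>start_measure) = (\<integral>\<^sup>+x. ennreal (\<rho>0 x) * ennreal (killing_prob x * F x) \<partial>lborel)"
    unfolding start_measure_def by (rule nn_integral_density) measurable
  then show "(\<integral>\<^sup>+x. ennreal (kernel x (y, False) * F x) \<partial>start_measure) = (\<integral>\<^sup>+x. kill 0 x * ennreal (\<rho>0 x * F x) \<partial>lborel)"
    using rho0(2) F killing_prob_pos by (simp add: kernel_def ennreal_mult less_imp_le mult_ac flip: ennreal_killing_prob)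
qed

end

section \<open>Solving the reduced system and returning to the full one\<close>

context schroedinger_data
begin

lemma compact_positive_bounds:
  fixes f :: "'z::topological_space \<Rightarrow> real"
  assumes "compact S" "S \<noteq> {}" "continuous_on S f" "\<And>x. 0 < f x"
  obtains c C where "0 < c" "\<And>x. x \<in> S \<Longrightarrow> c \<le> f x \<and> f x \<le> C"
  using continuous_attains_inf[OF assms(1-3)] continuous_attains_sup[OF assms(1-3)] assms(4) by metis

text \<open>Closed balls exhaust the start space, and their products with \<open>bool\<close> the
  end space. Both branches of the kernel are continuous and positive, hence bounded on compact sets;
  the extreme bounds serve for both.\<close>

lemma kernel_schroedinger_pair_exists: "\<exists>F G. schroedinger_pair start_measure end_measure kernel F G"
proof (rule schroedinger_pair_exists[OF prob_space_start_measure prob_space_end_measure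
      space_start_measure space_end_measure kernel_measurable])
  let ?A = "\<lambda>k::nat. cball (0 :: real ^ 'n) (real k)"
  have inc: "incseq ?A" by (auto simp: incseq_def)
  have UN: "(\<Union>k. ?A k) = UNIV"
    using real_arch_simple by (auto simp: mem_cball_0)
  show "?A k \<in> sets start_measure" for k by simp
  show "incseq ?A" "(\<Union>k. ?A k) = UNIV" by (fact inc UN)+
  show "?A k \<times> UNIV \<in> sets end_measure" for k
    by (simp add: sets_end_measure pair_measureI)
  show "incseq (\<lambda>k. ?A k \<times> (UNIV :: bool set))"
    using inc by (fastforce simp: incseq_def)
  have "(\<Union>k. ?A k \<times> (UNIV :: bool set)) = (\<Union>k. ?A k) \<times> UNIV" by blast
  then show "(\<Union>k. ?A k \<times> (UNIV :: bool set)) = UNIV"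
    by (simp only: UN UNIV_Times_UNIV)
  show "0 \<le> kernel x z" for x z using kernel_pos[of x z] by simp
  show "continuous_on (?A k) (\<lambda>x. kernel x z)" for k z
  proof (cases "snd z")
    case True
    then show ?thesis
      unfolding kernel_def by (simp, intro q_continuous continuous_intros) auto
  next
    case False
    then show ?thesis
      using continuous_on_subset[OF continuous_killing_prob] by (simp add: kernel_def)
  qed
  show "\<exists>c>0. \<exists>C. \<forall>x\<in>?A k. \<forall>z\<in>?A k \<times> (UNIV :: bool set). c \<le> kernel x z \<and> kernel x z \<le> C" for k
  proof -
    have "continuous_on (?A k \<times> ?A k) (\<lambda>w. q 0 (fst w) 1 (snd w))"
      by (intro q_continuous continuous_intros) auto
    then obtain c C where c: "0 < c"
      "\<And>w. w \<in> ?A k \<times> ?A k \<Longrightarrow> c \<le> q 0 (fst w) 1 (snd w) \<and> q 0 (fst w) 1 (snd w) \<le> C"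
      by (rule compact_positive_bounds[rotated 2]) (auto intro!: compact_Times q_pos)
    have "continuous_on (?A k) killing_prob"
      using continuous_killing_prob by (rule continuous_on_subset) simp
    then obtain d D where d: "0 < d" "\<And>x. x \<in> ?A k \<Longrightarrow> d \<le> killing_prob x \<and> killing_prob x \<le> D"
      by (rule compact_positive_bounds[rotated 2]) (auto intro!: killing_prob_pos)
    show ?thesis
    proof (rule exI[of _ "min c d"], intro conjI exI[of _ "max C D"] ballI)
      show "0 < min c d" using c(1) d(1) by simp
      fix x and z :: "(real ^ 'n) \<times> bool"
      assume x: "x \<in> ?A k" and z: "z \<in> ?A k \<times> UNIV"
      then have "c \<le> q 0 x 1 (fst z)" "q 0 x 1 (fst z) \<le> C"
        using c(2)[of "(x, fst z)"] by (auto simp: mem_Times_iff)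
      with d(2)[OF x] show "min c d \<le> kernel x z" "kernel x z \<le> max C D"
        by (auto simp: kernel_def)
    qed
  qed
qed

lemma reduced_system_exists: "\<exists>f g c. reduced_system f g c"
proof -
  obtain F G where pair: "schroedinger_pair start_measure end_measure kernel F G"
    using kernel_schroedinger_pair_exists by blast
  have [measurable]: "F \<in> borel_measurable borel" "G \<in> borel_measurable (lborel \<Otimes>\<^sub>M count_space UNIV)"
    and nonneg: "\<And>x. 0 \<le> F x" "\<And>z. 0 \<le> G z"
    and F: "AE x in start_measure. ennreal (F x) * (\<integral>\<^sup>+z. ennreal (kernel x z * G z) \<partial>end_measure) = 1"
    and G: "AE z in end_measure. ennreal (G z) * (\<integral>\<^sup>+x. ennreal (kernel x z * F x) \<partial>start_measure) = 1"
    using pair by (auto simp: schroedinger_pair_def cong: measurable_cong_sets)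
  define f where "f = (\<lambda>x. ennreal (\<rho>0 x * F x))"
  define g where "g = (\<lambda>y. ennreal (\<rho>1 y * G (y, True)))"
  define c where "c = (\<integral>\<^sup>+y. ennreal (killed_mass * \<rho>0 y * G (y, False)) \<partial>lborel)"
  have [measurable]: "f \<in> borel_measurable borel" "g \<in> borel_measurable borel"
    by (simp_all add: f_def g_def)
  have kernel_G: "(\<integral>\<^sup>+z. ennreal (kernel x z * G z) \<partial>end_measure) = backward g c 0 x" for x
    unfolding g_def c_def by (rule nn_integral_kernel_end_measure) (use nonneg in auto)
  have kernel_F: "(\<integral>\<^sup>+x. ennreal (kernel x (y, True) * F x) \<partial>start_measure) = forward f 1 y"
    "(\<integral>\<^sup>+x. ennreal (kernel x (y, False) * F x) \<partial>start_measure) = (\<integral>\<^sup>+x. kill 0 x * f x \<partial>lborel)" for y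
    unfolding f_def by (rule nn_integral_kernel_start_measure; use nonneg in simp)+
  let ?K = "\<integral>\<^sup>+x. kill 0 x * f x \<partial>lborel"
  have f0: "AE x in lborel. ennreal (\<rho>0 x) = backward g c 0 x * f x"
  proof -
    have "AE x in lborel. 0 < \<rho>0 x \<longrightarrow> ennreal (F x) * backward g c 0 x = 1"
      using F unfolding AE_start_measure kernel_G .
    then show ?thesis
    proof eventually_elim
      case (elim x)
      have "backward g c 0 x * f x = ennreal (\<rho>0 x) * (ennreal (F x) * backward g c 0 x)"
        using rho0(2) nonneg by (simp add: f_def ennreal_mult mult_ac)
      with elim rho0(2)[of x] show ?case by (cases "\<rho>0 x = 0") auto
    qed
  qed
  have g1: "AE y in lborel. ennreal (\<rho>1 y) = g y * forward f 1 y"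
  proof -
    have "AE y in lborel. 0 < \<rho>1 y \<longrightarrow> ennreal (G (y, True)) * forward f 1 y = 1"
      using AE_end_measureD(1)[OF G] unfolding kernel_F .
    then show ?thesis
    proof eventually_elim
      case (elim y)
      have "g y * forward f 1 y = ennreal (\<rho>1 y) * (ennreal (G (y, True)) * forward f 1 y)"
        using rho1(2) nonneg by (simp add: g_def ennreal_mult mult_ac)
      with elim rho1(2)[of y] show ?case by (cases "\<rho>1 y = 0") auto
    qed
  qed
  \<comment> \<open>The cemetery equation \<open>G (y, False) * ?K = 1\<close> holds for almost
    every \<open>y\<close> with \<open>\<rho>0 y > 0\<close>; integrating it against
    \<open>killed_mass * \<rho>0\<close> gives the equation for the single number
    \<open>c\<close>.\<close>
  have mass: "c * ?K = ennreal killed_mass"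
  proof (cases "0 < killed_mass")
    case True
    have "AE y in lborel. 0 < \<rho>0 y \<longrightarrow> ennreal (G (y, False)) * ?K = 1"
      using AE_end_measureD(2)[OF G True] unfolding kernel_F .
    then have AE: "AE y in lborel. ennreal (killed_mass * \<rho>0 y * G (y, False)) * ?K = ennreal killed_mass * ennreal (\<rho>0 y)"
    proof eventually_elim
      case (elim y)
      have "ennreal (killed_mass * \<rho>0 y * G (y, False)) * ?K =
          ennreal killed_mass * (ennreal (\<rho>0 y) * (ennreal (G (y, False)) * ?K))"
        using rho0(2) nonneg killed_mass_nonneg by (simp add: ennreal_mult mult_ac)
      with elim rho0(2)[of y] show ?case by (cases "\<rho>0 y = 0") auto
    qed
    have "c * ?K = (\<integral>\<^sup>+y. ennreal (killed_mass * \<rho>0 y * G (y, False)) * ?K \<partial>lborel)"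
      unfolding c_def by (rule nn_integral_multc[symmetric]) measurable
    also have "\<dots> = (\<integral>\<^sup>+y. ennreal killed_mass * ennreal (\<rho>0 y) \<partial>lborel)"
      by (rule nn_integral_cong_AE[OF AE])
    also have "\<dots> = ennreal killed_mass"
      by (simp add: nn_integral_cmult nn_integral_rho0)
    finally show ?thesis .
  next
    case False
    then have "killed_mass = 0" using killed_mass_nonneg by simp
    then show ?thesis by (simp add: c_def)
  qed
  \<comment> \<open>Since \<open>c * ?K\<close> is finite, an infinite \<open>c\<close> needs
    \<open>?K = 0\<close>; then \<open>killed_mass = 0\<close>, and the integral defining
    \<open>c\<close> vanishes.\<close>
  have "c \<noteq> \<infinity>"
  proof
    assume c: "c = \<infinity>"
    with mass have "?K = 0"
      by (auto simp: ennreal_top_mult split: if_splits)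
    with mass have "killed_mass = 0" using killed_mass_nonneg by simp
    then have "c = 0" by (simp add: c_def)
    with c show False by simp
  qed
  with f0 g1 mass have "reduced_system f g c"
    by (simp add: reduced_system_def less_top)
  then show ?thesis by blast
qed

text \<open>As \<open>q\<close> and the killing probability are positive, a solution cannot vanish anywhere in the
  interior; this excludes the junk products \<open>0 * \<infinity>\<close> and forces \<open>f\<close> and \<open>g\<close> to be finite a.e.\<close>

lemma reduced_systemD:
  assumes "reduced_system f g c"
  defines "F \<equiv> \<lambda>x. enn2real (f x) / \<rho>0 x"
    and "G \<equiv> \<lambda>z. if snd z then enn2real (g (fst z)) / \<rho>1 (fst z) else enn2real c / killed_mass"
  shows "schroedinger_pair start_measure end_measure kernel F G"
    and "AE x in lborel. f x = ennreal (\<rho>0 x * F x)"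
    and "AE y in lborel. g y = ennreal (\<rho>1 y * G (y, True))"
    and "\<And>y. c = ennreal (killed_mass * G (y, False))"
proof -
  have [measurable]: "f \<in> borel_measurable borel" "g \<in> borel_measurable borel" and c: "c < \<infinity>"
    and f0: "AE x in lborel. ennreal (\<rho>0 x) = backward g c 0 x * f x"
    and g1: "AE x in lborel. ennreal (\<rho>1 x) = g x * forward f 1 x"
    and mass: "c * (\<integral>\<^sup>+x. kill 0 x * f x \<partial>lborel) = ennreal killed_mass"
    using assms(1) by (auto simp: reduced_system_def)
  let ?K = "\<integral>\<^sup>+x. kill 0 x * f x \<partial>lborel"
  have [measurable]: "F \<in> borel_measurable borel" "G \<in> borel_measurable (lborel \<Otimes>\<^sub>M count_space UNIV)"
    unfolding F_def G_def by measurable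
  have nonneg: "0 \<le> F x" "0 \<le> G z" for x z
    using rho0(2) rho1(2) killed_mass_nonneg by (auto simp: F_def G_def)
  have q0[measurable]: "(\<lambda>y. q 0 x 1 y) \<in> borel_measurable borel" "(\<lambda>y. q 0 y 1 x) \<in> borel_measurable borel" for x
    by (intro q_measurable; simp)+
  have q_ne: "ennreal (q 0 x 1 y) \<noteq> 0" for x y using q_pos[of 0 1 x y] by simp
  obtain x1 where x1: "0 < \<rho>0 x1" "ennreal (\<rho>0 x1) = backward g c 0 x1 * f x1"
    using rho0_AE_witness[OF f0] .
  have f_ne: "\<not> (AE x in lborel. f x = 0)"
  proof
    assume "AE x in lborel. f x = 0"
    with f0 have rho0_0: "AE x in lborel. \<rho>0 x = 0"
      by eventually_elim (use rho0(2) in \<open>auto simp: ennreal_eq_0_iff intro: antisym\<close>)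
    show False
      by (rule rho0_AE_witness[OF rho0_0]) simp
  qed
  \<comment> \<open>Vanishing at one point would force \<open>c = 0\<close> and \<open>g = 0\<close>
    almost everywhere, by positivity of the killing probability and of \<open>q\<close>. Then
    \<open>backward g c 0\<close> would vanish identically, contrary to its value at
    \<open>x1\<close>.\<close>
  have backward_pos: "backward g c 0 x \<noteq> 0" for x
  proof
    assume "backward g c 0 x = 0"
    then have "c = 0" "AE y in lborel. g y = 0"
      using kill_pos[of x] q_ne by (auto simp: backward_def nn_integral_0_iff_AE)
    then have "backward g c 0 x1 = 0"
      by (auto simp: backward_def nn_integral_0_iff_AE)
    with x1 show False by simp
  qed
  have forward_pos: "forward f 1 y \<noteq> 0" for y
    using f_ne q_ne by (auto simp: forward_def nn_integral_0_iff_AE)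
  have K_pos: "?K \<noteq> 0"
    using f_ne kill_pos by (auto simp: nn_integral_0_iff_AE less_imp_neq[symmetric])
  have finite_factor: "b \<noteq> \<infinity>" if "ennreal r = a * b" "a \<noteq> 0" for r a b
    using that by (auto simp: ennreal_mult_top)
  show f: "AE x in lborel. f x = ennreal (\<rho>0 x * F x)"
    using f0
  proof eventually_elim
    case (elim x)
    from finite_factor[OF elim backward_pos] have fin: "ennreal (enn2real (f x)) = f x" by (simp add: less_top)
    show ?case
    \<comment> \<open>Where \<open>\<rho>0\<close> vanishes, so does \<open>f\<close>, because
      \<open>backward g c 0\<close> does not; this matches the value \<open>0\<close> of division by
      zero in \<open>F\<close>.\<close>
    proof (cases "\<rho>0 x = 0")
      case True
      with elim backward_pos show ?thesis by (auto simp: F_def)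
    qed (simp add: F_def fin)
  qed
  show g: "AE y in lborel. g y = ennreal (\<rho>1 y * G (y, True))"
    using g1
  proof eventually_elim
    case (elim y)
    from finite_factor[of "\<rho>1 y" "forward f 1 y" "g y"] elim forward_pos
    have fin: "ennreal (enn2real (g y)) = g y" by (simp add: less_top mult.commute)
    show ?case
    proof (cases "\<rho>1 y = 0")
      case True
      with elim forward_pos show ?thesis by (auto simp: G_def)
    qed (simp add: G_def fin)
  qed
  show c_eq: "c = ennreal (killed_mass * G (y, False))" for y
  proof (cases "killed_mass = 0")
    case True
    with mass K_pos show ?thesis by simp
  next
    case False
    then show ?thesis using c by (simp add: G_def)
  qed
  have c_int: "c = (\<integral>\<^sup>+y. ennreal (killed_mass * \<rho>0 y * G (y, False)) \<partial>lborel)"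
  proof -
    have "(\<integral>\<^sup>+y. ennreal (killed_mass * \<rho>0 y * G (y, False)) \<partial>lborel) = (\<integral>\<^sup>+y. c * ennreal (\<rho>0 y) \<partial>lborel)"
    proof (rule nn_integral_cong)
      fix y
      have "ennreal (killed_mass * \<rho>0 y * G (y, False)) = ennreal (killed_mass * G (y, False)) * ennreal (\<rho>0 y)"
        using rho0(2) nonneg killed_mass_nonneg by (simp add: ennreal_mult mult_ac)
      then show "ennreal (killed_mass * \<rho>0 y * G (y, False)) = c * ennreal (\<rho>0 y)"
        by (simp only: c_eq[of y, symmetric])
    qed
    then show ?thesis by (simp add: nn_integral_cmult nn_integral_rho0)
  qed
  have cancel: "b * a = 1" if "ennreal r * (b * a) = ennreal r" "0 < r" for a b r
    using that ennreal_mult_cancel_left[of "ennreal r" "b * a" 1] by simp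
  have "backward (\<lambda>y. ennreal (\<rho>1 y * G (y, True))) c 0 x = backward g c 0 x" for x
    unfolding backward_def by (intro arg_cong2[where f = "(+)"] nn_integral_cong_AE refl)
      (use g in eventually_elim, simp)
  then have kernel_N: "(\<integral>\<^sup>+z. ennreal (kernel x z * G z) \<partial>end_measure) = backward g c 0 x" for x
    by (simp add: nn_integral_kernel_end_measure nonneg flip: c_int)
  have "forward (\<lambda>x. ennreal (\<rho>0 x * F x)) 1 y = forward f 1 y" for y
    unfolding forward_def by (intro nn_integral_cong_AE) (use f in eventually_elim, simp)
  then have kernel_M_True: "(\<integral>\<^sup>+x. ennreal (kernel x (y, True) * F x) \<partial>start_measure) = forward f 1 y" for y
    by (simp add: nn_integral_kernel_start_measure nonneg)
  have "(\<integral>\<^sup>+x. kill 0 x * ennreal (\<rho>0 x * F x) \<partial>lborel) = ?K"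
    by (intro nn_integral_cong_AE) (use f in eventually_elim, simp)
  then have kernel_M_False: "(\<integral>\<^sup>+x. ennreal (kernel x (y, False) * F x) \<partial>start_measure) = ?K" for y
    by (simp add: nn_integral_kernel_start_measure nonneg)
  have F_AE: "AE x in start_measure. ennreal (F x) * (\<integral>\<^sup>+z. ennreal (kernel x z * G z) \<partial>end_measure) = 1"
    unfolding AE_start_measure kernel_N using f0 f
  proof eventually_elim
    case (elim x)
    have "ennreal (\<rho>0 x) * (ennreal (F x) * backward g c 0 x) = backward g c 0 x * f x"
      using elim(2) rho0(2) nonneg by (simp add: ennreal_mult mult_ac)
    then have "ennreal (\<rho>0 x) * (ennreal (F x) * backward g c 0 x) = ennreal (\<rho>0 x)"
      using elim(1) by simp
    with cancel show ?case by blast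
  qed
  have G_AE: "AE z in end_measure. ennreal (G z) * (\<integral>\<^sup>+x. ennreal (kernel x z * F x) \<partial>start_measure) = 1"
  proof (rule AE_end_measureI)
    interpret S: prob_space start_measure by (rule prob_space_start_measure)
    have [measurable]: "(\<lambda>w. kernel (snd w) (fst w)) \<in> borel_measurable (end_measure \<Otimes>\<^sub>M start_measure)"
      using measurable_pair_swap[OF kernel_measurable] by (simp add: split_beta')
    have "(\<lambda>z. \<integral>\<^sup>+x. ennreal (kernel x z * F x) \<partial>start_measure) \<in> borel_measurable end_measure"
      by (intro S.borel_measurable_nn_integral) (simp add: split_beta')
    then have [measurable]: "(\<lambda>z. \<integral>\<^sup>+x. ennreal (kernel x z * F x) \<partial>start_measure) \<in> borel_measurable (lborel \<Otimes>\<^sub>M count_space UNIV)"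
      by (simp add: sets_end_measure cong: measurable_cong_sets)
    show "Measurable.pred (lborel \<Otimes>\<^sub>M count_space UNIV)
        (\<lambda>z. ennreal (G z) * (\<integral>\<^sup>+x. ennreal (kernel x z * F x) \<partial>start_measure) = 1)"
      by measurable
    show "AE y in lborel. 0 < \<rho>1 y \<longrightarrow>
        ennreal (G (y, True)) * (\<integral>\<^sup>+x. ennreal (kernel x (y, True) * F x) \<partial>start_measure) = 1"
      unfolding kernel_M_True using g1 g
    proof eventually_elim
      case (elim y)
      have "ennreal (\<rho>1 y) * (ennreal (G (y, True)) * forward f 1 y) = g y * forward f 1 y"
        using elim(2) rho1(2) nonneg by (simp add: ennreal_mult mult_ac)
      then have "ennreal (\<rho>1 y) * (ennreal (G (y, True)) * forward f 1 y) = ennreal (\<rho>1 y)"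
        using elim(1) by simp
      with cancel show ?case by blast
    qed
    assume pos: "0 < killed_mass"
    have "ennreal (G (y, False)) * ?K = 1" for y
    proof (rule cancel[OF _ pos])
      have "ennreal killed_mass * (ennreal (G (y, False)) * ?K) = c * ?K"
        using c_eq[of y] nonneg killed_mass_nonneg by (simp add: ennreal_mult mult_ac)
      with mass show "ennreal killed_mass * (ennreal (G (y, False)) * ?K) = ennreal killed_mass" by simp
    qed
    then show "AE y in lborel. 0 < \<rho>0 y \<longrightarrow>
        ennreal (G (y, False)) * (\<integral>\<^sup>+x. ennreal (kernel x (y, False) * F x) \<partial>start_measure) = 1"
      unfolding kernel_M_False by simp
  qed
  show "schroedinger_pair start_measure end_measure kernel F G"
    unfolding schroedinger_pair_def using F_AE G_AE nonneg
    by (simp cong: measurable_cong_sets add: sets_end_measure)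
qed

lemma reduced_system_unique:
  assumes "reduced_system f g c" "reduced_system f' g' c'"
  obtains \<kappa> where "0 < \<kappa>" "AE x in lborel. f' x = ennreal \<kappa> * f x"
    "AE y in lborel. g' y = ennreal (inverse \<kappa>) * g y" "c' = ennreal (inverse \<kappa>) * c"
proof -
  define F where "F f = (\<lambda>x. enn2real (f x) / \<rho>0 x)" for f
  define G where "G g c = (\<lambda>z. if snd z then enn2real (g (fst z)) / \<rho>1 (fst z) else enn2real c / killed_mass)"
    for g :: "real ^ 'n \<Rightarrow> ennreal" and c
  have pair: "schroedinger_pair start_measure end_measure kernel (F f) (G g c)"
    and f: "AE x in lborel. f x = ennreal (\<rho>0 x * F f x)"
    and g: "AE y in lborel. g y = ennreal (\<rho>1 y * G g c (y, True))"
    and c: "c = ennreal (killed_mass * G g c (y, False))" if "reduced_system f g c" for f g c y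
    unfolding F_def G_def by (rule reduced_systemD[OF that])+
  obtain \<kappa> where \<kappa>: "0 < \<kappa>" "AE x in start_measure. F f' x = \<kappa> * F f x"
    "AE z in end_measure. G g' c' z = inverse \<kappa> * G g c z"
    using schroedinger_pair_unique[OF prob_space_start_measure prob_space_end_measure kernel_measurable kernel_pos pair[OF assms(1)] pair[OF assms(2)]] .
  have FG: "0 \<le> F f x" "0 \<le> G g c z" for x z
    using rho0(2) rho1(2) killed_mass_nonneg by (auto simp: F_def G_def)
  have "AE x in lborel. f' x = ennreal \<kappa> * f x"
    using \<kappa>(2)[unfolded AE_start_measure] f[OF assms(1)] f[OF assms(2)]
  proof eventually_elim
    case (elim x)
    have "\<rho>0 x * F f' x = \<kappa> * (\<rho>0 x * F f x)"
      using elim(1) rho0(2)[of x] by (cases "\<rho>0 x = 0") auto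
    moreover have "ennreal (\<kappa> * (\<rho>0 x * F f x)) = ennreal \<kappa> * ennreal (\<rho>0 x * F f x)"
      using \<kappa>(1) FG rho0(2) by (intro ennreal_mult) auto
    ultimately show ?case
      unfolding elim(2,3) by (simp only:)
  qed
  moreover have "AE y in lborel. g' y = ennreal (inverse \<kappa>) * g y"
    using AE_end_measureD(1)[OF \<kappa>(3)] g[OF assms(1)] g[OF assms(2)]
  proof eventually_elim
    case (elim y)
    have "\<rho>1 y * G g' c' (y, True) = inverse \<kappa> * (\<rho>1 y * G g c (y, True))"
      using elim(1) rho1(2)[of y] by (cases "\<rho>1 y = 0") auto
    moreover have "ennreal (inverse \<kappa> * (\<rho>1 y * G g c (y, True))) = ennreal (inverse \<kappa>) * ennreal (\<rho>1 y * G g c (y, True))"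
      using \<kappa>(1) FG rho1(2) by (intro ennreal_mult) auto
    ultimately show ?case
      unfolding elim(2,3) by (simp only:)
  qed
  \<comment> \<open>If the cemetery has mass, any typical point of it gives the ratio; otherwise
    both constants are \<open>0\<close>, as they carry the factor
    \<open>killed_mass\<close>.\<close>
  moreover have "c' = ennreal (inverse \<kappa>) * c"
  proof (cases "0 < killed_mass")
    case True
    obtain y where "G g' c' (y, False) = inverse \<kappa> * G g c (y, False)"
      using rho0_AE_witness[OF AE_end_measureD(2)[OF \<kappa>(3) True]] by metis
    then have "ennreal (killed_mass * G g' c' (y, False)) = ennreal (inverse \<kappa>) * ennreal (killed_mass * G g c (y, False))"
      using \<kappa>(1) FG killed_mass_nonneg by (simp add: ennreal_mult mult_ac)
    then show ?thesis by (simp only: c[OF assms(1), of y, symmetric] c[OF assms(2), of y, symmetric])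
  next
    case False
    then have "killed_mass = 0" using killed_mass_nonneg by simp
    then have "c = 0" "c' = 0" using c[OF assms(1)] c[OF assms(2)] by (metis ennreal_0 mult_zero_left)+
    then show ?thesis by simp
  qed
  ultimately show ?thesis using \<kappa>(1) that by blast
qed

lemma schroedinger_system_exists: "\<exists>\<phi>h \<psi>h \<phi> \<psi>. schroedinger_system V q \<rho>0 \<rho>1 \<phi>h \<psi>h \<phi> \<psi>"
  using reduced_system_exists schroedinger_system_of_reduced by blast

text \<open>Only \<open>\<phi>h 0\<close>, \<open>\<phi> 1\<close> and \<open>\<psi> 0\<close> have
  to be compared, as they determine the rest. Integrals against \<open>q\<close> ignore null sets,
  so the scaling holds pointwise for \<open>\<phi>h\<close> at \<open>t > 0\<close> and for
  \<open>\<phi>\<close> at \<open>t < 1\<close>.\<close>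

lemma schroedinger_system_unique:
  assumes S: "schroedinger_system V q \<rho>0 \<rho>1 \<phi>h \<psi>h \<phi> \<psi>"
    and S': "schroedinger_system V q \<rho>0 \<rho>1 \<phi>h' \<psi>h' \<phi>' \<psi>'"
  shows "\<exists>\<kappa>>0. \<forall>t\<in>{0..1}.
    (AE x in lborel. \<phi>h' t x = ennreal \<kappa> * \<phi>h t x) \<and> \<psi>h' t = ennreal \<kappa> * \<psi>h t \<and>
    (AE x in lborel. \<phi>' t x = ennreal (inverse \<kappa>) * \<phi> t x) \<and> \<psi>' t = ennreal (inverse \<kappa>) * \<psi> t"
proof -
  note D = schroedinger_systemD[OF S] and D' = schroedinger_systemD[OF S']
  have meas[measurable]: "\<phi>h 0 \<in> borel_measurable borel" "\<phi>h' 0 \<in> borel_measurable borel" "\<phi> 1 \<in> borel_measurable borel"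
    using D(5) D'(5) by (auto simp: reduced_system_def)
  obtain \<kappa> where \<kappa>: "0 < \<kappa>" and f: "AE x in lborel. \<phi>h' 0 x = ennreal \<kappa> * \<phi>h 0 x"
    and g: "AE y in lborel. \<phi>' 1 y = ennreal (inverse \<kappa>) * \<phi> 1 y" and c: "\<psi>' 0 = ennreal (inverse \<kappa>) * \<psi> 0"
    using reduced_system_unique[OF D(5) D'(5)] .
  have \<phi>h: "\<phi>h' t x = ennreal \<kappa> * \<phi>h t x" if t: "t \<in> {0<..1}" for t x
  proof -
    have [measurable]: "(\<lambda>x0. q 0 x0 t x) \<in> borel_measurable borel"
      using t by (intro q_measurable) auto
    have "forward (\<phi>h' 0) t x = (\<integral>\<^sup>+x0. ennreal \<kappa> * (ennreal (q 0 x0 t x) * \<phi>h 0 x0) \<partial>lborel)"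
      unfolding forward_def by (intro nn_integral_cong_AE) (use f in eventually_elim, simp add: mult_ac)
    also have "\<dots> = ennreal \<kappa> * forward (\<phi>h 0) t x"
      unfolding forward_def by (rule nn_integral_cmult) measurable
    finally show ?thesis using D(1)[OF t] D'(1)[OF t] by simp
  qed
  have \<phi>: "\<phi>' t x = ennreal (inverse \<kappa>) * \<phi> t x" if t: "t \<in> {0..<1}" for t x
  proof -
    have [measurable]: "(\<lambda>y. q t x 1 y) \<in> borel_measurable borel"
      using t by (intro q_measurable) auto
    have "(\<integral>\<^sup>+y. ennreal (q t x 1 y) * \<phi>' 1 y \<partial>lborel) =
        (\<integral>\<^sup>+y. ennreal (inverse \<kappa>) * (ennreal (q t x 1 y) * \<phi> 1 y) \<partial>lborel)"
      by (intro nn_integral_cong_AE) (use g in eventually_elim, simp add: mult_ac)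
    also have "\<dots> = ennreal (inverse \<kappa>) * (\<integral>\<^sup>+y. ennreal (q t x 1 y) * \<phi> 1 y \<partial>lborel)"
      by (rule nn_integral_cmult) measurable
    finally have "backward (\<phi>' 1) (\<psi>' 0) t x = ennreal (inverse \<kappa>) * backward (\<phi> 1) (\<psi> 0) t x"
      by (simp add: backward_def c distrib_left mult.assoc)
    then show ?thesis using D(2)[OF t] D'(2)[OF t] by simp
  qed
  have \<psi>h: "\<psi>h' t = ennreal \<kappa> * \<psi>h t" if t: "t \<in> {0..1}" for t
    unfolding D(4)[OF t] D'(4)[OF t] using t f
    by (intro killed_mass_upto_scale[OF meas(1) meas(2) _ D(1) D'(1)]) auto
  show ?thesis
  proof (intro exI[of _ \<kappa>] conjI \<kappa> ballI)
    fix t :: real assume t: "t \<in> {0..1}"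
    show "AE x in lborel. \<phi>h' t x = ennreal \<kappa> * \<phi>h t x"
      using f \<phi>h[of t] t by (cases "t = 0") auto
    show "AE x in lborel. \<phi>' t x = ennreal (inverse \<kappa>) * \<phi> t x"
      using g \<phi>[of t] t by (cases "t = 1") auto
    show "\<psi>h' t = ennreal \<kappa> * \<psi>h t" by (rule \<psi>h[OF t])
    show "\<psi>' t = ennreal (inverse \<kappa>) * \<psi> t"
      using c D(3)[OF t] D'(3)[OF t] by simp
  qed
qed

end

theorem theorem9:
  fixes b :: "real \<Rightarrow> real ^ 'n \<Rightarrow> real ^ 'n"
    and \<sigma> :: "real \<Rightarrow> real ^ 'n \<Rightarrow> real ^ 'm ^ 'n"
    and V :: "real \<Rightarrow> real ^ 'n \<Rightarrow> real"
    and q :: "real \<Rightarrow> real ^ 'n \<Rightarrow> real \<Rightarrow> real ^ 'n \<Rightarrow> real"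
    and \<rho>0 \<rho>1 :: "real ^ 'n \<Rightarrow> real"
  assumes V_cont: "continuous_on ({0..1} \<times> UNIV) (\<lambda>(t, x). V t x)"
    and V_nonneg: "\<And>t x. t \<in> {0..1} \<Longrightarrow> 0 \<le> V t x"
    and V_nonzero: "\<exists>t\<in>{0..1}. \<exists>x. V t x \<noteq> 0"
    and a_pos_def: "\<And>t x. t \<in> {0..1} \<Longrightarrow> positive_definite (diffusion_matrix \<sigma> t x)"
    and rho0: "integrable lborel \<rho>0" "\<And>x. 0 \<le> \<rho>0 x" "(\<integral>x. \<rho>0 x \<partial>lborel) = 1"
    and rho1: "integrable lborel \<rho>1" "\<And>x. 0 \<le> \<rho>1 x" "(\<integral>x. \<rho>1 x \<partial>lborel) \<le> 1"
    and q_fundamental: "fundamental_solution b V (diffusion_matrix \<sigma>) q"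
    and q_transition: "killed_transition_density V q"
    and q_cont: "continuous_on {(s, x, t, y). 0 \<le> s \<and> s < t \<and> t \<le> 1} (\<lambda>(s, x, t, y). q s x t y)"
    and q_pos: "\<And>s x t y. 0 \<le> s \<Longrightarrow> s < t \<Longrightarrow> t \<le> 1 \<Longrightarrow> 0 < q s x t y"
  shows "(\<exists>\<phi>h \<psi>h \<phi> \<psi>. schroedinger_system V q \<rho>0 \<rho>1 \<phi>h \<psi>h \<phi> \<psi>) \<and>
    (\<forall>\<phi>h \<psi>h \<phi> \<psi> \<phi>h' \<psi>h' \<phi>' \<psi>'.
      schroedinger_system V q \<rho>0 \<rho>1 \<phi>h \<psi>h \<phi> \<psi> \<and>
      schroedinger_system V q \<rho>0 \<rho>1 \<phi>h' \<psi>h' \<phi>' \<psi>' \<longrightarrow>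
      (\<exists>\<kappa>>0. \<forall>t\<in>{0..1}.
        (AE x in lborel. \<phi>h' t x = ennreal \<kappa> * \<phi>h t x) \<and>
        \<psi>h' t = ennreal \<kappa> * \<psi>h t \<and>
        (AE x in lborel. \<phi>' t x = ennreal (inverse \<kappa>) * \<phi> t x) \<and>
        \<psi>' t = ennreal (inverse \<kappa>) * \<psi> t))"
proof -
  interpret schroedinger_data V q \<rho>0 \<rho>1
    by unfold_locales (fact assms)+
  show ?thesis
    using schroedinger_system_exists schroedinger_system_unique by blast
qed

end
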